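(* Let $Q$ be the $q$-matrix on $\mathbf{Z}_+^d$ defined in the context, let $P(t)=(p_{\mathbf{i}\mathbf{j}}(t))$ be its $Q$-function and $\lambda_{\mathcal{C}}$ the decay parameter of $P(t)$ on $\mathcal{C}=\mathbf{Z}_+^d\setminus\{\mathbf{0}\}$. Then for any $\lambda\in[0,\lambda_{\mathcal{C}}]$: (i) There exists a $\lambda$-invariant measure $(m_{\mathbf{i}}:\mathbf{i}\in\mathcal{C})$ for $Q$ on $\mathcal{C}$. Moreover, the generating function $M(\mathbf{x})=\sum_{\mathbf{i}\in\mathcal{C}}m_{\mathbf{i}}\mathbf{x}^{\mathbf{i}}$ of this $\lambda$-invariant measure satisfies $$\lambda M(\mathbf{x})+\sum_{r=1}^dB_r(\mathbf{x})M^{(r)}(\mathbf{x})=\sum_{r=1}^dm_{\mathbf{e}_r}\,\mu_r\gamma_{r0},\qquad \mathbf{x}\in\prod_{s=1}^d[0,q_s),$$ where $M^{(r)}(\mathbf{x})=\sum_{\mathbf{i}\in\mathcal{C}_r^+}m_{\mathbf{i}}\mathbf{x}^{\mathbf{i}-\mathbf{e}_r}$, $\mathcal{C}_r^+=\{\mathbf{i}\in\mathcal{C}:i_r>0\}$, and $m_{\mathbf{e}_r}$ ($r=1,\dots,d$) are positive constants. (ii) This measure $(m_{\mathbf{i}}:\mathbf{i}\in\mathcal{C})$ is also a $\lambda$-invariant measure for $P(t)$ on $\mathcal{C}$. (iii) This $\lambda$-invariant measure is convergent (i.e. $\sum_{\mathbf{i}\in\mathcal{C}}m_{\mathbf{i}}<\infty$)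 if and only if $\rho(\mathbf{1})<0$, $\lambda_{\mathcal{C}}>0$ and $\lambda\in(0,\lambda_{\mathcal{C}}]$.
   Context: Parameters. Let $d\ge 2$. For $1\le r\le d$ let $\lambda_{rl}\ge 0$ ($l\ge 1$) with $\lambda_r:=\sum_{l\ge1}\lambda_{rl}\in(0,\infty)$, let $\mu_r>0$, and let $\gamma_{rs}\ge 0$ ($0\le s\le d$) with $\sum_{s=0}^d\gamma_{rs}=1$, $\gamma_{rr}=0$. Assume $\gamma_{r0}>0$ for some $r\in\{1,\dots,d\}$ and that the matrix $(\gamma_{rs})_{1\le r,s\le d}$ is irreducible. Let $\mathbf{e}_r$ be the $r$th unit vector, $\mathbf{1}=(1,\dots,1)$ and $\mathbf{x}^{\mathbf{j}}=\prod_{r=1}^dx_r^{j_r}$. Generator. $Q=(q_{\mathbf{i}\mathbf{j}}:\mathbf{i},\mathbf{j}\in\mathbf{Z}_+^d)$ is given by: $q_{\mathbf{i}\mathbf{j}}=\lambda_{rl}$ if $i_r>0$ and $\mathbf{j}=\mathbf{i}+l\mathbf{e}_r$ ($l\ge1$); $q_{\mathbf{i}\mathbf{j}}=\mu_r\gamma_{r0}$ if $i_r>0$ and $\mathbf{j}=\mathbf{i}-\mathbf{e}_r$; $q_{\mathbf{i}\mathbf{j}}=\mu_r\gamma_{rs}$ if $i_r>0$ and $\mathbf{j}=\mathbf{i}-\mathbf{e}_r+\mathbf{e}_s$ ($1\le s\le d$, $s\ne r$); $q_{\mathbf{i}\mathbf{i}}=-\sum_{r:\,i_r>0}(\lambda_r+\mu_r)$;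 and $q_{\mathbf{i}\mathbf{j}}=0$ otherwise (so $\mathbf{0}$ is absorbing). The $Q$-function $P(t)$ is the (unique, Feller minimal) transition function of the continuous-time Markov chain with generator $Q$. The set $\mathcal{C}=\mathbf{Z}_+^d\setminus\{\mathbf{0}\}$ is an irreducible class. Decay parameter. $\lambda_{\mathcal{C}}=\sup\{\lambda\ge0:\int_0^\infty e^{\lambda t}p_{\mathbf{i}\mathbf{j}}(t)\,dt<\infty\}$, which does not depend on $\mathbf{i},\mathbf{j}\in\mathcal{C}$. Invariant measures. For $\lambda\ge 0$, a family $(m_{\mathbf{i}}:\mathbf{i}\in\mathcal{C})$ of positive numbers is a $\lambda$-invariant measure for $Q$ on $\mathcal{C}$ if $\sum_{\mathbf{i}\in\mathcal{C}}m_{\mathbf{i}}q_{\mathbf{i}\mathbf{j}}=-\lambda m_{\mathbf{j}}$ for all $\mathbf{j}\in\mathcal{C}$; it is $\lambda$-invariant for $P(t)$ on $\mathcal{C}$ if $\sum_{\mathbf{i}\in\mathcal{C}}m_{\mathbf{i}}p_{\mathbf{i}\mathbf{j}}(t)=e^{-\lambda t}m_{\mathbf{j}}$ for all $\mathbf{j}\in\mathcal{C}$, $t\ge0$. Generating functions. $B_r(\mathbf{x})=x_r\big(\sum_{k\ge1}\lambda_{rk}x_r^k-\lambda_r\big)+\mu_r\big(\gamma_{r0}+\sum_{s=1}^d\gamma_{rs}x_s\big)-\mu_rx_r$ and $\mathbf{B}=(B_1,\dots,B_d)$. $\mathbf{q}=(q_1,\dots,q_d)$ is the smallest nonnegative solution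 of $\mathbf{B}(\mathbf{x})=\mathbf{0}$ in $[0,1]^d$. $\rho(\mathbf{x})$ is the maximal (largest real) eigenvalue of the matrix $\mathbf{B}'(\mathbf{x})=(\partial B_r/\partial x_s(\mathbf{x}))_{r,s}$, where derivatives are given by termwise differentiation of the power series and $\rho(\mathbf{x})=+\infty$ if some entry is $+\infty$. *)

theory Defs
  imports "HOL-Analysis.Analysis"
begin

text \<open>
  The \<open>d\<close> coordinates are the elements of a finite type \<open>'d\<close>, and states are vectors of type
  \<open>nat ^ 'd\<close>; \<open>axis r l\<close> is the vector \<open>l e\<^sub>r\<close>. The parameters are
  \<open>lam r l\<close> (meaningful for \<open>l \<ge> 1\<close> only; \<open>lam r 0\<close> is never used), \<open>mu r\<close>, and
  \<open>gam r a\<close>, where \<open>a = None\<close> plays the role of the index \<open>0\<close> (leaving the system) and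
  \<open>a = Some s\<close> that of the index \<open>s\<close>.
\<close>

definition lam_total :: "('d \<Rightarrow> nat \<Rightarrow> real) \<Rightarrow> 'd \<Rightarrow> real" where
  "lam_total lam r = (\<Sum>l. lam r (Suc l))"

definition irreducible_nonneg_matrix :: "('d \<Rightarrow> 'd \<Rightarrow> real) \<Rightarrow> bool" where
  "irreducible_nonneg_matrix A \<longleftrightarrow> (\<forall>r s. (r, s) \<in> {(r, s). A r s > 0}\<^sup>+)"

text \<open>Off the diagonal, at most one summand below is nonzero for each pair of states.\<close>

definition gen ::
  "('d::finite \<Rightarrow> nat \<Rightarrow> real) \<Rightarrow> ('d \<Rightarrow> real) \<Rightarrow> ('d \<Rightarrow> 'd option \<Rightarrow> real)
    \<Rightarrow> nat ^ 'd \<Rightarrow> nat ^ 'd \<Rightarrow> real" where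
  "gen lam mu gam i j =
    (if j = i then - (\<Sum>r | i $ r > 0. lam_total lam r + mu r)
     else (\<Sum>r | i $ r > 0.
        (if j $ r > i $ r \<and> j = i + axis r (j $ r - i $ r) then lam r (j $ r - i $ r) else 0)
      + (if j = i - axis r 1 then mu r * gam r None else 0)
      + (\<Sum>s | s \<noteq> r. if j = i - axis r 1 + axis s 1 then mu r * gam r (Some s) else 0)))"

definition transition_function :: "(real \<Rightarrow> 'a \<Rightarrow> 'a \<Rightarrow> real) \<Rightarrow> bool" where
  "transition_function P \<longleftrightarrow>
     (\<forall>t\<ge>0. \<forall>i j. P t i j \<ge> 0) \<and>
     (\<forall>t\<ge>0. \<forall>i. P t i summable_on UNIV \<and> (\<Sum>\<^sub>\<infinity>j. P t i j) \<le> 1) \<and>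
     (\<forall>i j. P 0 i j = (if i = j then 1 else 0)) \<and>
     (\<forall>s\<ge>0. \<forall>t\<ge>0. \<forall>i j. ((\<lambda>k. P s i k * P t k j) has_sum P (s + t) i j) UNIV) \<and>
     (\<forall>i. ((\<lambda>t. P t i i) \<longlongrightarrow> 1) (at_right 0))"

text \<open>
  A \<open>Q\<close>-function is a standard transition function whose derivative at \<open>0\<close> is \<open>Q\<close>. The matrix
  \<open>gen lam mu gam\<close> is conservative with bounded diagonal, so it has exactly one
  \<open>Q\<close>-function, which is the Feller minimal one.
\<close>

definition Q_function :: "('a \<Rightarrow> 'a \<Rightarrow> real) \<Rightarrow> (real \<Rightarrow> 'a \<Rightarrow> 'a \<Rightarrow> real) \<Rightarrow> bool" where
  "Q_function Q P \<longleftrightarrow> transition_function P \<and>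
     (\<forall>i j. ((\<lambda>t. P t i j) has_real_derivative Q i j) (at 0 within {0..}))"

text \<open>The common value, for \<open>i, j \<in> C\<close>, of the abscissa of convergence.\<close>

definition decay_parameter :: "'a set \<Rightarrow> (real \<Rightarrow> 'a \<Rightarrow> 'a \<Rightarrow> real) \<Rightarrow> ereal" where
  "decay_parameter C P =
     (THE L. \<forall>i\<in>C. \<forall>j\<in>C.
        L = Sup (ereal ` {l. l \<ge> 0 \<and>
              (\<integral>\<^sup>+t\<in>{0..}. ennreal (exp (l * t) * P t i j) \<partial>lborel) < \<infinity>}))"

definition invariant_measure_Q ::
  "'a set \<Rightarrow> ('a \<Rightarrow> 'a \<Rightarrow> real) \<Rightarrow> real \<Rightarrow> ('a \<Rightarrow> real) \<Rightarrow> bool" where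
  "invariant_measure_Q C Q l m \<longleftrightarrow> (\<forall>i\<in>C. m i > 0) \<and>
     (\<forall>j\<in>C. ((\<lambda>i. m i * Q i j) has_sum (- l * m j)) C)"

definition invariant_measure_P ::
  "'a set \<Rightarrow> (real \<Rightarrow> 'a \<Rightarrow> 'a \<Rightarrow> real) \<Rightarrow> real \<Rightarrow> ('a \<Rightarrow> real) \<Rightarrow> bool" where
  "invariant_measure_P C P l m \<longleftrightarrow> (\<forall>i\<in>C. m i > 0) \<and>
     (\<forall>j\<in>C. \<forall>t\<ge>0. ((\<lambda>i. m i * P t i j) has_sum (exp (- l * t) * m j)) C)"

definition monomial :: "real ^ 'd \<Rightarrow> nat ^ 'd::finite \<Rightarrow> real" where
  "monomial x i = (\<Prod>r\<in>UNIV. (x $ r) ^ (i $ r))"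

definition gf :: "(nat ^ 'd::finite) set \<Rightarrow> (nat ^ 'd \<Rightarrow> real) \<Rightarrow> real ^ 'd \<Rightarrow> real" where
  "gf C m x = (\<Sum>\<^sub>\<infinity>i\<in>C. m i * monomial x i)"

definition gf_part ::
  "(nat ^ 'd::finite) set \<Rightarrow> (nat ^ 'd \<Rightarrow> real) \<Rightarrow> 'd \<Rightarrow> real ^ 'd \<Rightarrow> real" where
  "gf_part C m r x = (\<Sum>\<^sub>\<infinity>i\<in>{i\<in>C. i $ r > 0}. m i * monomial x (i - axis r 1))"

definition B ::
  "('d::finite \<Rightarrow> nat \<Rightarrow> real) \<Rightarrow> ('d \<Rightarrow> real) \<Rightarrow> ('d \<Rightarrow> 'd option \<Rightarrow> real)
    \<Rightarrow> 'd \<Rightarrow> real ^ 'd \<Rightarrow> real" where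
  "B lam mu gam r x =
     x $ r * ((\<Sum>k. lam r (Suc k) * (x $ r) ^ Suc k) - lam_total lam r)
     + mu r * (gam r None + (\<Sum>s\<in>UNIV. gam r (Some s) * x $ s)) - mu r * x $ r"

text \<open>The order on \<open>real ^ 'd\<close> is the componentwise one.\<close>

definition min_root ::
  "('d::finite \<Rightarrow> nat \<Rightarrow> real) \<Rightarrow> ('d \<Rightarrow> real) \<Rightarrow> ('d \<Rightarrow> 'd option \<Rightarrow> real) \<Rightarrow> real ^ 'd" where
  "min_root lam mu gam = (LEAST x. 0 \<le> x \<and> x \<le> 1 \<and> (\<forall>r. B lam mu gam r x = 0))"

text \<open>
  The termwise derivative \<open>\<partial>B\<^sub>r/\<partial>x\<^sub>s\<close> for \<open>x \<ge> 0\<close>; the series has nonnegative terms and may be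
  infinite.
\<close>

definition dB ::
  "('d::finite \<Rightarrow> nat \<Rightarrow> real) \<Rightarrow> ('d \<Rightarrow> real) \<Rightarrow> ('d \<Rightarrow> 'd option \<Rightarrow> real)
    \<Rightarrow> 'd \<Rightarrow> 'd \<Rightarrow> real ^ 'd \<Rightarrow> ereal" where
  "dB lam mu gam r s x =
     (if s = r
      then (\<Sum>k. ereal (real (Suc k + 1) * lam r (Suc k) * (x $ r) ^ Suc k))
           - ereal (lam_total lam r) - ereal (mu r)
      else 0)
     + ereal (mu r * gam r (Some s))"

definition max_real_eigenvalue :: "real ^ 'd ^ 'd::finite \<Rightarrow> real" where
  "max_real_eigenvalue A = Max {l. \<exists>v. v \<noteq> 0 \<and> A *v v = l *\<^sub>R v}"

definition rho ::
  "('d::finite \<Rightarrow> nat \<Rightarrow> real) \<Rightarrow> ('d \<Rightarrow> real) \<Rightarrow> ('d \<Rightarrow> 'd option \<Rightarrow> real) \<Rightarrow> real ^ 'd \<Rightarrow> ereal"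
  where
  "rho lam mu gam x =
     (if \<exists>r s. dB lam mu gam r s x = \<infinity> then \<infinity>
      else ereal (max_real_eigenvalue (\<chi> r s. real_of_ereal (dB lam mu gam r s x))))"

end

theory Submission
  imports Defs "HOL-Probability.Probability"
begin

text \<open>
  The generator has bounded diagonal, so the process is a discrete chain with kernel
  \<open>K = I + Q / rate\<close> run along a Poisson clock, and \<open>\<integral> e\<^sup>l\<^sup>t p\<^sub>i\<^sub>j(t) dt\<close> is a multiple of the Green
  function \<open>\<Sum>\<^sub>n R\<^sup>n K\<^sup>n(i,j)\<close> with \<open>R = rate / (rate - l)\<close>. Since every state has only finitely many
  predecessors, limits of \<open>G(k\<^sub>n, \<cdot>) / G(k\<^sub>n, o)\<close> along distinct starting points \<open>k\<^sub>n\<close> (and rates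
  increasing to \<open>l\<close>) exist and satisfy \<open>m = R m K\<close> exactly, hence invariance for \<open>Q\<close> and
  \<open>P(t)\<close>, even at \<open>l = \<lambda>\<^sub>C\<close>.

  If \<open>B(y) \<ge> 0\<close> and \<open>y < 1\<close>, then \<open>y\<^sup>i\<close> is a bounded submartingale, hence at most the extinction
  probability and so at most \<open>u(i) = E\<^sub>i e\<^sup>l\<^sup>T\<close>. Thus \<open>u - y\<^sup>i\<close> dominates the potential of
  its charge \<open>l y\<^sup>j + \<Sum>\<^sub>r B\<^sub>r(y) y\<^sup>j\<^sup>-\<^sup>e\<^sup>r\<close>, a bound that survives the limit. The iterates of
  \<open>x + B(x) / rate\<close> from \<open>0\<close> are such points and increase to the minimal root, so the generating
  functions converge below it; if it is \<open>1\<close> and \<open>l > 0\<close>, the measure is finite. Conversely, for a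
  finite measure the functional equation reads \<open>l (M(1) - M(x)) = \<Sum>\<^sub>r B\<^sub>r(x) M\<^sub>r(x)\<close>; at
  \<open>x = 1 - e v\<close> with \<open>v\<close> the Perron vector of \<open>B'(1)\<close> the left side is of order \<open>e\<close>, while
  \<open>\<rho>(1) \<ge> 0\<close> would make the right side at most \<open>o(e)\<close>.
\<close>

section \<open>Nonnegative kernels\<close>

text \<open>At the decay parameter itself the Green function may be infinite, which is why the rates
  only tend to \<open>l\<close>. The last-step identity for \<open>G(k, .)\<close> carries a source
  at \<open>k\<close>; it disappears in the limit only because the starting points are distinct.
  Infinite columns would leave no more than an inequality, by Fatou. Pointwise convergence says
  nothing about the total mass of the limit, and the functional equation cannot bound it either,
  since it presupposes that the series converge. The bound has to be proved before the limit,
  against a quantity that converges itself: the flow into the absorbing state, a finite sum over its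
  predecessors. This is what the potential inequality supplies. The test functions need
  \<open>y < 1\<close> strictly, because comparing \<open>y^i\<close> with the extinction
  probability requires \<open>y^i\<close> to vanish at infinity; and to control all parts of the
  generating function, also when \<open>l = 0\<close>, they need \<open>B_r(y) > 0\<close> for every
  \<open>r\<close>. The minimal root satisfies neither in general: \<open>B\<close> vanishes there
  and it may be 1. Its iterates satisfy both from some index on.\<close>

abbreviation nn_sum :: "('a \<Rightarrow> ennreal) \<Rightarrow> ennreal" (binder "\<Sum>\<^sup>+" 10) where
  "nn_sum f \<equiv> \<integral>\<^sup>+ x. f x \<partial>count_space UNIV"

abbreviation l1_sum :: "('a \<Rightarrow> real) \<Rightarrow> real" (binder "\<Sum>\<^sup>1" 10) where
  "l1_sum f \<equiv> integral\<^sup>L (count_space UNIV) f"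

abbreviation summable_l1 :: "('a \<Rightarrow> real) \<Rightarrow> bool" where
  "summable_l1 f \<equiv> integrable (count_space UNIV) f"

lemma nn_integral_count_space_swap:
  "(\<Sum>\<^sup>+ x. \<Sum>\<^sup>+ y. f x y) = (\<Sum>\<^sup>+ y. \<Sum>\<^sup>+ x. f x y)"
  using nn_integral_fst_count_space[of "\<lambda>(x, y). f x y"]
    nn_integral_snd_count_space[of "\<lambda>(x, y). f x y"] by simp

definition kop :: "('a \<Rightarrow> 'a \<Rightarrow> ennreal) \<Rightarrow> ('a \<Rightarrow> ennreal) \<Rightarrow> 'a \<Rightarrow> ennreal" where
  "kop K f i = (\<Sum>\<^sup>+ j. K i j * f j)"

definition kpow :: "('a \<Rightarrow> 'a \<Rightarrow> ennreal) \<Rightarrow> nat \<Rightarrow> 'a \<Rightarrow> 'a \<Rightarrow> ennreal" where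
  "kpow K n i j = (kop K ^^ n) (indicator {j}) i"

definition green :: "('a \<Rightarrow> 'a \<Rightarrow> ennreal) \<Rightarrow> real \<Rightarrow> 'a \<Rightarrow> 'a \<Rightarrow> ennreal" where
  "green K R i j = (\<Sum>n. ennreal (R ^ n) * kpow K n i j)"

lemma kop_add: "kop K (\<lambda>j. f j + g j) = (\<lambda>i. kop K f i + kop K g i)"
  by (rule ext) (simp add: kop_def distrib_left nn_integral_add)

lemma kop_cmult: "kop K (\<lambda>j. c * f j) = (\<lambda>i. c * kop K f i)"
  by (rule ext) (simp add: kop_def nn_integral_cmult mult.left_commute)

lemma kop_pow_add: "(kop K ^^ n) (\<lambda>j. f j + g j) = (\<lambda>i. (kop K ^^ n) f i + (kop K ^^ n) g i)"
  by (induction n) (simp_all add: kop_add)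

lemma kop_pow_cmult: "(kop K ^^ n) (\<lambda>j. c * f j) = (\<lambda>i. c * (kop K ^^ n) f i)"
  by (induction n) (simp_all add: kop_cmult)

lemma kpow_0: "kpow K 0 i j = indicator {j} i"
  by (simp add: kpow_def)

lemma kpow_Suc: "kpow K (Suc n) i j = (\<Sum>\<^sup>+ k. K i k * kpow K n k j)"
  by (simp add: kpow_def kop_def)

lemma kpow_1: "kpow K (Suc 0) i j = K i j"
  by (simp add: kpow_def kop_def)

lemma kop_pow_eq: "(kop K ^^ n) f i = (\<Sum>\<^sup>+ j. kpow K n i j * f j)"
proof (induction n arbitrary: i)
  case 0
  have "(\<Sum>\<^sup>+ j. indicator {j} i * f j) = (\<Sum>\<^sup>+ j. f j * indicator {i} j)"
    by (intro nn_integral_cong) (auto simp: indicator_def)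
  then show ?case by (simp add: kpow_0)
next
  case (Suc n)
  have "(kop K ^^ Suc n) f i = (\<Sum>\<^sup>+ k. \<Sum>\<^sup>+ j. K i k * (kpow K n k j * f j))"
    by (simp add: kop_def Suc.IH nn_integral_cmult)
  also have "\<dots> = (\<Sum>\<^sup>+ j. \<Sum>\<^sup>+ k. K i k * kpow K n k j * f j)"
    by (subst nn_integral_count_space_swap) (simp add: mult.assoc)
  also have "\<dots> = (\<Sum>\<^sup>+ j. kpow K (Suc n) i j * f j)" by (simp add: kpow_Suc nn_integral_multc)
  finally show ?case .
qed

lemma kpow_add: "kpow K (m + n) i j = (\<Sum>\<^sup>+ k. kpow K m i k * kpow K n k j)"
proof -
  have "kpow K (m + n) i j = (kop K ^^ m) (\<lambda>k. kpow K n k j) i" by (simp add: kpow_def funpow_add)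
  then show ?thesis by (simp add: kop_pow_eq)
qed

lemma kpow_mult_le: "kpow K m i k * kpow K n k j \<le> kpow K (m + n) i j"
  unfolding kpow_add by (rule nn_integral_ge_point) simp

lemma green_eq_add:
  assumes "R \<ge> 0"
  shows "green K R i j = indicator {j} i + ennreal R * (\<Sum>\<^sup>+ k. green K R i k * K k j)"
proof -
  have "green K R i j = indicator {j} i + (\<Sum>n. ennreal (R ^ Suc n) * kpow K (Suc n) i j)"
    unfolding green_def by (subst suminf_offset[where i = 1]) (auto simp: kpow_0)
  also have "(\<Sum>n. ennreal (R ^ Suc n) * kpow K (Suc n) i j)
      = (\<Sum>n. ennreal R * (ennreal (R ^ n) * (\<Sum>\<^sup>+ k. kpow K n i k * K k j)))"
    using kpow_add[of K _ "Suc 0" i j] assms by (simp add: kpow_1 ennreal_mult mult.assoc)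
  also have "\<dots> = ennreal R * (\<Sum>n. \<Sum>\<^sup>+ k. ennreal (R ^ n) * kpow K n i k * K k j)"
    by (simp add: nn_integral_cmult mult.assoc)
  also have "\<dots> = ennreal R * (\<Sum>\<^sup>+ k. green K R i k * K k j)"
    by (subst nn_integral_suminf[symmetric]) (simp_all add: green_def)
  finally show ?thesis .
qed

text \<open>Restrict to paths whose last \<open>n\<close> steps lead from \<open>k\<close> to
  \<open>j\<close>. The factor relating the values at \<open>k\<close> and \<open>j\<close> does not
  involve the starting point \<open>i\<close>, which later makes the Harnack constants
  uniform.\<close>

lemma green_ge_mult_kpow:
  assumes "R \<ge> 0"
  shows "ennreal (R ^ n) * (green K R i k * kpow K n k j) \<le> green K R i j"
proof -
  have "ennreal (R ^ n) * (green K R i k * kpow K n k j)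
      = (\<Sum>m. ennreal (R ^ (m + n)) * (kpow K m i k * kpow K n k j))"
    unfolding green_def using assms
    by (simp add: power_add ennreal_mult mult_ac flip: ennreal_suminf_cmult ennreal_suminf_multc)
  also have "\<dots> \<le> (\<Sum>m. ennreal (R ^ (m + n)) * kpow K (m + n) i j)"
    by (intro suminf_le mult_left_mono kpow_mult_le) auto
  also have "\<dots> \<le> green K R i j"
    unfolding green_def by (subst (2) suminf_offset[where i = n]) auto
  finally show ?thesis .
qed

lemma green_ge_kpow_mult:
  assumes "R \<ge> 0"
  shows "ennreal (R ^ n) * (kpow K n i k * green K R k j) \<le> green K R i j"
proof -
  have "ennreal (R ^ n) * (kpow K n i k * green K R k j)
      = (\<Sum>m. ennreal (R ^ (n + m)) * (kpow K n i k * kpow K m k j))"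
    unfolding green_def using assms
    by (simp add: power_add ennreal_mult mult_ac flip: ennreal_suminf_cmult ennreal_suminf_multc)
  also have "\<dots> \<le> (\<Sum>m. ennreal (R ^ (n + m)) * kpow K (n + m) i j)"
    by (intro suminf_le mult_left_mono kpow_mult_le) auto
  also have "\<dots> \<le> green K R i j"
    unfolding green_def by (subst (2) suminf_offset[where i = n]) (auto simp: add.commute)
  finally show ?thesis .
qed

lemma green_mono: "0 \<le> R \<Longrightarrow> R \<le> S \<Longrightarrow> green K R i j \<le> green K S i j"
  unfolding green_def by (intro suminf_le mult_right_mono) (auto intro: power_mono ennreal_leI)

lemma green_potential_eq:
  "(\<Sum>\<^sup>+ j. green K R i j * f j) = (\<Sum>n. ennreal (R ^ n) * (kop K ^^ n) f i)"
proof -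
  have "(\<Sum>\<^sup>+ j. green K R i j * f j) = (\<Sum>\<^sup>+ j. (\<Sum>n. ennreal (R ^ n) * (kpow K n i j * f j)))"
    unfolding green_def by (simp add: mult.assoc flip: ennreal_suminf_multc)
  also have "\<dots> = (\<Sum>n. ennreal (R ^ n) * (kop K ^^ n) f i)"
    by (subst nn_integral_suminf) (simp_all add: nn_integral_cmult kop_pow_eq)
  finally show ?thesis .
qed

text \<open>This is \<open>f = R (K f + b) - h\<close> iterated \<open>N\<close> times. Subtraction
  in \<open>ennreal\<close> is truncated, so the charge \<open>h\<close> is carried on the left
  throughout.\<close>

lemma potential_partial_sum:
  assumes "R \<ge> 0" and eq: "\<And>i. f i + h i = ennreal R * (kop K f i + b i)"
  shows "f i + (\<Sum>n<N. ennreal (R ^ n) * (kop K ^^ n) h i)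
    = ennreal (R ^ N) * (kop K ^^ N) f i + (\<Sum>n<N. ennreal (R ^ Suc n) * (kop K ^^ n) b i)"
proof (induction N)
  case 0
  show ?case by simp
next
  case (Suc N)
  have "(kop K ^^ N) f i + (kop K ^^ N) h i = (kop K ^^ N) (\<lambda>i. f i + h i) i"
    by (simp add: kop_pow_add)
  also have "\<dots> = ennreal R * ((kop K ^^ Suc N) f i + (kop K ^^ N) b i)"
    by (simp only: eq kop_pow_cmult kop_pow_add funpow_Suc_right comp_def)
  finally have *: "(kop K ^^ N) f i + (kop K ^^ N) h i
    = ennreal R * ((kop K ^^ Suc N) f i + (kop K ^^ N) b i)" .
  have "f i + (\<Sum>n<Suc N. ennreal (R ^ n) * (kop K ^^ n) h i)
    = ennreal (R ^ N) * ((kop K ^^ N) f i + (kop K ^^ N) h i)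
      + (\<Sum>n<N. ennreal (R ^ Suc n) * (kop K ^^ n) b i)"
    using Suc by (simp add: distrib_left add_ac)
  also have "\<dots> = ennreal (R ^ Suc N) * (kop K ^^ Suc N) f i
      + (\<Sum>n<Suc N. ennreal (R ^ Suc n) * (kop K ^^ n) b i)"
    unfolding * using \<open>R \<ge> 0\<close> by (simp add: distrib_left add_ac ennreal_mult mult_ac)
  finally show ?case .
qed

lemma suminf_ennreal_split: "(\<Sum>n. f n) = (\<Sum>n<N. f n) + (\<Sum>n. f (n + N) :: ennreal)"
  by (subst suminf_offset[where i = N]) auto

text \<open>The right-hand side \<open>u\<close> solves \<open>u = R (K u + b)\<close>, so \<open>u - f\<close> is superharmonic with charge \<open>h\<close>.\<close>

lemma green_potential_le:
  assumes "R \<ge> 0" and eq: "\<And>i. f i + h i = ennreal R * (kop K f i + b i)"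
    and f_le: "\<And>i. f i \<le> ennreal R * (\<Sum>\<^sup>+ j. green K R i j * b j)"
  shows "(\<Sum>\<^sup>+ j. green K R i j * h j) \<le> ennreal R * (\<Sum>\<^sup>+ j. green K R i j * b j)"
proof -
  define u where "u i = ennreal R * (\<Sum>\<^sup>+ j. green K R i j * b j)" for i
  have u: "u i = (\<Sum>n. ennreal (R ^ Suc n) * (kop K ^^ n) b i)" for i
    unfolding u_def green_potential_eq using \<open>R \<ge> 0\<close> by (simp add: ennreal_mult mult.assoc)
  \<comment> \<open>\<open>R^N K^N u\<close> is exactly the tail of the series for \<open>u\<close>.
    Hence replacing \<open>f\<close> by \<open>u\<close> in the remainder term restores the whole
    series, and no convergence of the remainder to 0 is required.\<close>
  have tail: "ennreal (R ^ N) * (kop K ^^ N) u i = (\<Sum>n. ennreal (R ^ Suc (n + N)) * (kop K ^^ (n + N)) b i)"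
    for N
  proof -
    have "(kop K ^^ N) u i = (\<Sum>\<^sup>+ j. (\<Sum>n. kpow K N i j * (ennreal (R ^ Suc n) * (kop K ^^ n) b j)))"
      unfolding kop_pow_eq u by simp
    also have "\<dots> = (\<Sum>n. ennreal (R ^ Suc n) * (kop K ^^ (n + N)) b i)" by (subst nn_integral_suminf)
         (simp_all add: kop_pow_cmult funpow_add add.commute[of _ N] flip: kop_pow_eq)
    finally show ?thesis
      using \<open>R \<ge> 0\<close> by (simp add: power_add ennreal_mult mult_ac flip: ennreal_suminf_cmult)
  qed
  have "(\<Sum>n<N. ennreal (R ^ n) * (kop K ^^ n) h i) \<le> u i" for N
  proof -
    have "(\<Sum>n<N. ennreal (R ^ n) * (kop K ^^ n) h i)
      \<le> f i + (\<Sum>n<N. ennreal (R ^ n) * (kop K ^^ n) h i)" by (simp add: add_increasing)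
    also have "\<dots> = ennreal (R ^ N) * (kop K ^^ N) f i
        + (\<Sum>n<N. ennreal (R ^ Suc n) * (kop K ^^ n) b i)"
      by (rule potential_partial_sum[OF assms(1) eq])
    also have "\<dots> \<le> ennreal (R ^ N) * (kop K ^^ N) u i
        + (\<Sum>n<N. ennreal (R ^ Suc n) * (kop K ^^ n) b i)"
      unfolding kop_pow_eq u_def by (intro add_right_mono mult_left_mono nn_integral_mono f_le) auto
    also have "\<dots> = u i"
      unfolding tail u
        suminf_ennreal_split[where N = N and f = "\<lambda>n. ennreal (R ^ Suc n) * (kop K ^^ n) b i"]
      by (rule add.commute)
    finally show ?thesis .
  qed
  then show ?thesis
    unfolding green_potential_eq[of K R i h] u_def[symmetric] by (intro suminf_le_const) auto
qed

section \<open>Absorbing chains\<close>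

lemma tendsto_0_of_suminf_finite:
  fixes f :: "nat \<Rightarrow> ennreal"
  assumes "(\<Sum>n. f n) < \<infinity>"
  shows "f \<longlonglongrightarrow> 0"
proof -
  have fin: "f n < \<infinity>" for n using ennreal_suminf_lessD[OF assms] by simp
  then have f: "f n = ennreal (enn2real (f n))" for n by (simp add: ennreal_enn2real_if less_top)
  then have "(\<Sum>n. ennreal (enn2real (f n))) \<noteq> top" using assms by auto
  then have "summable (\<lambda>n. enn2real (f n))" by (intro summable_suminf_not_top) auto
  then have "(\<lambda>n. ennreal (enn2real (f n))) \<longlonglongrightarrow> ennreal 0"
    by (intro tendsto_ennrealI summable_LIMSEQ_zero)
  then show ?thesis using f by simp
qed

text \<open>Compactness of the product of intervals is Tychonoff's theorem; countability of the
  index set makes the function space first countable, so that compactness yields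
  subsequences.\<close>

lemma pointwise_convergent_subsequence:
  fixes x :: "nat \<Rightarrow> 'a::countable \<Rightarrow> real"
  assumes "\<And>n i. x n i \<in> {a i..b i}"
  obtains r y where "strict_mono r" "\<And>i. (\<lambda>n. x (r n) i) \<longlonglongrightarrow> y i"
proof -
  have "compactin (product_topology (\<lambda>i. euclidean) UNIV) (PiE UNIV (\<lambda>i. {a i..b i}))"
    by (subst compactin_PiE) auto
  then have "compact (PiE UNIV (\<lambda>i. {a i..b i}))" by (simp add: euclidean_product_topology)
  then have "seq_compact (PiE UNIV (\<lambda>i. {a i..b i}))" by (rule compact_imp_seq_compact)
  moreover have "x n \<in> PiE UNIV (\<lambda>i. {a i..b i})" for n using assms by auto
  ultimately obtain y r where "strict_mono r" and lim: "(x \<circ> r) \<longlonglongrightarrow> y"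
    unfolding seq_compact_def by metis
  have "(\<lambda>n. x (r n) i) \<longlonglongrightarrow> y i" for i
    using continuous_on_tendsto_compose[OF continuous_on_product_coordinates[of i] lim] by simp
  with \<open>strict_mono r\<close> that show thesis by blast
qed

lemma stochastic_kpow:
  assumes "\<And>i. (\<Sum>\<^sup>+ j. K i j) = 1"
  shows "(\<Sum>\<^sup>+ j. kpow K n i j) = 1"
proof -
  have "(kop K ^^ n) (\<lambda>_. 1) = (\<lambda>_. 1)" by (induction n) (auto simp: kop_def assms)
  then have "(kop K ^^ n) (\<lambda>_. 1) i = 1" by simp
  then show ?thesis by (simp add: kop_pow_eq)
qed

lemma stochastic_kpow_le_1:
  assumes "\<And>i. (\<Sum>\<^sup>+ j. K i j) = 1"
  shows "kpow K n i j \<le> 1"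
  using nn_integral_ge_point[of j UNIV "kpow K n i"] stochastic_kpow[OF assms, where n = n and i = i] by simp

text \<open>\<open>finite_column\<close> covers \<open>j = z\<close> as well: the flow into the
  absorbing state is a finite sum too, and so converges along with the measures in a pointwise
  limit.\<close>

locale absorbing_chain =
  fixes K :: "'a::countable \<Rightarrow> 'a \<Rightarrow> ennreal" and z :: 'a
  assumes row_sum: "(\<Sum>\<^sup>+ j. K i j) = 1"
    and absorbing: "j \<noteq> z \<Longrightarrow> K z j = 0"
    and irreducible: "i \<noteq> z \<Longrightarrow> j \<noteq> z \<Longrightarrow> \<exists>n. kpow K n i j > 0"
    and finite_column: "finite {i. i \<noteq> z \<and> K i j \<noteq> 0}"
    and infinite_states: "infinite (UNIV :: 'a set)"
begin

abbreviation column_sum :: "('a \<Rightarrow> real) \<Rightarrow> 'a \<Rightarrow> real" where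
  "column_sum m j \<equiv> (\<Sum>i | i \<noteq> z \<and> K i j \<noteq> 0. m i * enn2real (K i j))"

text \<open>The value 0 at \<open>z\<close> makes absorption count only once: the potential of
  \<open>exit\<close> with \<open>R = 1\<close> is the absorption probability for starting points
  other than \<open>z\<close>.\<close>

definition exit :: "'a \<Rightarrow> ennreal" where
  "exit i = (if i = z then 0 else K i z)"

text \<open>\<open>f\<close>, extended by \<open>1\<close> at the absorbing state, is a submartingale with drift \<open>D\<close>.\<close>

definition test_pair :: "('a \<Rightarrow> real) \<Rightarrow> ('a \<Rightarrow> real) \<Rightarrow> bool" where
  "test_pair f D \<longleftrightarrow> (\<forall>i. 0 \<le> f i \<and> f i \<le> 1 \<and> 0 \<le> D i) \<and> f z = 0 \<and> D z = 0 \<and>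
    (\<forall>e>0. finite {i. f i > e}) \<and>
    (\<forall>i. i \<noteq> z \<longrightarrow> ennreal (f i + D i) = kop K (\<lambda>j. ennreal (f j)) i + K i z)"

lemma kpow_row_sum: "(\<Sum>\<^sup>+ j. kpow K n i j) = 1"
  by (rule stochastic_kpow[OF row_sum])

lemma kpow_le_1: "kpow K n i j \<le> 1"
  by (rule stochastic_kpow_le_1[OF row_sum])

lemma kpow_absorbing: "j \<noteq> z \<Longrightarrow> kpow K n z j = 0"
proof (induction n)
  case (Suc n)
  have "K z k * kpow K n k j = 0" for k using Suc absorbing[of k] by (cases "k = z") auto
  then have "(\<lambda>k. K z k * kpow K n k j) = (\<lambda>_. 0)" by blast
  then show ?case unfolding kpow_Suc by simp
qed (simp add: kpow_0)

lemma K_le_1: "K i j \<le> 1"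
  using kpow_le_1[of "Suc 0" i j] by (simp add: kpow_1)

lemma K_fin: "K i j \<noteq> \<infinity>"
  using K_le_1[of i j] by (auto simp: top_unique)

lemma nn_sum_column:
  assumes w: "\<And>i. i \<noteq> z \<Longrightarrow> w i = ennreal (v i)" "\<And>i. i \<noteq> z \<Longrightarrow> v i \<ge> 0"
  shows "(\<Sum>\<^sup>+ i. w i * (if i = z then 0 else K i j)) = ennreal (column_sum v j)"
proof -
  have "(\<Sum>\<^sup>+ i. w i * (if i = z then 0 else K i j))
    = (\<Sum>i | i \<noteq> z \<and> K i j \<noteq> 0. w i * (if i = z then 0 else K i j))"
    using finite_column[of j] by (intro nn_integral_count_space') auto
  also have "\<dots> = (\<Sum>i | i \<noteq> z \<and> K i j \<noteq> 0. ennreal (v i * enn2real (K i j)))"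
    using w K_fin[of _ j] by (intro sum.cong) (auto simp: ennreal_mult ennreal_enn2real_if)
  also have "\<dots> = ennreal (column_sum v j)" using w by (intro sum_ennreal) auto
  finally show ?thesis .
qed

lemma green_pos:
  assumes "R \<ge> 1" "i \<noteq> z" "j \<noteq> z"
  shows "green K R i j > 0"
proof -
  obtain n where n: "kpow K n i j > 0" using irreducible assms by blast
  have "0 < ennreal (R ^ n) * kpow K n i j" using n assms by (simp add: ennreal_zero_less_mult_iff)
  also have "\<dots> \<le> green K R i j"
    unfolding green_def using sum_le_suminf[of "\<lambda>n. ennreal (R ^ n) * kpow K n i j" "{n}"] by auto
  finally show ?thesis .
qed

text \<open>Solidarity: paths from \<open>i\<close> to \<open>i'\<close> and from \<open>j'\<close>
  to \<open>j\<close>, both of positive weight, bound \<open>G(i', j')\<close> by a multiple of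
  \<open>G(i, j)\<close>. This is why the decay parameter does not depend on the pair of
  states.\<close>

lemma green_finite_transfer:
  assumes "R \<ge> 1" "i \<noteq> z" "j \<noteq> z" "i' \<noteq> z" "j' \<noteq> z" "green K R i j < \<infinity>"
  shows "green K R i' j' < \<infinity>"
proof -
  obtain m n where m: "kpow K m i i' > 0" and n: "kpow K n j' j > 0"
    using irreducible assms by blast
  have "ennreal (R ^ m) * (kpow K m i i' * (ennreal (R ^ n) * (green K R i' j' * kpow K n j' j)))
      \<le> ennreal (R ^ m) * (kpow K m i i' * green K R i' j)"
    using assms(1) by (intro mult_left_mono green_ge_mult_kpow) auto
  also have "\<dots> \<le> green K R i j" using assms(1) by (intro green_ge_kpow_mult) auto
  finally have "ennreal (R ^ m) * (kpow K m i i' * (ennreal (R ^ n) * (green K R i' j' * kpow K n j' j))) < \<infinity>"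
    using assms(6) by (rule le_less_trans)
  moreover have "ennreal (R ^ m) \<noteq> 0" "ennreal (R ^ n) \<noteq> 0" using assms(1) by auto
  ultimately show ?thesis using m n by (auto simp: ennreal_mult_less_top)
qed

text \<open>Iterating the equation gives \<open>f \<le> K^N f\<close> plus a partial sum of the
  absorption probability. The remainder tends to 0: outside a finite set \<open>f\<close> is small,
  and a transient chain leaves the finite set.\<close>

lemma dominated_by_exit:
  assumes f_z: "f z = 0" and f_le: "\<And>i. f i \<le> 1"
    and vanish: "\<And>e. e > 0 \<Longrightarrow> finite {i. f i > ennreal e}"
    and eq: "\<And>i. f i + h i = kop K f i + exit i"
    and fin: "\<And>i j. i \<noteq> z \<Longrightarrow> j \<noteq> z \<Longrightarrow> green K 1 i j < \<infinity>"
  shows "f i \<le> (\<Sum>\<^sup>+ j. green K 1 i j * exit j)" (is "_ \<le> ?u i")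
proof (cases "i = z")
  case True
  then show ?thesis using f_z by simp
next
  case False
  have le: "f i \<le> (kop K ^^ N) f i + ?u i" for N
  proof -
    have "f i \<le> f i + (\<Sum>n<N. ennreal (1 ^ n) * (kop K ^^ n) h i)" by (simp add: add_increasing2)
    also have "\<dots> = ennreal (1 ^ N) * (kop K ^^ N) f i
        + (\<Sum>n<N. ennreal (1 ^ Suc n) * (kop K ^^ n) exit i)"
      by (rule potential_partial_sum) (simp_all add: eq)
    also have "\<dots> \<le> (kop K ^^ N) f i + ?u i"
      unfolding green_potential_eq by (auto intro!: add_left_mono sum_le_suminf)
    finally show ?thesis .
  qed
  have "f i \<le> ?u i + ennreal e" if "e > 0" for e
  proof -
    \<comment> \<open>\<open>f z = 0\<close> keeps the absorbing state out of \<open>F\<close>, so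
      finiteness of the Green function applies to every state of \<open>F\<close>.\<close>
    define F where "F = {j. f j > ennreal e}"
    have F: "finite F" "z \<notin> F" using vanish[OF that] f_z by (auto simp: F_def)
    have bound: "(kop K ^^ N) f i \<le> (\<Sum>j\<in>F. kpow K N i j) + ennreal e" for N
    proof -
      have "(kop K ^^ N) f i \<le> (\<Sum>\<^sup>+ j. kpow K N i j * indicator F j + kpow K N i j * ennreal e)"
        unfolding kop_pow_eq
      proof (intro nn_integral_mono)
        fix j
        show "kpow K N i j * f j \<le> kpow K N i j * indicator F j + kpow K N i j * ennreal e"
        proof (cases "j \<in> F")
          case True
          have "kpow K N i j * f j \<le> kpow K N i j * 1" by (intro mult_left_mono f_le) auto
          then show ?thesis using True by (simp add: add_increasing2)
        next
          case False
          then have "f j \<le> ennreal e" by (simp add: F_def not_less)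
          then show ?thesis by (simp add: add_increasing mult_left_mono)
        qed
      qed
      also have "\<dots> = (\<Sum>j\<in>F. kpow K N i j) + ennreal e"
        using F by (simp add: nn_integral_add nn_integral_multc kpow_row_sum nn_integral_indicator_finite)
      finally show ?thesis .
    qed
    have "(\<lambda>N. kpow K N i j) \<longlonglongrightarrow> 0" if "j \<in> F" for j using that F fin[OF False, of j]
      by (intro tendsto_0_of_suminf_finite) (auto simp: green_def)
    then have "(\<lambda>N. (\<Sum>j\<in>F. kpow K N i j) + ennreal e + ?u i) \<longlonglongrightarrow> (\<Sum>j\<in>F. 0) + ennreal e + ?u i"
      by (intro tendsto_intros) auto
    then have "f i \<le> (\<Sum>j\<in>F. 0) + ennreal e + ?u i"
    proof (rule LIMSEQ_le_const, intro exI allI impI)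
      fix N
      have "f i \<le> (kop K ^^ N) f i + ?u i" by (rule le)
      also have "\<dots> \<le> (\<Sum>j\<in>F. kpow K N i j) + ennreal e + ?u i" by (intro add_right_mono bound)
      finally show "f i \<le> (\<Sum>j\<in>F. kpow K N i j) + ennreal e + ?u i" .
    qed
    then show ?thesis by (simp add: add.commute)
  qed
  then show ?thesis by (rule ennreal_le_epsilon)
qed

text \<open>A limit of normalised Green functions \<open>G(k\<^sub>n, \<cdot>) / G(k\<^sub>n, o)\<close> with starting points \<open>k\<^sub>n\<close>
  leaving every finite set. Finite columns let the equation pass to the limit.\<close>

lemma exists_invariant_measure:
  assumes Rs_ge: "\<And>n. Rs n \<ge> 1" and Rs_lim: "Rs \<longlonglongrightarrow> R"
    and fin: "\<And>n i j. i \<noteq> z \<Longrightarrow> j \<noteq> z \<Longrightarrow> green K (Rs n) i j < \<infinity>"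
  obtains m where "\<And>i. i \<noteq> z \<Longrightarrow> m i > 0"
    and "\<And>j. j \<noteq> z \<Longrightarrow> m j = R * column_sum m j"
    and "\<And>f D F. test_pair f D \<Longrightarrow> finite F \<Longrightarrow> z \<notin> F \<Longrightarrow>
      (\<Sum>j\<in>F. m j * ((R - 1) * f j + R * D j)) \<le> R * column_sum m z"
proof -
  have "infinite (- {z} :: 'a set)" using infinite_states by (simp add: Compl_eq_Diff_UNIV)
  then obtain k :: "nat \<Rightarrow> 'a" where k: "inj k" "range k \<subseteq> - {z}"
    using infinite_countable_subset by blast
  then have kz: "k n \<noteq> z" for n by auto
  define o' where "o' = k 0"
  have oz: "o' \<noteq> z" using kz by (simp add: o'_def)
  define g where "g n j = enn2real (green K (Rs n) (k n) j)" for n j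
  have g: "green K (Rs n) (k n) j = ennreal (g n j)" if "j \<noteq> z" for n j
    using fin[OF kz that, of n n] by (simp add: g_def ennreal_enn2real_if less_top)
  have g_pos: "g n j > 0" if "j \<noteq> z" for n j
    using green_pos[OF Rs_ge kz that, of n n] unfolding g[OF that] by simp
  have g_nn: "g n j \<ge> 0" for n j by (simp add: g_def)
  have Kr: "K i j = ennreal (enn2real (K i j))" for i j
    using K_fin[of i j] by (simp add: ennreal_enn2real_if)
  have R: "R \<ge> 1" using Rs_lim by (rule LIMSEQ_le_const) (use Rs_ge in auto)
  \<comment> \<open>The constant is the weight of one fixed path from \<open>i\<close> to
    \<open>j\<close>; since \<open>Rs n \<ge> 1\<close>, it works for all \<open>n\<close> and all
    starting points \<open>k n\<close>.\<close>
  have harnack: "\<exists>c>0. \<forall>n. c * g n i \<le> g n j" if ij: "i \<noteq> z" "j \<noteq> z" for i j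
  proof -
    obtain N where N: "kpow K N i j > 0" using irreducible ij by blast
    define c where "c = enn2real (kpow K N i j)"
    have c: "kpow K N i j = ennreal c"
      using kpow_le_1[of N i j] by (auto simp: c_def ennreal_enn2real_if top_unique)
    have "c > 0" using N unfolding c by simp
    moreover have "c * g n i \<le> g n j" for n
    proof -
      have "ennreal (Rs n ^ N) * (green K (Rs n) (k n) i * kpow K N i j) \<le> green K (Rs n) (k n) j"
        using Rs_ge[of n] by (intro green_ge_mult_kpow) auto
      then have "ennreal (Rs n ^ N * (g n i * c)) \<le> ennreal (g n j)"
        unfolding g[OF ij(1)] g[OF ij(2)] c using g_nn \<open>c > 0\<close> Rs_ge[of n]
        by (simp add: ennreal_mult)
      then have "Rs n ^ N * (g n i * c) \<le> g n j" using g_nn by simp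
      moreover have "1 * (g n i * c) \<le> Rs n ^ N * (g n i * c)"
        using Rs_ge[of n] g_nn \<open>c > 0\<close> by (intro mult_right_mono one_le_power) auto
      ultimately show ?thesis by (simp add: mult.commute)
    qed
    ultimately show ?thesis by blast
  qed
  \<comment> \<open>The upper bounds give compactness, the lower bounds keep the limit strictly
    positive.\<close>
  have "\<forall>j. \<exists>a b. 0 < a \<and> (j \<noteq> z \<longrightarrow> (\<forall>n. a \<le> g n j / g n o' \<and> g n j / g n o' \<le> b))"
  proof
    fix j
    show "\<exists>a b. 0 < a \<and> (j \<noteq> z \<longrightarrow> (\<forall>n. a \<le> g n j / g n o' \<and> g n j / g n o' \<le> b))"
    proof (cases "j = z")
      case True
      then show ?thesis by (intro exI[of _ 1]) auto
    next
      case False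
      obtain c d where c: "c > 0" "\<And>n. c * g n o' \<le> g n j" and d: "d > 0" "\<And>n. d * g n j \<le> g n o'"
        using harnack[OF oz False] harnack[OF False oz] by blast
      then have "c \<le> g n j / g n o' \<and> g n j / g n o' \<le> 1 / d" for n
        using g_pos[OF oz, of n] by (simp add: field_simps)
      then show ?thesis using c(1) by blast
    qed
  qed
  then obtain a b where ab: "\<And>j. 0 < a j" "\<And>j n. j \<noteq> z \<Longrightarrow> a j \<le> g n j / g n o' \<and> g n j / g n o' \<le> b j"
    by metis
  define x where "x n j = (if j = z then 0 else g n j / g n o')" for n j
  have "x n j \<in> {(if j = z then 0 else a j)..(if j = z then 0 else b j)}" for n j
    using ab(2) by (auto simp: x_def)
  then obtain r m where r: "strict_mono r" and m: "\<And>i. (\<lambda>n. x (r n) i) \<longlonglongrightarrow> m i"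
    by (rule pointwise_convergent_subsequence[of x]) blast
  have m_pos: "m j > 0" if "j \<noteq> z" for j
    using LIMSEQ_le_const[OF m[of j], of "a j"] ab that by (force simp: x_def intro: less_le_trans)
  have RsR: "(\<lambda>n. Rs (r n)) \<longlonglongrightarrow> R" using LIMSEQ_subseq_LIMSEQ[OF Rs_lim r] by (simp add: comp_def)
  have gK: "(\<Sum>\<^sup>+ i. green K (Rs n) (k n) i * K i j) = ennreal (column_sum (g n) j)"
    if "j \<noteq> z" for n j
  proof -
    have "(\<lambda>i. green K (Rs n) (k n) i * K i j)
        = (\<lambda>i. green K (Rs n) (k n) i * (if i = z then 0 else K i j))"
      using absorbing[OF that] by auto
    then show ?thesis by (simp only:) (rule nn_sum_column[OF g g_nn])
  qed
  have gE: "(\<Sum>\<^sup>+ i. green K (Rs n) (k n) i * exit i) = ennreal (column_sum (g n) z)" for n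
    unfolding exit_def by (rule nn_sum_column[OF g g_nn])
  show thesis
  proof
    show "m i > 0" if "i \<noteq> z" for i by (rule m_pos[OF that])
  next
    fix j assume j: "j \<noteq> z"
    define I where "I = {i. i \<noteq> z \<and> K i j \<noteq> 0}"
    have eq: "x n j = indicator {j} (k n) / g n o' + Rs n * (\<Sum>i\<in>I. x n i * enn2real (K i j))" for n
    proof -
      have "ennreal (g n j) = indicator {j} (k n)
          + ennreal (Rs n) * ennreal (\<Sum>i\<in>I. g n i * enn2real (K i j))"
        using green_eq_add[of "Rs n" K "k n" j] Rs_ge[of n] gK[OF j] g[OF j] by (simp add: I_def)
      also have "\<dots> = ennreal (indicator {j} (k n) + Rs n * (\<Sum>i\<in>I. g n i * enn2real (K i j)))"
        using Rs_ge[of n] g_nn by (subst ennreal_plus)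
           (auto simp: ennreal_mult sum_nonneg indicator_def split: if_splits)
      finally have "g n j = indicator {j} (k n) + Rs n * (\<Sum>i\<in>I. g n i * enn2real (K i j))"
        using Rs_ge[of n] g_nn by (subst (asm) ennreal_inj) (auto intro!: sum_nonneg add_nonneg_nonneg mult_nonneg_nonneg)
      moreover have "(\<Sum>i\<in>I. x n i * enn2real (K i j)) = (\<Sum>i\<in>I. g n i * enn2real (K i j)) / g n o'"
        unfolding sum_divide_distrib by (intro sum.cong) (auto simp: x_def I_def)
      ultimately show ?thesis using j by (simp add: x_def add_divide_distrib)
    qed
    \<comment> \<open>The source term vanishes: by injectivity the starting point equals
      \<open>j\<close> for at most one \<open>n\<close>.\<close>
    have "eventually (\<lambda>n. k n \<noteq> j) sequentially"
    proof -
      have "finite (k -` {j})" using k(1) by (intro finite_vimageI) auto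
      then show ?thesis
        unfolding eventually_sequentially finite_nat_set_iff_bounded
        by (metis leD singletonI vimageI)
    qed
    then have "eventually (\<lambda>n. k (r n) \<noteq> j) sequentially"
      using r by (rule eventually_subseq[rotated])
    then have "eventually (\<lambda>n. x (r n) j = Rs (r n) * (\<Sum>i\<in>I. x (r n) i * enn2real (K i j))) sequentially"
      by eventually_elim (subst eq, simp)
    moreover have "(\<lambda>n. Rs (r n) * (\<Sum>i\<in>I. x (r n) i * enn2real (K i j)))
        \<longlonglongrightarrow> R * (\<Sum>i\<in>I. m i * enn2real (K i j))"
      by (intro tendsto_intros RsR m)
    ultimately have "(\<lambda>n. x (r n) j) \<longlonglongrightarrow> R * (\<Sum>i\<in>I. m i * enn2real (K i j))"
      using tendsto_cong by force
    with m[of j] have "m j = R * (\<Sum>i\<in>I. m i * enn2real (K i j))" by (rule LIMSEQ_unique)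
    then show "m j = R * column_sum m j" by (simp only: I_def)
  next
    fix f D :: "'a \<Rightarrow> real" and F
    assume fD: "test_pair f D"
      and F: "finite F" "z \<notin> F"
    from fD have f: "\<And>i. 0 \<le> f i" "\<And>i. f i \<le> 1" "f z = 0"
      and van: "\<And>e. e > 0 \<Longrightarrow> finite {i. f i > e}" and D: "\<And>i. 0 \<le> D i" "D z = 0"
      and eq: "\<And>i. i \<noteq> z \<Longrightarrow> ennreal (f i + D i) = kop K (\<lambda>j. ennreal (f j)) i + K i z"
      by (auto simp: test_pair_def)
    have "kop K (\<lambda>j. ennreal (f j)) z = 0"
    proof -
      have "K z j * ennreal (f j) = 0" for j using absorbing[of j] f(3) by (cases "j = z") auto
      then have "(\<lambda>j. K z j * ennreal (f j)) = (\<lambda>_. 0)" by blast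
      then show ?thesis unfolding kop_def by simp
    qed
    then have eq': "ennreal (f i) + ennreal (D i) = kop K (\<lambda>j. ennreal (f j)) i + exit i" for i
      using eq[of i] f D by (cases "i = z") (auto simp: exit_def)
    \<comment> \<open>Multiplying \<open>f + D = K f + exit\<close> by \<open>Rs n\<close> and
      moving the surplus \<open>(Rs n - 1) f\<close> into the charge gives the equation at rate
      \<open>Rs n\<close>; see \<open>fh\<close>.\<close>
    define h where "h n j = (Rs n - 1) * f j + Rs n * D j" for n j
    have h_nn: "h n j \<ge> 0" for n j
      unfolding h_def using f D Rs_ge[of n] by (intro add_nonneg_nonneg mult_nonneg_nonneg) auto
    have bound: "(\<Sum>j\<in>F. x n j * h n j) \<le> Rs n * column_sum (x n) z" for n
    proof -
      have fin1: "green K 1 i j < \<infinity>" if "i \<noteq> z" "j \<noteq> z" for i j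
        using green_mono[of 1 "Rs n" K i j] Rs_ge[of n] fin[OF that, of n] by auto
      \<comment> \<open>The submartingale comparison is made at \<open>R = 1\<close>, where the
        equation for \<open>f\<close> and \<open>D\<close> lives. Passing to \<open>Rs n\<close>
        only enlarges the right side.\<close>
      have "ennreal (f i) \<le> (\<Sum>\<^sup>+ j. green K 1 i j * exit j)" for i
        by (rule dominated_by_exit[where h = "\<lambda>i. ennreal (D i)"])
           (use f D van eq' fin1 in \<open>auto simp: ennreal_less_iff\<close>)
      also have "\<dots> i \<le> ennreal (Rs n) * (\<Sum>\<^sup>+ j. green K (Rs n) i j * exit j)" for i
      proof -
        have "1 * (\<Sum>\<^sup>+ j. green K 1 i j * exit j)
          \<le> ennreal (Rs n) * (\<Sum>\<^sup>+ j. green K (Rs n) i j * exit j)"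
          using Rs_ge[of n] by (intro mult_mono nn_integral_mono mult_right_mono green_mono) auto
        then show ?thesis by simp
      qed
      finally have fu: "ennreal (f i) \<le> ennreal (Rs n) * (\<Sum>\<^sup>+ j. green K (Rs n) i j * exit j)"
        for i .
      have fh: "ennreal (f i) + ennreal (h n i)
          = ennreal (Rs n) * (kop K (\<lambda>j. ennreal (f j)) i + exit i)" for i
      proof -
        have "ennreal (f i) + ennreal (h n i) = ennreal (Rs n * (f i + D i))"
          using h_nn f by (simp add: h_def algebra_simps flip: ennreal_plus)
        also have "\<dots> = ennreal (Rs n) * (ennreal (f i) + ennreal (D i))"
          using Rs_ge[of n] f D by (simp add: ennreal_mult)
        finally show ?thesis by (simp only: eq')
      qed
      \<comment> \<open>The potential is cut down to the finite set \<open>F\<close>, on which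
        pointwise convergence of the normalised Green functions is enough.\<close>
      have "(\<Sum>j\<in>F. ennreal (g n j * h n j)) = (\<Sum>j\<in>F. green K (Rs n) (k n) j * ennreal (h n j))"
      proof (rule sum.cong[OF refl])
        fix j assume "j \<in> F"
        then have "j \<noteq> z" using F by auto
        then show "ennreal (g n j * h n j) = green K (Rs n) (k n) j * ennreal (h n j)"
          using g_nn h_nn by (simp add: g ennreal_mult)
      qed
      also have "\<dots> = (\<Sum>\<^sup>+ j. green K (Rs n) (k n) j * ennreal (h n j) * indicator F j)"
        by (subst nn_integral_count_space'[where A = F]) (use F in auto)
      also have "\<dots> \<le> (\<Sum>\<^sup>+ j. green K (Rs n) (k n) j * ennreal (h n j))"
        by (intro nn_integral_mono) (auto simp: indicator_def)
      also have "\<dots> \<le> ennreal (Rs n) * (\<Sum>\<^sup>+ j. green K (Rs n) (k n) j * exit j)"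
        using Rs_ge[of n] by (intro green_potential_le[OF _ fh fu]) auto
      also have "\<dots> = ennreal (Rs n * column_sum (g n) z)"
        unfolding gE using Rs_ge[of n] g_nn by (simp add: ennreal_mult sum_nonneg)
      finally have "(\<Sum>j\<in>F. g n j * h n j) \<le> Rs n * column_sum (g n) z"
      proof (subst (asm) sum_ennreal)
        assume "ennreal (\<Sum>j\<in>F. g n j * h n j) \<le> ennreal (Rs n * column_sum (g n) z)"
        moreover have "0 \<le> Rs n * column_sum (g n) z"
          using Rs_ge[of n] g_nn by (intro mult_nonneg_nonneg sum_nonneg) auto
        ultimately show ?thesis by (simp add: ennreal_le_iff)
      qed (use g_nn h_nn in auto)
      then have "(\<Sum>j\<in>F. g n j * h n j) / g n o' \<le> Rs n * column_sum (g n) z / g n o'"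
        using g_pos[OF oz, of n] by (intro divide_right_mono) auto
      moreover have "(\<Sum>j\<in>F. x n j * h n j) = (\<Sum>j\<in>F. g n j * h n j) / g n o'"
        unfolding sum_divide_distrib using F by (intro sum.cong) (auto simp: x_def)
      moreover have "column_sum (x n) z = column_sum (g n) z / g n o'"
        unfolding sum_divide_distrib by (intro sum.cong) (auto simp: x_def)
      ultimately show ?thesis by simp
    qed
    have "(\<lambda>n. \<Sum>j\<in>F. x (r n) j * h (r n) j) \<longlonglongrightarrow> (\<Sum>j\<in>F. m j * ((R - 1) * f j + R * D j))"
      unfolding h_def by (intro tendsto_intros RsR m)
    moreover have "(\<lambda>n. Rs (r n) * column_sum (x (r n)) z) \<longlonglongrightarrow> R * column_sum m z"
      by (intro tendsto_intros RsR m)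
    ultimately show "(\<Sum>j\<in>F. m j * ((R - 1) * f j + R * D j)) \<le> R * column_sum m z"
      by (rule LIMSEQ_le) (use bound in auto)
  qed
qed

end

section \<open>Uniformization\<close>

text \<open>A bridge: the statements about measures use \<open>has_sum\<close>, whereas exchanges of
  summation are done with \<open>count_space\<close> integrals.\<close>

lemma has_sum_iff_nn_integral:
  fixes f :: "'a \<Rightarrow> real"
  assumes nn: "\<And>x. x \<in> A \<Longrightarrow> f x \<ge> 0" and "c \<ge> 0"
  shows "(f has_sum c) A \<longleftrightarrow> (\<integral>\<^sup>+ x. ennreal (f x) \<partial>count_space A) = ennreal c"
proof
  assume "(f has_sum c) A"
  then have "f summable_on A" "infsum f A = c" by (auto simp: summable_on_def infsumI)
  then have "Infinite_Set_Sum.abs_summable_on f A"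
    using summable_on_iff_abs_summable_on_real[of f A] abs_summable_equivalent[of f A] by blast
  then have "integrable (count_space A) f" "integral\<^sup>L (count_space A) f = c"
    using infsetsum_infsum[of f A] \<open>infsum f A = c\<close>
    by (auto simp: Infinite_Set_Sum.abs_summable_on_def infsetsum_def)
  then show "(\<integral>\<^sup>+ x. ennreal (f x) \<partial>count_space A) = ennreal c"
    using nn_integral_eq_integral[of "count_space A" f] nn by (simp add: AE_count_space)
next
  assume *: "(\<integral>\<^sup>+ x. ennreal (f x) \<partial>count_space A) = ennreal c"
  have int: "integrable (count_space A) f"
    by (intro integrableI_nonneg) (use * nn in \<open>auto simp: AE_count_space\<close>)
  then have "integral\<^sup>L (count_space A) f = c" using nn_integral_eq_integral[OF int] * nn \<open>c \<ge> 0\<close>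
    by (simp add: AE_count_space integral_nonneg_AE)
  moreover have "Infinite_Set_Sum.abs_summable_on f A"
    using int by (simp add: Infinite_Set_Sum.abs_summable_on_def)
  ultimately have "f summable_on A" "infsum f A = c"
    using infsetsum_infsum[of f A] abs_summable_equivalent[of f A]
      summable_on_iff_abs_summable_on_real[of f A]
    by (blast, simp add: infsetsum_def)
  then show "(f has_sum c) A" using has_sum_infsum by fastforce
qed

lemma integral_of_has_sum:
  fixes f :: "'a \<Rightarrow> real"
  assumes "(f has_sum c) UNIV" "\<And>x. f x \<ge> 0"
  shows "summable_l1 f" "integral\<^sup>L (count_space UNIV) f = c"
proof -
  have c: "c \<ge> 0" using assms has_sum_nonneg by blast
  have *: "(\<Sum>\<^sup>+ x. ennreal (f x)) = ennreal c"
    using assms c by (subst (asm) has_sum_iff_nn_integral) auto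
  show int: "summable_l1 f" by (intro integrableI_nonneg) (use * assms in auto)
  then show "integral\<^sup>L (count_space UNIV) f = c" using nn_integral_eq_integral[OF int] * assms c
    by (simp add: integral_nonneg_AE)
qed

lemma integrable_mult_bounded:
  fixes f g :: "'a \<Rightarrow> real"
  assumes "summable_l1 f" "\<And>x. \<bar>g x\<bar> \<le> c"
  shows "summable_l1 (\<lambda>x. f x * g x)"
proof (rule Bochner_Integration.integrable_bound[of _ "\<lambda>x. c * \<bar>f x\<bar>"])
  show "summable_l1 (\<lambda>x. c * \<bar>f x\<bar>)" using assms by auto
  have "\<bar>f x\<bar> * \<bar>g x\<bar> \<le> \<bar>f x\<bar> * c" for x using assms(2) by (intro mult_left_mono) auto
  moreover have "c \<ge> 0" using assms(2) abs_ge_zero order_trans by blast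
  ultimately show "AE x in count_space UNIV. norm (f x * g x) \<le> norm (c * \<bar>f x\<bar>)"
    by (simp add: abs_mult mult.commute)
qed auto

section \<open>The backward equation for an arbitrary Q-function\<close>

lemma transition_function_bounds:
  assumes "transition_function P" "t \<ge> 0"
  shows "0 \<le> P t i j" "P t i j \<le> 1"
proof -
  have nn: "P t i j \<ge> 0" for i j using assms by (auto simp: transition_function_def)
  have P_sum: "P t i summable_on UNIV" "infsum (P t i) UNIV \<le> 1"
    using assms by (auto simp: transition_function_def)
  show "P t i j \<ge> 0" by (rule nn)
  have "P t i j = infsum (P t i) {j}" by simp
  also have "\<dots> \<le> infsum (P t i) UNIV" using P_sum nn by (intro infsum_mono_neutral) auto
  finally show "P t i j \<le> 1" using P_sum by linarith
qed

text \<open>Both one-sided difference quotients at \<open>t\<close> are \<open>\<Sum>\<^sub>k (P\<^sub>h(i,k) - \<delta>\<^sub>i\<^sub>k)/h \<cdot> P\<^sub>\<tau>(k,j)\<close> with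
  \<open>\<tau> \<in> {t, t - h}\<close>; by Scheffe's lemma the first factor converges in \<open>\<ell>\<^sup>1\<close>.\<close>

lemma Q_function_backward:
  fixes P :: "real \<Rightarrow> 'a \<Rightarrow> 'a \<Rightarrow> real"
  assumes QP: "Q_function Q P"
    and off: "\<And>i j. i \<noteq> j \<Longrightarrow> Q i j \<ge> 0"
    and cons: "\<And>i. ((\<lambda>j. Q i j) has_sum (- Q i i)) (UNIV - {i})"
    and t: "t \<ge> 0"
  shows "((\<lambda>t. P t i j) has_real_derivative (\<Sum>\<^sup>1 k. Q i k * P t k j)) (at t within {0..})"
proof -
  note QP' = QP[unfolded Q_function_def transition_function_def]
  have P_nn: "P t i j \<ge> 0" and P_le: "P t i j \<le> 1" if "t \<ge> 0" for t i j
    using transition_function_bounds[OF _ that] QP by (auto simp: Q_function_def)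
  have P_sum: "P t i summable_on UNIV" "infsum (P t i) UNIV \<le> 1" if "t \<ge> 0" for t i
    using QP' that by blast+
  have P_0: "P 0 i j = (if i = j then 1 else 0)" for i j using QP' by blast
  have CK: "((\<lambda>k. P s i k * P t k j) has_sum P (s + t) i j) UNIV" if "s \<ge> 0" "t \<ge> 0" for s t i j
    using QP' that by blast
  have std: "((\<lambda>t. P t i i) \<longlongrightarrow> 1) (at_right 0)" for i using QP' by blast
  have der: "((\<lambda>t. P t i j) has_real_derivative Q i j) (at 0 within {0..})" for i j
    using QP' by blast
  have int_P: "summable_l1 (P t i)" "integral\<^sup>L (count_space UNIV) (P t i) \<le> 1"
    if "t \<ge> 0" for t i
    using integral_of_has_sum[OF has_sum_infsum[OF P_sum(1)[OF that, of i]]] P_nn that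
      P_sum(2)[OF that, of i] by auto
  have off_mass: "(\<Sum>\<^sup>1 k. P h i k * indicator (-{i}) k) \<le> 1 - P h i i"
    and off_int: "summable_l1 (\<lambda>k. P h i k * indicator (-{i}) k)"
    if "h \<ge> 0" for h i
  proof -
    have e: "P h i k * indicator (-{i}) k = P h i k - P h i i * indicator {i} k" for k
      by (auto simp: indicator_def)
    have i1: "summable_l1 (\<lambda>k. P h i i * indicator {i} k :: real)"
      by (intro integrable_mult_right integrable_real_indicator) auto
    have "(\<Sum>\<^sup>1 k. P h i i * indicator {i} k :: real) = P h i i" by (simp add: measure_count_space)
    then show "(\<Sum>\<^sup>1 k. P h i k * indicator (-{i}) k) \<le> 1 - P h i i"
      unfolding e using int_P[OF that, of i] i1 by simp
    show "summable_l1 (\<lambda>k. P h i k * indicator (-{i}) k)"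
      unfolding e using int_P(1)[OF that, of i] i1 by simp
  qed
  have CK_int: "summable_l1 (\<lambda>k. P s i k * P t k j)"
    "(\<Sum>\<^sup>1 k. P s i k * P t k j) = P (s + t) i j" if "s \<ge> 0" "t \<ge> 0" for s t i j
    using integral_of_has_sum[OF CK[OF that]] P_nn that by auto
  \<comment> \<open>Condition on the first \<open>h\<close> time units. The difference becomes a
    gain from leaving \<open>i\<close> minus a loss from not staying, and both lie between 0 and
    \<open>1 - P h i i\<close>.\<close>
  have modulus: "\<bar>P (s + h) i j - P s i j\<bar> \<le> 1 - P h i i" if "s \<ge> 0" "h \<ge> 0" for s h i j
  proof -
    have "P (s + h) i j = (\<Sum>\<^sup>1 k. P h i k * P s k j)"
      using CK_int[OF that(2,1)] by (simp add: add.commute)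
    also have "\<dots> = (\<Sum>\<^sup>1 k. P h i k * indicator (-{i}) k * P s k j + P h i i * P s i j * indicator {i} k)"
      by (intro Bochner_Integration.integral_cong) (auto simp: indicator_def)
    also have "\<dots> = (\<Sum>\<^sup>1 k. P h i k * indicator (-{i}) k * P s k j) + P h i i * P s i j"
      by (subst Bochner_Integration.integral_add)
         (use int_P(1)[OF that(2)] off_int[OF that(2)] P_le[OF that(1)] P_nn[OF that(1)] in
          \<open>auto intro!: integrable_mult_bounded[where c = 1] integrable_mult_right
             integrable_real_indicator simp: measure_count_space\<close>)
    finally have e: "P (s + h) i j - P s i j
      = (\<Sum>\<^sup>1 k. P h i k * indicator (-{i}) k * P s k j) - (1 - P h i i) * P s i j"
      by (simp add: algebra_simps)
    have "0 \<le> (\<Sum>\<^sup>1 k. P h i k * indicator (-{i}) k * P s k j)"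
      using P_nn that by (intro integral_nonneg_AE) auto
    moreover have "(\<Sum>\<^sup>1 k. P h i k * indicator (-{i}) k * P s k j)
        \<le> (\<Sum>\<^sup>1 k. P h i k * indicator (-{i}) k)"
      using P_nn P_le that off_int[OF that(2)] int_P(1)[OF that(2)]
      by (intro integral_mono integrable_mult_bounded[where c = 1]) (auto intro!: mult_left_le)
    moreover have "0 \<le> (1 - P h i i) * P s i j" "(1 - P h i i) * P s i j \<le> 1 - P h i i"
      using P_nn P_le that by (auto intro!: mult_left_le)
    ultimately show ?thesis using e off_mass[OF that(2), of i] by linarith
  qed
  have Q_off: "((\<lambda>k. Q i k * indicator (-{i}) k) has_sum (- Q i i)) UNIV"
    using cons[of i] by (subst (asm) has_sum_cong_neutral[where g = "\<lambda>k. Q i k * indicator (-{i}) k"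
        and T = UNIV]) (auto simp: indicator_def)
  have Q_off_int: "summable_l1 (\<lambda>k. Q i k * indicator (-{i}) k)"
    "(\<Sum>\<^sup>1 k. Q i k * indicator (-{i}) k) = - Q i i"
    using integral_of_has_sum[OF Q_off] off by (auto simp: indicator_def)
  have Q_eq: "Q i k = Q i k * indicator (-{i}) k + Q i i * indicator {i} k" for k
    by (auto simp: indicator_def)
  have Q_int: "summable_l1 (Q i)"
  proof -
    have e: "Q i = (\<lambda>k. Q i k * indicator (-{i}) k + Q i i * indicator {i} k)" using Q_eq by blast
    show ?thesis
      by (subst e) (intro Bochner_Integration.integrable_add Q_off_int integrable_mult_right
        integrable_real_indicator, auto)
  qed
  have Q_ii: "Q i i \<le> 0" using has_sum_nonneg[OF Q_off] off by (auto simp: indicator_def)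
  have Q_norm: "(\<Sum>\<^sup>+ k. norm (Q i k)) = ennreal (- 2 * Q i i)"
  proof -
    have "(\<Sum>\<^sup>+ k. norm (Q i k))
      = (\<Sum>\<^sup>+ k. ennreal (Q i k * indicator (-{i}) k) + ennreal (- Q i i) * indicator {i} k)"
      using off Q_ii by (intro nn_integral_cong) (auto simp: indicator_def)
    also have "\<dots> = ennreal (- Q i i) + ennreal (- Q i i)"
    proof -
      have "0 \<le> Q i k * indicator (-{i}) k" for k using off by (auto simp: indicator_def)
      then show ?thesis using nn_integral_eq_integral[OF Q_off_int(1)] Q_off_int(2)
        by (simp add: nn_integral_add nn_integral_cmult_indicator)
    qed
    finally show ?thesis using Q_ii by (simp flip: ennreal_plus)
  qed
  have main: "(\<lambda>n. (\<Sum>\<^sup>1 k. (P (h n) i k - (if i = k then 1 else 0)) / h n * P (\<tau> n) k j))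
      \<longlonglongrightarrow> (\<Sum>\<^sup>1 k. Q i k * P t k j)"
    if h: "\<And>n. h n > 0" "h \<longlonglongrightarrow> 0" and \<tau>: "\<And>n. \<tau> n \<ge> 0" "\<And>n. \<tau> n = t \<or> \<tau> n + h n = t" for h \<tau>
  proof -
    define A where "A n k = (P (h n) i k - (if i = k then 1 else 0)) / h n" for n k
    have h0: "filterlim h (at_right 0) sequentially"
      unfolding filterlim_at using h by (auto simp: order_less_imp_not_eq2)
    have A_lim: "(\<lambda>n. A n k) \<longlonglongrightarrow> Q i k" for k
    proof -
      have "((\<lambda>y. (P y i k - P 0 i k) / (y - 0)) \<longlongrightarrow> Q i k) (at 0 within {0..})"
        using der[of i k] by (simp add: has_field_derivative_iff)
      then have "((\<lambda>y. (P y i k - P 0 i k) / (y - 0)) \<longlongrightarrow> Q i k) (at_right 0)"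
        by (rule tendsto_within_subset) auto
      from filterlim_compose[OF this h0] show ?thesis by (simp add: A_def P_0)
    qed
    have A_int: "summable_l1 (A n)" for n
    proof -
      have e: "A n k = (P (h n) i k - indicator {i} k) / h n" for k
        by (auto simp: A_def indicator_def)
      show ?thesis
        unfolding e using int_P(1)[of "h n" i] h(1)[of n]
        by (intro integrable_divide Bochner_Integration.integrable_diff integrable_real_indicator) auto
    qed
    have A_norm: "(\<Sum>\<^sup>+ k. norm (A n k)) \<le> ennreal (- 2 * A n i)" for n
    proof -
      have A_ii: "A n i \<le> 0"
        using P_le[of "h n" i i] h(1)[of n] by (simp add: A_def divide_nonpos_pos)
      have "(\<Sum>\<^sup>+ k. norm (A n k))
        = (\<Sum>\<^sup>+ k. ennreal (P (h n) i k * indicator (-{i}) k / h n) + ennreal (- A n i) * indicator {i} k)"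
      proof (intro nn_integral_cong)
        fix k
        show "ennreal (norm (A n k))
          = ennreal (P (h n) i k * indicator (-{i}) k / h n) + ennreal (- A n i) * indicator {i} k"
        proof (cases "k = i")
          case True
          then show ?thesis using A_ii by simp
        next
          case False
          then show ?thesis using h(1)[of n] P_nn[of "h n" i k] by (auto simp: A_def)
        qed
      qed
      also have "\<dots> = ennreal ((\<Sum>\<^sup>1 k. P (h n) i k * indicator (-{i}) k / h n)) + ennreal (- A n i)"
        using h(1)[of n] off_int[of "h n" i] P_nn[of "h n" i]
        by (subst nn_integral_add) (auto simp: nn_integral_eq_integral)
      also have "\<dots> \<le> ennreal (- A n i) + ennreal (- A n i)" using off_mass[of "h n" i] h(1)[of n]
        by (intro add_right_mono ennreal_leI) (auto simp: A_def field_simps)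
      finally show ?thesis using A_ii by (simp flip: ennreal_plus)
    qed
    \<comment> \<open>Scheffe's lemma asks that the norms of the rows do not exceed the norm of the
      limit asymptotically. Substochastic rows give at most \<open>-2 A n i\<close>, whose limit
      \<open>-2 Q i i\<close> is the full norm of the row of \<open>Q\<close> because
      \<open>Q\<close> is conservative.\<close>
    have "(\<lambda>n. \<Sum>\<^sup>+ k. norm (A n k - Q i k)) \<longlonglongrightarrow> 0"
    proof (rule Scheffe_lemma1)
      have "(\<lambda>n. ennreal (- 2 * A n i)) \<longlonglongrightarrow> ennreal (- 2 * Q i i)"
        by (intro tendsto_ennrealI tendsto_intros A_lim)
      then have "limsup (\<lambda>n. ennreal (- 2 * A n i)) = ennreal (- 2 * Q i i)"
        by (intro lim_imp_Limsup) auto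
      moreover have "limsup (\<lambda>n. \<Sum>\<^sup>+ k. norm (A n k)) \<le> limsup (\<lambda>n. ennreal (- 2 * A n i))"
        using A_norm by (intro Limsup_mono) auto
      ultimately show "limsup (\<lambda>n. \<Sum>\<^sup>+ k. norm (A n k)) \<le> (\<Sum>\<^sup>+ k. norm (Q i k))"
        using Q_norm by simp
    qed (use A_int Q_int A_lim in auto)
    then have L1: "(\<lambda>n. enn2real (\<Sum>\<^sup>+ k. norm (A n k - Q i k))) \<longlonglongrightarrow> 0"
      by (intro tendsto_enn2real) simp_all
    have diff: "(\<lambda>n. (\<Sum>\<^sup>1 k. (A n k - Q i k) * P (\<tau> n) k j)) \<longlonglongrightarrow> 0"
    proof (rule Lim_null_comparison[OF _ L1], rule always_eventually, rule allI)
      fix n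
      have int: "summable_l1 (\<lambda>k. A n k - Q i k)" using A_int Q_int by auto
      have "norm ((\<Sum>\<^sup>1 k. (A n k - Q i k) * P (\<tau> n) k j))
        \<le> (\<Sum>\<^sup>1 k. norm ((A n k - Q i k) * P (\<tau> n) k j))" by (rule integral_norm_bound)
      also have "\<dots> \<le> (\<Sum>\<^sup>1 k. norm (A n k - Q i k))" using int P_nn[OF \<tau>(1)] P_le[OF \<tau>(1)]
        by (intro integral_mono integrable_norm integrable_mult_bounded[where c = 1])
           (auto simp: abs_mult intro!: mult_left_le)
      also have "\<dots> = enn2real (\<Sum>\<^sup>+ k. norm (A n k - Q i k))" by (intro integral_eq_nn_integral) auto
      finally show "norm ((\<Sum>\<^sup>1 k. (A n k - Q i k) * P (\<tau> n) k j))
        \<le> enn2real (\<Sum>\<^sup>+ k. norm (A n k - Q i k))" .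
    qed
    have P_lim: "(\<lambda>n. P (\<tau> n) k j) \<longlonglongrightarrow> P t k j" for k
    proof -
      have "(\<lambda>n. 1 - P (h n) k k) \<longlonglongrightarrow> 1 - 1" by (intro tendsto_intros filterlim_compose[OF std h0])
      then have lim0: "(\<lambda>n. 1 - P (h n) k k) \<longlonglongrightarrow> 0" by simp
      have "(\<lambda>n. P (\<tau> n) k j - P t k j) \<longlonglongrightarrow> 0"
      proof (rule Lim_null_comparison[OF always_eventually lim0], rule allI)
        show "norm (P (\<tau> n) k j - P t k j) \<le> 1 - P (h n) k k" for n
          using \<tau>(2)[of n] modulus[of "\<tau> n" "h n" k j] \<tau>(1)[of n] h(1)[of n] P_le[of "h n" k k]
          by (auto simp: abs_minus_commute)
      qed
      then show ?thesis by (rule LIM_zero_cancel)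
    qed
    have "(\<lambda>n. (\<Sum>\<^sup>1 k. Q i k * P (\<tau> n) k j)) \<longlonglongrightarrow> (\<Sum>\<^sup>1 k. Q i k * P t k j)"
    proof (rule integral_dominated_convergence[where w = "\<lambda>k. norm (Q i k)"])
      show "AE k in count_space UNIV. norm (Q i k * P (\<tau> n) k j) \<le> norm (Q i k)" for n
        using P_nn[OF \<tau>(1)] P_le[OF \<tau>(1)] by (auto simp: abs_mult intro!: mult_left_le)
    qed (use Q_int P_lim in \<open>auto intro!: tendsto_intros\<close>)
    from tendsto_add[OF diff this]
    have "(\<lambda>n. (\<Sum>\<^sup>1 k. (A n k - Q i k) * P (\<tau> n) k j) + (\<Sum>\<^sup>1 k. Q i k * P (\<tau> n) k j))
        \<longlonglongrightarrow> (\<Sum>\<^sup>1 k. Q i k * P t k j)" by simp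
    moreover have "(\<Sum>\<^sup>1 k. (A n k - Q i k) * P (\<tau> n) k j) + (\<Sum>\<^sup>1 k. Q i k * P (\<tau> n) k j)
      = (\<Sum>\<^sup>1 k. A n k * P (\<tau> n) k j)" for n
      by (subst Bochner_Integration.integral_add[symmetric])
         (use A_int Q_int P_nn[OF \<tau>(1)] P_le[OF \<tau>(1)] in
          \<open>auto intro!: integrable_mult_bounded[where c = 1] Bochner_Integration.integral_cong
            simp: algebra_simps\<close>)
    ultimately show ?thesis by (simp add: A_def)
  qed
  show ?thesis
    unfolding has_field_derivative_iff
  proof (subst tendsto_at_iff_sequentially, intro allI impI)
    fix s :: "nat \<Rightarrow> real"
    assume "\<forall>n. s n \<in> {0..} - {t}" "s \<longlonglongrightarrow> t"
    then have s: "\<And>n. s n \<ge> 0" "\<And>n. s n \<noteq> t" "s \<longlonglongrightarrow> t" by auto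
    define h where "h n = \<bar>s n - t\<bar>" for n
    define \<tau> where "\<tau> n = min (s n) t" for n
    have h: "\<And>n. h n > 0" "h \<longlonglongrightarrow> 0" using s tendsto_rabs[OF tendsto_diff[OF s(3) tendsto_const[of t]]]
      by (auto simp: h_def[abs_def])
    have \<tau>: "\<tau> n \<ge> 0" "\<tau> n = t \<or> \<tau> n + h n = t" for n using s t by (auto simp: h_def \<tau>_def min_def)
    have "(P (s n) i j - P t i j) / (s n - t) = (\<Sum>\<^sup>1 k. (P (h n) i k - (if i = k then 1 else 0)) / h n * P (\<tau> n) k j)" for n
    proof -
      have "(P (s n) i j - P t i j) / (s n - t) = (P (h n + \<tau> n) i j - P (\<tau> n) i j) / h n"
        using s(2)[of n] by (auto simp: h_def \<tau>_def min_def field_simps)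
      also have "P (h n + \<tau> n) i j - P (\<tau> n) i j = (\<Sum>\<^sup>1 k. P (h n) i k * P (\<tau> n) k j)
          - (\<Sum>\<^sup>1 k. P 0 i k * P (\<tau> n) k j)"
        using CK_int(2)[of "h n" "\<tau> n" i j] CK_int(2)[of 0 "\<tau> n" i j] h(1)[of n] \<tau>(1)[of n] by simp
      also have "\<dots> = (\<Sum>\<^sup>1 k. (P (h n) i k - P 0 i k) * P (\<tau> n) k j)"
        using CK_int(1)[of "h n" "\<tau> n" i j] CK_int(1)[of 0 "\<tau> n" i j] h(1)[of n] \<tau>(1)[of n]
        by (subst Bochner_Integration.integral_diff[symmetric]) (auto simp: algebra_simps)
      finally show ?thesis by (simp add: P_0 flip: integral_divide_zero)
    qed
    then show "((\<lambda>y. (P y i j - P t i j) / (y - t)) \<circ> s) \<longlonglongrightarrow> (\<Sum>\<^sup>1 k. Q i k * P t k j)"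
      using main[OF h \<tau>] by (simp add: comp_def)
  qed
qed

section \<open>Poisson representation of the transition function\<close>

lemma DERIV_abs_le:
  fixes f g :: "real \<Rightarrow> real"
  assumes "t \<ge> 0" "f 0 = 0" "g 0 = 0"
    and f: "\<And>x. 0 \<le> x \<Longrightarrow> x \<le> t \<Longrightarrow> (f has_real_derivative f' x) (at x within {0..})"
    and g: "\<And>x. 0 \<le> x \<Longrightarrow> x \<le> t \<Longrightarrow> (g has_real_derivative g' x) (at x within {0..})"
    and le: "\<And>x. 0 \<le> x \<Longrightarrow> x \<le> t \<Longrightarrow> \<bar>f' x\<bar> \<le> g' x"
  shows "\<bar>f t\<bar> \<le> g t"
proof (cases "t = 0")
  case False
  have at: "at x within {0..} = at x" if "0 < x" for x :: real
    using that by (intro at_within_interior) auto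
  have cont: "continuous_on {0..t} h"
    if "\<And>x. 0 \<le> x \<Longrightarrow> x \<le> t \<Longrightarrow> (h has_real_derivative h' x) (at x within {0..})" for h h' :: "real \<Rightarrow> real"
    unfolding continuous_on_eq_continuous_within
  proof
    fix x assume "x \<in> {0..t}"
    then have "(h has_real_derivative h' x) (at x within {0..t})"
      using that[of x] by (auto intro: has_field_derivative_subset)
    then show "continuous (at x within {0..t}) h" by (rule DERIV_continuous)
  qed
  have "norm (f t - f 0) \<le> g t - g 0"
  proof (rule differentiable_bound_general[OF _ cont[OF f] cont[OF g]])
    fix x assume x: "0 < x" "x < t"
    show "(f has_vector_derivative f' x) (at x)" "(g has_vector_derivative g' x) (at x)"
      using f[of x] g[of x] x by (simp_all add: at has_real_derivative_iff_has_vector_derivative)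
    show "norm (f' x) \<le> g' x" using le[of x] x by simp
  qed (use False \<open>t \<ge> 0\<close> in auto)
  then show ?thesis using assms by simp
qed (use assms in simp)

abbreviation poisson_weight :: "real \<Rightarrow> nat \<Rightarrow> real" where
  "poisson_weight a n \<equiv> exp (- a) * a ^ n / fact n"

text \<open>\<open>D N\<close> is the error of the \<open>N\<close>th partial sum after
  multiplication by \<open>exp (L t)\<close>. The backward equation gives
  \<open>D (N + 1)' = L K D N\<close> with value 0 at time 0, so each integration gains a factor as
  in the exponential series. Nothing but the backward equation and the bounds on \<open>P\<close>
  enters, so the formula also shows that the Q-function is unique.\<close>

lemma uniformization:
  fixes K :: "'a \<Rightarrow> 'a \<Rightarrow> real"
  assumes QP: "Q_function Q P" and L: "L > 0"
    and Q: "\<And>i j. Q i j = L * (K i j - (if i = j then 1 else 0))"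
    and K_nn: "\<And>i j. K i j \<ge> 0" and K_sum: "\<And>i. (K i has_sum 1) UNIV" and t: "t \<ge> 0"
  shows "ennreal (P t i j)
    = (\<Sum>n. ennreal (poisson_weight (L * t) n) * kpow (\<lambda>i j. ennreal (K i j)) n i j)"
proof -
  define KE where "KE = (\<lambda>i j. ennreal (K i j))"
  define \<kappa> where "\<kappa> n i j = enn2real (kpow KE n i j)" for n i j
  have K_int: "summable_l1 (K i)" for i using integral_of_has_sum[OF K_sum K_nn] by auto
  have KE_sum: "(\<Sum>\<^sup>+ j. KE i j) = 1" for i
    using K_sum[of i] K_nn by (subst (asm) has_sum_iff_nn_integral) (auto simp: KE_def)
  have kp: "kpow KE n i j = ennreal (\<kappa> n i j)" and \<kappa>_nn: "\<kappa> n i j \<ge> 0" and \<kappa>_le: "\<kappa> n i j \<le> 1" for n i j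
  proof -
    have le: "kpow KE n i j \<le> 1" by (rule stochastic_kpow_le_1[OF KE_sum])
    then show e: "kpow KE n i j = ennreal (\<kappa> n i j)"
      by (auto simp: \<kappa>_def ennreal_enn2real_if top_unique)
    show nn: "\<kappa> n i j \<ge> 0" by (simp add: \<kappa>_def)
    show "\<kappa> n i j \<le> 1" using le nn unfolding e by (simp add: ennreal_le_1)
  qed
  have \<kappa>_0: "\<kappa> 0 i j = (if i = j then 1 else 0)" for i j by (simp add: \<kappa>_def kpow_0 indicator_def)
  have K\<kappa>_int: "summable_l1 (\<lambda>k. K i k * \<kappa> n k j)" for n i j
    using K_int \<kappa>_nn \<kappa>_le by (intro integrable_mult_bounded[where c = 1]) auto
  have \<kappa>_Suc: "\<kappa> (Suc n) i j = (\<Sum>\<^sup>1 k. K i k * \<kappa> n k j)" for n i j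
  proof -
    have "kpow KE (Suc n) i j = (\<Sum>\<^sup>+ k. ennreal (K i k * \<kappa> n k j))"
      by (simp add: kpow_Suc kp ennreal_mult K_nn \<kappa>_nn) (simp add: KE_def)
    also have "\<dots> = ennreal ((\<Sum>\<^sup>1 k. K i k * \<kappa> n k j))"
      using K\<kappa>_int[of i n j] K_nn \<kappa>_nn by (intro nn_integral_eq_integral) auto
    finally show ?thesis using K_nn \<kappa>_nn by (simp add: \<kappa>_def integral_nonneg_AE)
  qed
  have tf: "transition_function P" using QP by (simp add: Q_function_def)
  note P_bounds = transition_function_bounds[OF tf]
  have KP_int: "summable_l1 (\<lambda>k. K i k * P t k j)" if "t \<ge> 0" for i j t
    using K_int P_bounds[OF that] by (intro integrable_mult_bounded[where c = 1]) auto
  have off: "Q i j \<ge> 0" if "i \<noteq> j" for i j using that L K_nn by (simp add: Q)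
  have cons: "((\<lambda>j. Q i j) has_sum (- Q i i)) (UNIV - {i})" for i
  proof -
    have "(K i has_sum (1 - K i i)) (UNIV - {i})"
      using K_sum[of i] has_sum_finite[of "{i}" "K i"] by (intro has_sum_Diff) auto
    then have "((\<lambda>j. L * K i j) has_sum (L * (1 - K i i))) (UNIV - {i})"
      by (rule has_sum_cmult_right)
    moreover have "L * (1 - K i i) = - Q i i" by (simp add: Q algebra_simps)
    moreover have "((\<lambda>j. L * K i j) has_sum (- Q i i)) (UNIV - {i}) \<longleftrightarrow> (Q i has_sum (- Q i i)) (UNIV - {i})"
      by (rule has_sum_cong) (auto simp: Q)
    ultimately show ?thesis by simp
  qed
  have der_P: "((\<lambda>t. P t i j) has_real_derivative
      L * ((\<Sum>\<^sup>1 k. K i k * P t k j) - P t i j)) (at t within {0..})"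
    if "t \<ge> 0" for t i j
  proof -
    have "(\<Sum>\<^sup>1 k. Q i k * P t k j) = (\<Sum>\<^sup>1 k. L * (K i k * P t k j) - L * P t i j * indicator {i} k)"
      by (intro Bochner_Integration.integral_cong) (auto simp: Q indicator_def algebra_simps)
    also have "\<dots> = L * ((\<Sum>\<^sup>1 k. K i k * P t k j) - P t i j)" using KP_int[OF that, of i j]
      by (subst Bochner_Integration.integral_diff)
         (auto intro!: integrable_mult_right integrable_real_indicator
           simp: measure_count_space algebra_simps)
    finally show ?thesis using Q_function_backward[OF QP off cons that, of i j] by simp
  qed
  define D where "D N i j t = exp (L * t) * P t i j - (\<Sum>n<N. (L * t) ^ n / fact n * \<kappa> n i j)"
    for N i j t
  have power_deriv: "((\<lambda>x. (L * x) ^ Suc n / fact (Suc n)) has_real_derivative L * ((L * x) ^ n / fact n))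
      (at x within {0..})" for n x
  proof -
    have "((\<lambda>x. (L * x) ^ Suc n) has_real_derivative real (Suc n) * (L * x) ^ n * L) (at x within {0..})"
      using DERIV_power_Suc[OF DERIV_cmult_Id[of L x "{0..}"], of n] by (simp add: algebra_simps)
    from DERIV_cdivide[OF this, of "fact (Suc n)"] show ?thesis
      by (simp add: field_simps del: of_nat_Suc power_Suc)
  qed
  \<comment> \<open>The factor \<open>exp (L * t)\<close> is taken at the fixed final time and not
    at \<open>s\<close>: as a constant it passes unchanged through the integrations of the
    induction.\<close>
  have bound: "\<bar>D N i j s\<bar> \<le> exp (L * t) * ((L * s) ^ N / fact N)" if "0 \<le> s" "s \<le> t" for N i j s
    using that
  proof (induction N arbitrary: i j s)
    case 0
    have "exp (L * s) * P s i j \<le> exp (L * t) * 1"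
      using 0 L P_bounds[OF 0(1)] by (intro mult_mono) auto
    then show ?case using P_bounds[OF 0(1)] by (simp add: D_def)
  next
    case (Suc N)
    have D_int: "summable_l1 (\<lambda>k. K i k * D N k j x)"
      "(\<Sum>\<^sup>1 k. K i k * D N k j x) = exp (L * x) * (\<Sum>\<^sup>1 k. K i k * P x k j)
          - (\<Sum>n<N. (L * x) ^ n / fact n * \<kappa> (Suc n) i j)" if "x \<ge> 0" for x
    proof -
      have e: "K i k * D N k j x = exp (L * x) * (K i k * P x k j)
        - (\<Sum>n<N. (L * x) ^ n / fact n * (K i k * \<kappa> n k j))" for k
        by (simp add: D_def algebra_simps sum_distrib_left)
      show "summable_l1 (\<lambda>k. K i k * D N k j x)"
        unfolding e using KP_int[OF that] K\<kappa>_int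
        by (intro Bochner_Integration.integrable_diff Bochner_Integration.integrable_sum integrable_mult_right)
      show "(\<Sum>\<^sup>1 k. K i k * D N k j x) = exp (L * x) * (\<Sum>\<^sup>1 k. K i k * P x k j)
          - (\<Sum>n<N. (L * x) ^ n / fact n * \<kappa> (Suc n) i j)"
        unfolding e \<kappa>_Suc using KP_int[OF that, of i j] K\<kappa>_int
        by (subst Bochner_Integration.integral_diff)
           (auto intro!: Bochner_Integration.integrable_sum integrable_mult_right
             simp: Bochner_Integration.integral_sum)
    qed
    show ?case
    proof (rule DERIV_abs_le[OF Suc.prems(1), where f = "D (Suc N) i j"
          and f' = "\<lambda>x. L * (\<Sum>\<^sup>1 k. K i k * D N k j x)"
          and g' = "\<lambda>x. L * (exp (L * t) * ((L * x) ^ N / fact N))"])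
      show "D (Suc N) i j 0 = 0"
        unfolding D_def sum.lessThan_Suc_shift using tf by (simp add: \<kappa>_0 transition_function_def)
      show "exp (L * t) * ((L * 0) ^ Suc N / fact (Suc N)) = 0" by simp
    next
      fix x assume x: "0 \<le> x" "x \<le> s"
      have s: "((\<lambda>x. \<Sum>n<Suc N. (L * x) ^ n / fact n * \<kappa> n i j) has_real_derivative
          L * (\<Sum>n<N. (L * x) ^ n / fact n * \<kappa> (Suc n) i j)) (at x within {0..})"
      proof -
        have "((\<lambda>x. (L * x) ^ Suc n / fact (Suc n) * \<kappa> (Suc n) i j) has_real_derivative
          L * ((L * x) ^ n / fact n * \<kappa> (Suc n) i j)) (at x within {0..})" for n
          using DERIV_cmult_right[OF power_deriv[of n x], of "\<kappa> (Suc n) i j"] by (simp only: mult.assoc)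
        then have "((\<lambda>x. \<Sum>n<N. (L * x) ^ Suc n / fact (Suc n) * \<kappa> (Suc n) i j) has_real_derivative
          (\<Sum>n<N. L * ((L * x) ^ n / fact n * \<kappa> (Suc n) i j))) (at x within {0..})"
          by (rule DERIV_sum)
        from DERIV_add[OF DERIV_const[of "\<kappa> 0 i j"] this] show ?thesis
          unfolding sum.lessThan_Suc_shift sum_distrib_left
          by (simp del: power_Suc fact_Suc of_nat_Suc)
      qed
      show "(D (Suc N) i j has_real_derivative L * (\<Sum>\<^sup>1 k. K i k * D N k j x)) (at x within {0..})"
        unfolding D_def[abs_def] D_int(2)[OF x(1), unfolded D_def]
        by (rule derivative_eq_intros s der_P[OF x(1)] refl)+ (simp add: algebra_simps)
      show "((\<lambda>s. exp (L * t) * ((L * s) ^ Suc N / fact (Suc N))) has_real_derivative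
          L * (exp (L * t) * ((L * x) ^ N / fact N))) (at x within {0..})"
        using DERIV_cmult[OF power_deriv[of N x], of "exp (L * t)"] by (simp only: mult_ac)
      have "\<bar>(\<Sum>\<^sup>1 k. K i k * D N k j x)\<bar> \<le> (\<Sum>\<^sup>1 k. \<bar>K i k * D N k j x\<bar>)"
        using integral_norm_bound[of "count_space UNIV" "\<lambda>k. K i k * D N k j x"] by simp
      also have "\<dots> \<le> (\<Sum>\<^sup>1 k. K i k * (exp (L * t) * ((L * x) ^ N / fact N)))"
      proof (intro integral_mono)
        show "summable_l1 (\<lambda>k. \<bar>K i k * D N k j x\<bar>)" using D_int(1)[OF x(1)] by auto
        show "summable_l1 (\<lambda>k. K i k * (exp (L * t) * ((L * x) ^ N / fact N)))" using K_int by auto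
        show "\<bar>K i k * D N k j x\<bar> \<le> K i k * (exp (L * t) * ((L * x) ^ N / fact N))" for k
          using mult_left_mono[OF Suc.IH[of x k j] K_nn[of i k]] x Suc.prems K_nn[of i k]
          by (simp only: abs_mult abs_of_nonneg)
      qed
      also have "\<dots> = exp (L * t) * ((L * x) ^ N / fact N)"
        using integral_of_has_sum(2)[OF K_sum K_nn, of i] by simp
      finally have "L * \<bar>(\<Sum>\<^sup>1 k. K i k * D N k j x)\<bar> \<le> L * (exp (L * t) * ((L * x) ^ N / fact N))"
        using L by (intro mult_left_mono) auto
      then show "\<bar>L * (\<Sum>\<^sup>1 k. K i k * D N k j x)\<bar> \<le> L * (exp (L * t) * ((L * x) ^ N / fact N))"
        using L by (simp only: abs_mult abs_of_pos)
    qed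
  qed
  have "(\<lambda>N. D N i j t) \<longlonglongrightarrow> 0"
  proof (rule Lim_null_comparison[OF always_eventually])
    show "\<forall>N. norm (D N i j t) \<le> exp (L * t) * ((L * t) ^ N / fact N)" using bound t by auto
    have "(\<lambda>N. (L * t) ^ N / fact N) \<longlonglongrightarrow> 0"
      using summable_LIMSEQ_zero[OF summable_exp[of "L * t"]] by (simp add: field_simps)
    then show "(\<lambda>N. exp (L * t) * ((L * t) ^ N / fact N)) \<longlonglongrightarrow> 0" by (rule tendsto_mult_right_zero)
  qed
  then have "(\<lambda>n. (L * t) ^ n / fact n * \<kappa> n i j) sums (exp (L * t) * P t i j)"
    unfolding sums_def D_def using Lim_transform2 tendsto_const by fastforce
  from sums_mult[OF this, of "exp (- (L * t))"]
  have "(\<lambda>n. exp (- (L * t)) * (L * t) ^ n / fact n * \<kappa> n i j) sums P t i j"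
    by (simp add: mult.assoc[symmetric] flip: exp_add)
  then have "(\<Sum>n. ennreal (exp (- (L * t)) * (L * t) ^ n / fact n * \<kappa> n i j)) = ennreal (P t i j)"
    using L t \<kappa>_nn by (intro suminf_ennreal_eq) auto
  moreover have "ennreal (exp (- (L * t)) * (L * t) ^ n / fact n * \<kappa> n i j)
    = ennreal (poisson_weight (L * t) n) * kpow KE n i j" for n
    unfolding kp using L t \<kappa>_nn by (intro ennreal_mult) auto
  ultimately show ?thesis unfolding KE_def by (simp only:)
qed

section \<open>Laplace transforms as Green functions\<close>

lemma nn_integral_power_exp:
  assumes "a > 0"
  shows "(\<integral>\<^sup>+ t. ennreal (t ^ n * exp (- (a * t))) * indicator {0..} t \<partial>lborel)
    = ennreal (fact n / a ^ Suc n)" (is "?I = _")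
proof -
  have "ennreal (fact n) = (\<integral>\<^sup>+ t. ennreal (t ^ n * exp (- t)) * indicator {0..} t \<partial>lborel)"
    by (simp add: nn_intergal_power_times_exp_Ici)
  also have "\<dots> = ennreal a * (\<integral>\<^sup>+ t. ennreal ((a * t) ^ n * exp (- (a * t))) * indicator {0..} (a * t) \<partial>lborel)"
    using assms by (subst nn_integral_real_affine[where c = a and t = 0]) auto
  also have "(\<integral>\<^sup>+ t. ennreal ((a * t) ^ n * exp (- (a * t))) * indicator {0..} (a * t) \<partial>lborel)
    = (\<integral>\<^sup>+ t. ennreal (a ^ n) * (ennreal (t ^ n * exp (- (a * t))) * indicator {0..} t) \<partial>lborel)"
    using assms by (intro nn_integral_cong)
      (auto simp: indicator_def zero_le_mult_iff power_mult_distrib ennreal_mult mult_ac)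
  also have "\<dots> = ennreal (a ^ n) * ?I"
    by (rule nn_integral_cmult) auto
  finally have *: "ennreal (fact n) = ennreal (a ^ Suc n)
      * ?I"
    using assms by (simp add: ennreal_mult mult.assoc)
  have "ennreal (fact n / a ^ Suc n) = ennreal (1 / a ^ Suc n) * ennreal (fact n)"
    using assms by (simp flip: ennreal_mult)
  also have "\<dots> = ?I"
    unfolding * mult.assoc[symmetric] using assms by (simp flip: ennreal_mult)
  finally show ?thesis by simp
qed

text \<open>Integrating \<open>exp (l t)\<close> against the \<open>n\<close>th Poisson weight gives
  \<open>L^n / (L - l)^(n+1)\<close>, so Poisson weights turn into geometric weights with ratio
  \<open>L / (L - l)\<close>.\<close>

lemma laplace_eq_green:
  assumes unif: "\<And>t. t \<ge> 0 \<Longrightarrow> ennreal (P t i j)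
      = (\<Sum>n. ennreal (poisson_weight (L * t) n) * kpow K n i j)"
    and P_nn: "\<And>t. t \<ge> 0 \<Longrightarrow> P t i j \<ge> 0" and L: "L > 0" and l: "0 \<le> l" "l < L"
  shows "(\<integral>\<^sup>+ t\<in>{0..}. ennreal (exp (l * t) * P t i j) \<partial>lborel)
    = ennreal (1 / (L - l)) * green K (L / (L - l)) i j"
proof -
  have "(\<integral>\<^sup>+ t\<in>{0..}. ennreal (exp (l * t) * P t i j) \<partial>lborel)
    = (\<integral>\<^sup>+ t. (\<Sum>n. ennreal (L ^ n / fact n) * kpow K n i j
        * (ennreal (t ^ n * exp (- ((L - l) * t))) * indicator {0..} t)) \<partial>lborel)"
  proof (intro nn_integral_cong)
    fix t :: real
    show "ennreal (exp (l * t) * P t i j) * indicator {0..} t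
      = (\<Sum>n. ennreal (L ^ n / fact n) * kpow K n i j
        * (ennreal (t ^ n * exp (- ((L - l) * t))) * indicator {0..} t))"
    proof (cases "t \<ge> 0")
      case True
      have "ennreal (exp (l * t)) * (ennreal (poisson_weight (L * t) n) * kpow K n i j)
        = ennreal (L ^ n / fact n) * kpow K n i j * ennreal (t ^ n * exp (- ((L - l) * t)))" for n
      proof -
        have "exp (l * t) * (poisson_weight (L * t) n)
          = L ^ n / fact n * (t ^ n * exp (- ((L - l) * t)))"
          by (simp add: power_mult_distrib algebra_simps flip: exp_add)
        then have "ennreal (exp (l * t)) * ennreal (poisson_weight (L * t) n)
          = ennreal (L ^ n / fact n) * ennreal (t ^ n * exp (- ((L - l) * t)))"
          using True L by (simp flip: ennreal_mult)
        then have "ennreal (exp (l * t)) * ennreal (poisson_weight (L * t) n) * kpow K n i j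
          = ennreal (L ^ n / fact n) * ennreal (t ^ n * exp (- ((L - l) * t))) * kpow K n i j"
          by (rule arg_cong)
        then show ?thesis by (metis (no_types, lifting) mult.assoc mult.commute)
      qed
      then show ?thesis using True P_nn[OF True]
        by (simp add: ennreal_mult unif flip: ennreal_suminf_cmult)
    qed simp
  qed
  also have "\<dots> = (\<Sum>n. ennreal (L ^ n / fact n) * kpow K n i j * ennreal (fact n / (L - l) ^ Suc n))"
    using l by (subst nn_integral_suminf)
      (auto simp: nn_integral_cmult nn_integral_power_exp intro!: borel_measurable_times)
  also have "\<dots> = (\<Sum>n. ennreal (1 / (L - l)) * (ennreal ((L / (L - l)) ^ n) * kpow K n i j))"
  proof (intro suminf_cong)
    fix n
    have "L ^ n / fact n * (fact n / (L - l) ^ Suc n) = 1 / (L - l) * (L / (L - l)) ^ n"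
      using l by (simp add: field_simps)
    then have "ennreal (L ^ n / fact n) * ennreal (fact n / (L - l) ^ Suc n)
      = ennreal (1 / (L - l)) * ennreal ((L / (L - l)) ^ n)"
      using l L by (simp flip: ennreal_mult)
    then show "ennreal (L ^ n / fact n) * kpow K n i j * ennreal (fact n / (L - l) ^ Suc n)
      = ennreal (1 / (L - l)) * (ennreal ((L / (L - l)) ^ n) * kpow K n i j)"
      by (metis mult.assoc mult.commute)
  qed
  finally show ?thesis by (simp add: green_def)
qed

section \<open>Matrices with nonnegative off-diagonal entries\<close>

text \<open>Applying \<open>A - l0\<close> to a linear relation removes the term of
  \<open>l0\<close> and multiplies the others by nonzero numbers. The resulting finiteness of the
  spectrum is what makes the \<open>Max\<close> in \<open>max_real_eigenvalue\<close>
  meaningful.\<close>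

lemma eigenvectors_independent:
  fixes A :: "real ^ 'n ^ 'n"
  assumes "finite L" "\<And>l. l \<in> L \<Longrightarrow> v l \<noteq> 0 \<and> A *v v l = l *\<^sub>R v l"
    and "(\<Sum>l\<in>L. c l *\<^sub>R v l) = 0" "l \<in> L"
  shows "c l = 0"
  using assms
proof (induction L arbitrary: c l rule: finite_induct)
  case empty
  then show ?case by simp
next
  case (insert l0 L)
  have ev: "A *v v l = l *\<^sub>R v l" if "l \<in> insert l0 L" for l using insert.prems(1) that by blast
  have "0 = A *v (\<Sum>l\<in>insert l0 L. c l *\<^sub>R v l)" using insert.prems(2) by simp
  also have "\<dots> = (\<Sum>l\<in>insert l0 L. A *v (c l *\<^sub>R v l))"
    by (rule linear_sum[OF matrix_vector_mul_linear])
  also have "\<dots> = (\<Sum>l\<in>insert l0 L. (c l * l) *\<^sub>R v l)"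
    by (intro sum.cong refl) (simp add: matrix_vector_mult_scaleR ev)
  finally have "0 = (\<Sum>l\<in>insert l0 L. (c l * l) *\<^sub>R v l) - l0 *\<^sub>R (\<Sum>l\<in>insert l0 L. c l *\<^sub>R v l)"
    unfolding insert.prems(2) by simp
  also have "\<dots> = (\<Sum>l\<in>insert l0 L. (c l * (l - l0)) *\<^sub>R v l)"
    by (simp only: scaleR_sum_right flip: sum_subtractf) (simp add: algebra_simps)
  also have "\<dots> = (\<Sum>l\<in>L. (c l * (l - l0)) *\<^sub>R v l)" using insert.hyps by simp
  finally have "c l * (l - l0) = 0" if "l \<in> L" for l
    using insert.IH[of "\<lambda>l. c l * (l - l0)" l] insert.prems(1) that by simp
  then have cL: "c l = 0" if "l \<in> L" for l
    using insert.hyps(2) that by (metis eq_iff_diff_eq_0 mult_eq_0_iff)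
  then have "(\<Sum>l\<in>insert l0 L. c l *\<^sub>R v l) = c l0 *\<^sub>R v l0" using insert.hyps by simp
  then have "c l0 = 0" using insert.prems(1)[of l0] insert.prems(2) by simp
  with cL insert.prems(3) show ?case by blast
qed

lemma finite_eigenvalues:
  fixes A :: "real ^ 'n ^ 'n"
  shows "finite {l. \<exists>v. v \<noteq> 0 \<and> A *v v = l *\<^sub>R v}"
proof -
  let ?E = "{l. \<exists>v. v \<noteq> 0 \<and> A *v v = l *\<^sub>R v}"
  have "card L \<le> DIM(real ^ 'n)" if "L \<subseteq> ?E" "finite L" for L
  proof -
    have "\<forall>l\<in>L. \<exists>v. v \<noteq> 0 \<and> A *v v = l *\<^sub>R v" using that by auto
    then obtain v where v: "\<And>l. l \<in> L \<Longrightarrow> v l \<noteq> 0 \<and> A *v v l = l *\<^sub>R v l" by metis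
    have inj: "inj_on v L" by (intro inj_onI) (metis v scaleR_cancel_right)
    have "independent (v ` L)"
    proof (rule independent_if_scalars_zero)
      fix f x assume s: "(\<Sum>x\<in>v ` L. f x *\<^sub>R x) = 0" and "x \<in> v ` L"
      then obtain l where l: "l \<in> L" "x = v l" by auto
      have "(\<Sum>l\<in>L. f (v l) *\<^sub>R v l) = 0" using s by (simp add: sum.reindex[OF inj])
      from eigenvectors_independent[OF that(2) v this l(1)] show "f x = 0" using l by simp
    qed (use that in auto)
    then have "card (v ` L) \<le> DIM(real ^ 'n)" by (rule independent_card_le)
    then show ?thesis by (simp add: card_image[OF inj])
  qed
  then show ?thesis using finite_if_finite_subsets_card_bdd[of ?E] by blast
qed

text \<open>At the row where \<open>w / v\<close> is largest, with ratio \<open>c\<close>, the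
  vector \<open>c v - w\<close> is nonnegative and vanishes in that coordinate, so only off-diagonal
  entries act on it there. Used both for maximality of the Perron eigenvalue and to show that the
  minimal root is 1.\<close>

lemma max_ratio_row:
  fixes A :: "real ^ 'n ^ 'n"
  assumes off: "\<And>r s. r \<noteq> s \<Longrightarrow> A $ r $ s \<ge> 0" and v: "\<And>r. v $ r > 0"
    and w: "w $ r0 > 0"
  obtains r where "w $ r > 0" "(A *v w) $ r \<le> w $ r / v $ r * (A *v v) $ r"
proof -
  obtain r where r: "\<And>s. w $ s / v $ s \<le> w $ r / v $ r"
  proof -
    let ?g = "\<lambda>s. w $ s / v $ s"
    have "Max (range ?g) \<in> range ?g" by (rule Max_in) auto
    then obtain r where "Max (range ?g) = ?g r" by blast
    moreover have "?g s \<le> Max (range ?g)" for s by (rule Max_ge) auto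
    ultimately show thesis using that[of r] by metis
  qed
  define c where "c = w $ r / v $ r"
  have "c > 0" using r[of r0] w v[of r0] by (simp add: c_def) (meson divide_pos_pos less_le_trans)
  moreover have wr: "w $ r = c * v $ r" using v[of r] by (simp add: c_def)
  ultimately have "w $ r > 0" using v[of r] by simp
  moreover have "(A *v w) $ r \<le> c * (A *v v) $ r"
  proof -
    have "A $ r $ s * w $ s \<le> A $ r $ s * (c * v $ s)" for s
    proof (cases "s = r")
      case False
      have "w $ s \<le> c * v $ s" using r[of s] v[of s] by (simp add: c_def field_simps)
      then show ?thesis using off[of r s] False by (intro mult_left_mono) auto
    qed (simp add: wr)
    then have "(\<Sum>s\<in>UNIV. A $ r $ s * w $ s) \<le> (\<Sum>s\<in>UNIV. A $ r $ s * (c * v $ s))"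
      by (intro sum_mono)
    then show ?thesis by (simp add: matrix_vector_mult_def sum_distrib_left mult.left_commute)
  qed
  ultimately show thesis using that by (simp add: c_def)
qed

text \<open>A Brouwer fixed point of the normalised action on the simplex is a nonnegative
  eigenvector; irreducibility makes it positive, and comparison with any other eigenvector through
  \<open>max_ratio_row\<close> shows that its eigenvalue is the largest real one.\<close>

lemma perron_frobenius:
  fixes A :: "real ^ 'n ^ 'n"
  assumes off: "\<And>r s. r \<noteq> s \<Longrightarrow> A $ r $ s \<ge> 0"
    and irr: "\<And>r s. (r, s) \<in> {(r, s). r \<noteq> s \<and> A $ r $ s > 0}\<^sup>+"
  obtains v where "\<And>r. v $ r > 0" "A *v v = max_real_eigenvalue A *\<^sub>R v"
proof -
  \<comment> \<open>The shift makes all diagonal entries of \<open>M\<close> at least 1. Then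
    \<open>M\<close> does not decrease nonnegative vectors, and the normalising sum is at least 1 on
    the simplex.\<close>
  define c where "c = 1 + (\<Sum>r\<in>UNIV. \<bar>A $ r $ r\<bar>)"
  define M where "M = A + c *\<^sub>R mat 1"
  have diag: "M $ r $ r \<ge> 1" for r
  proof -
    have "\<bar>A $ r $ r\<bar> \<le> (\<Sum>r\<in>UNIV. \<bar>A $ r $ r\<bar>)" by (rule member_le_sum) auto
    then show ?thesis by (simp add: M_def c_def mat_def)
  qed
  have M_off: "M $ r $ s = A $ r $ s" if "r \<noteq> s" for r s using that by (simp add: M_def mat_def)
  have M_nn: "M $ r $ s \<ge> 0" for r s
    using diag[of r] M_off[of r s] off[of r s] by (cases "r = s") auto
  have M_mult: "M *v x = A *v x + c *\<^sub>R x" for x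
    by (simp add: M_def matrix_vector_mult_add_rdistrib flip: scaleR_matrix_vector_assoc)
  define S where "S = {x :: real ^ 'n. (\<forall>r. 0 \<le> x $ r) \<and> (\<Sum>r\<in>UNIV. x $ r) = 1}"
  have Mx: "(M *v x) $ r \<ge> x $ r" if "\<And>r. 0 \<le> x $ r" for x r
  proof -
    have "x $ r \<le> M $ r $ r * x $ r" using mult_right_mono[OF diag[of r] that[of r]] by simp
    also have "\<dots> \<le> (\<Sum>s\<in>UNIV. M $ r $ s * x $ s)" using M_nn that by (intro member_le_sum) auto
    finally show ?thesis by (simp add: matrix_vector_mult_def)
  qed
  have sum_ge: "(\<Sum>r\<in>UNIV. (M *v x) $ r) \<ge> 1" if "x \<in> S" for x
  proof -
    have "(\<Sum>r\<in>UNIV. x $ r) \<le> (\<Sum>r\<in>UNIV. (M *v x) $ r)"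
      using that by (intro sum_mono Mx) (auto simp: S_def)
    then show ?thesis using that by (simp add: S_def)
  qed
  define f where "f x = inverse (\<Sum>r\<in>UNIV. (M *v x) $ r) *\<^sub>R (M *v x)" for x
  obtain x where x: "x \<in> S" "f x = x"
  proof (rule brouwer[of S f])
    have "closed S"
      unfolding S_def
      by (intro closed_Collect_conj closed_Collect_all closed_Collect_le closed_Collect_eq continuous_intros)
    moreover have "bounded S"
    proof (rule boundedI)
      fix x assume x: "x \<in> S"
      have "norm x \<le> (\<Sum>r\<in>UNIV. \<bar>x $ r\<bar>)" by (rule norm_le_l1_cart)
      also have "\<dots> = 1" using x by (simp add: S_def)
      finally show "norm x \<le> 1" .
    qed
    ultimately show "compact S" by (simp add: compact_eq_bounded_closed)
    show "convex S"
      unfolding S_def convex_def by (auto simp: sum.distrib simp flip: sum_distrib_left)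
    have "axis undefined 1 \<in> S" by (auto simp: S_def axis_def)
    then show "S \<noteq> {}" by blast
    show "continuous_on S f"
      unfolding f_def using sum_ge by (intro continuous_intros) force+
    show "f \<in> S \<rightarrow> S"
    proof
      fix x assume x: "x \<in> S"
      have "0 \<le> (M *v x) $ r" for r using x Mx[of x r] by (force simp: S_def intro: order_trans)
      then show "f x \<in> S" using sum_ge[OF x] by (auto simp: S_def f_def simp flip: sum_distrib_left)
    qed
  qed blast
  define \<sigma> where "\<sigma> = (\<Sum>r\<in>UNIV. (M *v x) $ r)"
  have \<sigma>: "\<sigma> \<ge> 1" using sum_ge[OF x(1)] by (simp add: \<sigma>_def)
  have ev: "M *v x = \<sigma> *\<^sub>R x"
  proof -
    have "\<sigma> *\<^sub>R x = \<sigma> *\<^sub>R f x" by (simp only: x(2))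
    also have "\<dots> = M *v x" using \<sigma> by (simp add: f_def flip: \<sigma>_def)
    finally show ?thesis by simp
  qed
  have x_nn: "0 \<le> x $ r" for r using x by (simp add: S_def)
  obtain s where s: "x $ s > 0"
  proof -
    have "\<exists>s. x $ s \<noteq> 0"
    proof (rule ccontr)
      assume "\<not> ?thesis"
      then have "(\<Sum>r\<in>UNIV. x $ r) = 0" by simp
      with x show False by (simp add: S_def)
    qed
    then show thesis using that x_nn by (metis less_eq_real_def)
  qed
  \<comment> \<open>Positivity spreads from \<open>s\<close> backwards along positive entries:
    \<open>\<sigma> x_r\<close> is at least \<open>M_rt x_t\<close>.\<close>
  have pos: "x $ r > 0" for r using irr[of r s]
  proof (induction rule: converse_trancl_induct)
    have step: "x $ r > 0" if "r \<noteq> t" "A $ r $ t > 0" "x $ t > 0" for r t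
    proof -
      have "0 < M $ r $ t * x $ t" using that by (simp add: M_off)
      also have "\<dots> \<le> (\<Sum>s\<in>UNIV. M $ r $ s * x $ s)" using M_nn x_nn by (intro member_le_sum) auto
      also have "\<dots> = \<sigma> * x $ r" using ev by (simp add: matrix_vector_mult_def vec_eq_iff)
      finally show ?thesis using \<sigma> by (simp add: zero_less_mult_iff)
    qed
    show "x $ r > 0" if "(r, s) \<in> {(r, s). r \<noteq> s \<and> A $ r $ s > 0}" for r using that step s by blast
    show "x $ r > 0" if "(r, t) \<in> {(r, s). r \<noteq> s \<and> A $ r $ s > 0}" "x $ t > 0" for r t
      using that step by blast
  qed
  have evA: "A *v x = (\<sigma> - c) *\<^sub>R x" using ev by (simp add: M_mult algebra_simps)
  have "max_real_eigenvalue A = \<sigma> - c"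
    unfolding max_real_eigenvalue_def
  proof (rule Max_eqI[OF finite_eigenvalues])
    show "\<sigma> - c \<in> {l. \<exists>v. v \<noteq> 0 \<and> A *v v = l *\<^sub>R v}" using evA s by (auto intro!: exI[of _ x])
    fix l assume "l \<in> {l. \<exists>v. v \<noteq> 0 \<and> A *v v = l *\<^sub>R v}"
    then obtain w where w: "w \<noteq> 0" "A *v w = l *\<^sub>R w" by blast
    \<comment> \<open>An eigenvector may be negated; one of the two signs has a positive component,
      as the comparison requires.\<close>
    obtain w' where w': "\<exists>r. w' $ r > 0" "A *v w' = l *\<^sub>R w'"
    proof (cases "\<exists>r. w $ r > 0")
      case True
      then show thesis using that w by blast
    next
      case False
      moreover obtain r where "w $ r \<noteq> 0" using w by (auto simp: vec_eq_iff)
      ultimately have "(- w) $ r > 0" by (metis linorder_neqE_linordered_idom neg_0_less_iff_less vector_uminus_component)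
      moreover have "A *v (- w) = l *\<^sub>R (- w)"
        using w matrix_vector_mult_scaleR[of A "-1" w] by simp
      ultimately show thesis using that by blast
    qed
    then obtain r0 where "w' $ r0 > 0" by blast
    from max_ratio_row[OF off pos this]
    obtain r where r: "w' $ r > 0" "(A *v w') $ r \<le> w' $ r / x $ r * (A *v x) $ r"
      by blast
    then have "l * w' $ r \<le> (\<sigma> - c) * w' $ r" using pos[of r] by (simp add: w' evA)
    then show "l \<le> \<sigma> - c" using r(1) by simp
  qed
  with evA pos that show thesis by metis
qed

section \<open>The uniformized network\<close>

lemma axis_component: "axis r n $ s = (if s = r then n else 0)"
  by (simp add: axis_def)

lemma finite_vec_le: "finite {i :: nat ^ 'd::finite. \<forall>t. i $ t \<le> b t}"
proof (rule finite_subset)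
  show "{i :: nat ^ 'd. \<forall>t. i $ t \<le> b t} \<subseteq> vec_lambda ` (PiE UNIV (\<lambda>t. {..b t}))"
  proof
    fix i :: "nat ^ 'd" assume "i \<in> {i. \<forall>t. i $ t \<le> b t}"
    then have "vec_nth i \<in> PiE UNIV (\<lambda>t. {..b t})" by auto
    then show "i \<in> vec_lambda ` (PiE UNIV (\<lambda>t. {..b t}))" by (metis image_eqI vec_nth_inverse)
  qed
  show "finite (vec_lambda ` (PiE UNIV (\<lambda>t. {..b t})) :: (nat ^ 'd) set)"
    by (intro finite_imageI finite_PiE) auto
qed

lemma sum_UNIV_option:
  fixes f :: "'d::finite option \<Rightarrow> 'b::comm_monoid_add"
  shows "(\<Sum>a\<in>UNIV. f a) = f None + (\<Sum>s\<in>UNIV. f (Some s))"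
  by (simp add: UNIV_option_conv sum.reindex)

locale network =
  fixes lam :: "'d::finite \<Rightarrow> nat \<Rightarrow> real"
    and mu :: "'d \<Rightarrow> real"
    and gam :: "'d \<Rightarrow> 'd option \<Rightarrow> real"
  assumes lam_nonneg: "\<And>r k. k \<ge> 1 \<Longrightarrow> lam r k \<ge> 0"
    and lam_summable: "\<And>r. summable (\<lambda>k. lam r (Suc k))"
    and lam_total_pos: "\<And>r. lam_total lam r > 0"
    and mu_pos: "\<And>r. mu r > 0"
    and gam_nonneg: "\<And>r a. gam r a \<ge> 0"
    and gam_sum: "\<And>r. (\<Sum>a\<in>UNIV. gam r a) = 1"
    and gam_diag: "\<And>r. gam r (Some r) = 0"
    and gam_exit: "\<exists>r. gam r None > 0"
    and gam_irreducible: "irreducible_nonneg_matrix (\<lambda>r s. gam r (Some s))"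
begin

text \<open>The added 1 puts \<open>rate\<close> strictly above every total jump rate. All holding
  probabilities are then positive, which keeps \<open>l\<close> below \<open>rate\<close> even at
  the decay parameter and gives the iteration \<open>F\<close> a positive diagonal
  coefficient.\<close>

definition rate :: real where
  "rate = (\<Sum>r\<in>UNIV. lam_total lam r + mu r) + 1"

definition Kr :: "nat ^ 'd \<Rightarrow> nat ^ 'd \<Rightarrow> real" where
  "Kr i j = (if i = j then 1 else 0) + gen lam mu gam i j / rate"

definition K :: "nat ^ 'd \<Rightarrow> nat ^ 'd \<Rightarrow> ennreal" where
  "K i j = ennreal (Kr i j)"

abbreviation speed :: "'d \<Rightarrow> real" where
  "speed r \<equiv> lam_total lam r + mu r"

abbreviation \<beta> :: "'d \<Rightarrow> real ^ 'd \<Rightarrow> real" where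
  "\<beta> \<equiv> B lam mu gam"

abbreviation routed :: "'d \<Rightarrow> real ^ 'd \<Rightarrow> real" where
  "routed r v \<equiv> (\<Sum>s\<in>UNIV. gam r (Some s) * v $ s)"

abbreviation drift :: "real ^ 'd \<Rightarrow> nat ^ 'd \<Rightarrow> real" where
  "drift y i \<equiv> (\<Sum>r | i $ r > 0. \<beta> r y * monomial y (i - axis r 1))"

definition jump :: "'d \<Rightarrow> nat ^ 'd \<Rightarrow> nat ^ 'd \<Rightarrow> real" where
  "jump r i j =
     (if j $ r > i $ r \<and> j = i + axis r (j $ r - i $ r) then lam r (j $ r - i $ r) else 0)
     + (if j = i - axis r 1 then mu r * gam r None else 0)
     + (\<Sum>s | s \<noteq> r. if j = i - axis r 1 + axis s 1 then mu r * gam r (Some s) else 0)"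

lemma gam_split: "gam r None + (\<Sum>s\<in>UNIV. gam r (Some s)) = 1"
  using gam_sum[of r] by (simp add: sum_UNIV_option)

lemma jump_nonneg: "jump r i j \<ge> 0"
  unfolding jump_def using lam_nonneg mu_pos[THEN less_imp_le] gam_nonneg
  by (intro add_nonneg_nonneg sum_nonneg) auto

lemma shift_ne:
  fixes i :: "nat ^ 'd"
  assumes "i $ r > 0"
  shows "i - axis r 1 \<noteq> i" "s \<noteq> r \<Longrightarrow> i - axis r 1 + axis s 1 \<noteq> i"
  using assms by (auto simp: vec_eq_iff axis_component intro!: exI[of _ r])

lemma jump_self: "i $ r > 0 \<Longrightarrow> jump r i i = 0"
  unfolding jump_def using shift_ne[of i r] by (auto intro!: sum.neutral) metis

lemma rate_gt: "(\<Sum>r\<in>A. speed r) < rate"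
proof -
  have "0 \<le> speed r" for r using lam_total_pos[of r] mu_pos[of r] by linarith
  then have "(\<Sum>r\<in>A. speed r) \<le> (\<Sum>r\<in>UNIV. speed r)" by (intro sum_mono2) auto
  then show ?thesis by (simp add: rate_def)
qed

lemma rate_pos: "rate > 0"
  using rate_gt[of "{}"] by simp

lemma rate_gt_single: "speed r < rate"
  using rate_gt[of "{r}"] by simp

lemma Kr_eq: "Kr i j = (if i = j then 1 - (\<Sum>r | i $ r > 0. speed r) / rate else 0)
    + (\<Sum>r | i $ r > 0. jump r i j) / rate"
proof -
  have "gen lam mu gam i j = (if j = i then - (\<Sum>r | i $ r > 0. speed r)
      else (\<Sum>r | i $ r > 0. jump r i j))"
    by (simp only: gen_def jump_def)
  then show ?thesis by (auto simp: Kr_def jump_self)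
qed

lemma Kr_nonneg: "Kr i j \<ge> 0"
  unfolding Kr_eq using rate_gt[of "{r. i $ r > 0}"] rate_pos jump_nonneg
  by (auto intro!: add_nonneg_nonneg divide_nonneg_pos sum_nonneg)

lemma Kr_self_pos: "Kr i i > 0"
  unfolding Kr_eq using rate_gt[of "{r. i $ r > 0}"] rate_pos jump_nonneg
  by (auto intro!: add_pos_nonneg divide_nonneg_pos sum_nonneg)

lemma Kr_ge_jump: "i $ r > 0 \<Longrightarrow> jump r i j / rate \<le> Kr i j"
proof -
  assume "i $ r > 0"
  then have "jump r i j \<le> (\<Sum>r | i $ r > 0. jump r i j)" by (intro member_le_sum jump_nonneg) auto
  moreover have "(if i = j then 1 - (\<Sum>r | i $ r > 0. speed r) / rate else 0) \<ge> 0"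
    using rate_gt[of "{r. i $ r > 0}"] rate_pos by auto
  ultimately show ?thesis unfolding Kr_eq using rate_pos by (smt (verit) divide_right_mono)
qed

lemma nn_integral_jump:
  "(\<Sum>\<^sup>+ j. ennreal (jump r i j) * g j) = (\<Sum>k. ennreal (lam r (Suc k)) * g (i + axis r (Suc k)))
      + ennreal (mu r * gam r None) * g (i - axis r 1)
      + (\<Sum>s | s \<noteq> r. ennreal (mu r * gam r (Some s)) * g (i - axis r 1 + axis s 1))"
proof -
  define up where "up j = (if j $ r > i $ r \<and> j = i + axis r (j $ r - i $ r) then lam r (j $ r - i $ r) else 0)"
    for j :: "nat ^ 'd"
  have up_nn: "up j \<ge> 0" for j using lam_nonneg by (auto simp: up_def)
  have mg: "mu r * gam r a \<ge> 0" for a using mu_pos[of r] gam_nonneg[of r a] by simp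
  have split: "ennreal (jump r i j) * g j = ennreal (up j) * g j
      + ennreal (mu r * gam r None) * g j * indicator {i - axis r 1} j
      + (\<Sum>s | s \<noteq> r. ennreal (mu r * gam r (Some s)) * g j * indicator {i - axis r 1 + axis s 1} j)" for j
  proof -
    have "jump r i j = up j + mu r * gam r None * indicator {i - axis r 1} j
      + (\<Sum>s | s \<noteq> r. mu r * gam r (Some s) * indicator {i - axis r 1 + axis s 1} j)"
      unfolding jump_def up_def by (intro arg_cong2[where f = "(+)"] sum.cong) (auto simp: indicator_def)
    moreover have "ennreal \<dots> = ennreal (up j) + ennreal (mu r * gam r None * indicator {i - axis r 1} j)
      + ennreal (\<Sum>s | s \<noteq> r. mu r * gam r (Some s) * indicator {i - axis r 1 + axis s 1} j)"
    proof -
      have "0 \<le> mu r * gam r None * indicator {i - axis r 1} j"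
        using mg by (simp add: indicator_def)
      moreover have "0 \<le> (\<Sum>s | s \<noteq> r. mu r * gam r (Some s) * indicator {i - axis r 1 + axis s 1} j)"
        using mg by (intro sum_nonneg) (simp add: indicator_def)
      ultimately show ?thesis using up_nn[of j] by (simp only: ennreal_plus add_nonneg_nonneg)
    qed
    moreover have "\<dots> = ennreal (up j) + ennreal (mu r * gam r None) * indicator {i - axis r 1} j
      + (\<Sum>s | s \<noteq> r. ennreal (mu r * gam r (Some s)) * indicator {i - axis r 1 + axis s 1} j)"
    proof -
      have "ennreal (c * indicator A j) = ennreal c * indicator A j" for c A
        by (auto simp: indicator_def)
      then show ?thesis using mg by (simp add: mult_nonneg_nonneg flip: sum_ennreal)
    qed
    ultimately have "ennreal (jump r i j) = ennreal (up j)
      + ennreal (mu r * gam r None) * indicator {i - axis r 1} j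
      + (\<Sum>s | s \<noteq> r. ennreal (mu r * gam r (Some s)) * indicator {i - axis r 1 + axis s 1} j)"
      by simp
    then show ?thesis
      by (simp only: distrib_right sum_distrib_right mult.assoc mult.commute[of "indicator _ j" "g j"])
  qed
  \<comment> \<open>Upward jumps have size at least 1, hence the \<open>Suc\<close>. All states with
    \<open>up j\<close> nonzero lie in the range of the injection \<open>h\<close>, which turns the
    sum over states into a series over jump sizes.\<close>
  define h where "h k = i + axis r (Suc k)" for k
  have "inj h" by (rule injI) (auto simp: h_def vec_eq_iff axis_component split: if_splits)
  have up_h: "up (h k) = lam r (Suc k)" for k by (simp add: up_def h_def axis_component)
  have up_0: "up j = 0" if "j \<notin> range h" for j
  proof (rule ccontr)
    assume "up j \<noteq> 0"
    then have "j $ r > i $ r" "j = i + axis r (j $ r - i $ r)" by (auto simp: up_def split: if_splits)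
    moreover from this have "Suc (j $ r - i $ r - 1) = j $ r - i $ r" by simp
    ultimately have "j = h (j $ r - i $ r - 1)" by (simp only: h_def)
    with that show False by blast
  qed
  have "(\<Sum>\<^sup>+ j. ennreal (up j) * g j) = (\<integral>\<^sup>+ j. ennreal (up j) * g j \<partial>count_space (range h))"
    by (rule nn_integral_count_space_eq) (use up_0 in auto)
  also have "\<dots> = (\<Sum>\<^sup>+ k. ennreal (up (h k)) * g (h k))"
    using nn_integral_bij_count_space[of h UNIV "range h" "\<lambda>j. ennreal (up j) * g j"] \<open>inj h\<close>
    by (simp add: bij_betw_def)
  also have "\<dots> = (\<Sum>k. ennreal (lam r (Suc k)) * g (h k))"
    by (simp add: nn_integral_count_space_nat up_h)
  finally have up_int: "(\<Sum>\<^sup>+ j. ennreal (up j) * g j) = (\<Sum>k. ennreal (lam r (Suc k)) * g (h k))" .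
  have "(\<Sum>\<^sup>+ j. (\<Sum>s | s \<noteq> r. ennreal (mu r * gam r (Some s)) * g j * indicator {i - axis r 1 + axis s 1} j))
    = (\<Sum>s | s \<noteq> r. ennreal (mu r * gam r (Some s)) * g (i - axis r 1 + axis s 1))"
    by (subst nn_integral_sum) simp_all
  moreover have "(\<Sum>\<^sup>+ j. ennreal (mu r * gam r None) * g j * indicator {i - axis r 1} j)
    = ennreal (mu r * gam r None) * g (i - axis r 1)" by simp
  ultimately show ?thesis
    unfolding split by (subst nn_integral_add, simp, simp)+ (simp only: up_int h_def)
qed

lemma kop_K:
  "kop K g i = ennreal (1 - (\<Sum>r | i $ r > 0. speed r) / rate) * g i
    + ennreal (1 / rate) * (\<Sum>r | i $ r > 0. (\<Sum>\<^sup>+ j. ennreal (jump r i j) * g j))"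
proof -
  let ?c = "1 - (\<Sum>r | i $ r > 0. speed r) / rate"
  have c: "?c \<ge> 0" using rate_gt[of "{r. i $ r > 0}"] rate_pos by simp
  have "K i j * g j = ennreal ?c * g j * indicator {i} j
      + ennreal (1 / rate) * (\<Sum>r | i $ r > 0. ennreal (jump r i j) * g j)" for j
  proof -
    have "K i j = ennreal ?c * indicator {i} j + ennreal (1 / rate) * (\<Sum>r | i $ r > 0. ennreal (jump r i j))"
    proof -
      have "K i j = ennreal ((if i = j then ?c else 0) + 1 / rate * (\<Sum>r | i $ r > 0. jump r i j))"
        by (simp add: K_def Kr_eq)
      also have "\<dots> = ennreal (if i = j then ?c else 0) + ennreal (1 / rate * (\<Sum>r | i $ r > 0. jump r i j))"
        using c rate_pos jump_nonneg by (intro ennreal_plus) (auto intro!: divide_nonneg_pos sum_nonneg)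
      also have "ennreal (1 / rate * (\<Sum>r | i $ r > 0. jump r i j))
        = ennreal (1 / rate) * (\<Sum>r | i $ r > 0. ennreal (jump r i j))"
        using rate_pos jump_nonneg by (subst ennreal_mult) (auto intro!: sum_nonneg simp: sum_ennreal)
      also have "ennreal (if i = j then ?c else 0) = ennreal ?c * indicator {i} j"
        by (auto simp: indicator_def)
      finally show ?thesis .
    qed
    then show ?thesis
      by (simp only: distrib_right sum_distrib_right mult.assoc mult.commute[of "indicator _ j" "g j"])
  qed
  then show ?thesis by (simp add: kop_def nn_integral_add nn_integral_cmult nn_integral_sum)
qed

lemma total_rate_split:
  "(\<Sum>r | i $ r > 0. speed r) / rate \<le> 1"
  using rate_gt[of "{r. i $ r > 0}"] rate_pos by simp

section \<open>Action of the generator on monomials\<close>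

lemma monomial_nonneg: "(\<And>s. 0 \<le> y $ s) \<Longrightarrow> 0 \<le> monomial y i"
  unfolding monomial_def by (intro prod_nonneg) auto

lemma monomial_le_1: "(\<And>s. 0 \<le> y $ s) \<Longrightarrow> (\<And>s. y $ s \<le> 1) \<Longrightarrow> monomial y i \<le> 1"
  unfolding monomial_def by (intro prod_le_1) (auto intro: power_le_one)

lemma monomial_add: "monomial y (i + j) = monomial y i * monomial y j"
  by (simp add: monomial_def power_add prod.distrib)

lemma monomial_axis: "monomial y (axis r n) = y $ r ^ n"
proof -
  have "monomial y (axis r n) = (\<Prod>s\<in>UNIV. if s = r then y $ r ^ n else 1)"
    unfolding monomial_def by (intro prod.cong) (auto simp: axis_component)
  then show ?thesis by simp
qed

lemma monomial_zero: "monomial y 0 = 1"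
  by (simp add: monomial_def)

lemma minus_axis_add: "(i :: nat ^ 'd) $ r > 0 \<Longrightarrow> i - axis r 1 + axis r 1 = i"
  by (auto simp: vec_eq_iff axis_component)

lemma monomial_split:
  assumes "(i :: nat ^ 'd) $ r > 0"
  shows "monomial y i = y $ r * monomial y (i - axis r 1)"
proof -
  have "monomial y i = monomial y (i - axis r 1 + axis r 1)" by (simp only: minus_axis_add[OF assms])
  then show ?thesis by (simp only: monomial_add monomial_axis power_one_right mult.commute)
qed

lemma lam_power_summable:
  assumes "0 \<le> x" "x \<le> 1"
  shows "summable (\<lambda>k. lam r (Suc k) * x ^ Suc k)"
proof (rule summable_comparison_test'[OF lam_summable[of r]])
  show "norm (lam r (Suc k) * x ^ Suc k) \<le> lam r (Suc k)" for k
    using lam_nonneg[of "Suc k" r] assms by (simp del: power_Suc add: abs_mult mult_left_le power_le_one)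
qed

text \<open>After division by \<open>y^(i - e_r)\<close> the jump weights become the nonnegative
  coefficients of \<open>B_r(y) + speed r * y_r\<close>. The second claim is stated because
  \<open>B_r(y)\<close> may be negative: it ensures that \<open>ennreal\<close> does not truncate
  the right side.\<close>

lemma nn_integral_jump_monomial:
  assumes y: "\<And>s. 0 \<le> y $ s" "\<And>s. y $ s \<le> 1" and i: "i $ r > 0"
  shows "(\<Sum>\<^sup>+ j. ennreal (jump r i j) * ennreal (monomial y j))
    = ennreal (\<beta> r y * monomial y (i - axis r 1) + speed r * monomial y i)"
      (is "?l = _")
    and "0 \<le> \<beta> r y * monomial y (i - axis r 1) + speed r * monomial y i"
proof -
  define x where "x = y $ r"
  define m where "m = monomial y (i - axis r 1)"
  have x: "0 \<le> x" "x \<le> 1" using y by (auto simp: x_def)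
  have m: "m \<ge> 0" unfolding m_def by (rule monomial_nonneg[OF y(1)])
  have mi: "monomial y i = x * m"
    unfolding x_def m_def by (rule monomial_split[OF i])
  have up: "monomial y (i + axis r (Suc k)) = x ^ Suc k * (x * m)" for k
    by (simp add: monomial_add monomial_axis mi flip: x_def)
  have mg: "mu r * gam r a \<ge> 0" for a using mu_pos[of r] gam_nonneg[of r a] by simp
  have "(\<Sum>k. ennreal (lam r (Suc k)) * ennreal (monomial y (i + axis r (Suc k))))
    = (\<Sum>k. ennreal (lam r (Suc k) * x ^ Suc k * (x * m)))"
    using lam_nonneg[of "Suc _" r] x m
    by (intro suminf_cong) (simp add: up mult.assoc del: power_Suc flip: ennreal_mult)
  also have "\<dots> = ennreal (\<Sum>k. lam r (Suc k) * x ^ Suc k * (x * m))"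
    using lam_nonneg[of "Suc _" r] x m lam_power_summable[OF x, of r]
    by (intro suminf_ennreal2) (auto intro!: summable_mult2 simp del: power_Suc)
  also have "(\<Sum>k. lam r (Suc k) * x ^ Suc k * (x * m)) = (\<Sum>k. lam r (Suc k) * x ^ Suc k) * (x * m)"
    using lam_power_summable[OF x, of r] by (rule suminf_mult2[symmetric])
  finally have 1: "(\<Sum>k. ennreal (lam r (Suc k)) * ennreal (monomial y (i + axis r (Suc k))))
    = ennreal ((\<Sum>k. lam r (Suc k) * x ^ Suc k) * (x * m))" .
  have 2: "(\<Sum>s | s \<noteq> r. ennreal (mu r * gam r (Some s)) * ennreal (monomial y (i - axis r 1 + axis s 1)))
    = ennreal (mu r * routed r y * m)"
  proof -
    have "(\<Sum>s | s \<noteq> r. ennreal (mu r * gam r (Some s)) * ennreal (monomial y (i - axis r 1 + axis s 1)))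
      = (\<Sum>s | s \<noteq> r. ennreal (mu r * gam r (Some s) * (y $ s * m)))"
      unfolding monomial_add monomial_axis m_def[symmetric] using mg y m
      by (intro sum.cong refl) (simp add: mult.commute[of m] flip: ennreal_mult)
    also have "\<dots> = ennreal (\<Sum>s | s \<noteq> r. mu r * gam r (Some s) * (y $ s * m))"
      using mg y m by (intro sum_ennreal) auto
    also have "(\<Sum>s | s \<noteq> r. mu r * gam r (Some s) * (y $ s * m))
        = (\<Sum>s\<in>UNIV. mu r * gam r (Some s) * (y $ s * m))"
      by (rule sum.mono_neutral_left) (auto simp: gam_diag)
    finally show ?thesis by (simp add: sum_distrib_left sum_distrib_right mult_ac)
  qed
  have nn: "(\<Sum>k. lam r (Suc k) * x ^ Suc k) \<ge> 0" "routed r y \<ge> 0"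
    using lam_nonneg[of "Suc _" r] x y gam_nonneg lam_power_summable[OF x, of r]
    by (auto intro!: suminf_nonneg sum_nonneg)
  have "?l = ennreal ((\<Sum>k. lam r (Suc k) * x ^ Suc k) * (x * m)) + ennreal (mu r * gam r None * m)
    + ennreal (mu r * routed r y * m)"
    unfolding nn_integral_jump 1 2 using mg m by (simp add: m_def flip: ennreal_mult)
  also have "\<dots> = ennreal ((\<Sum>k. lam r (Suc k) * x ^ Suc k) * (x * m) + mu r * gam r None * m
    + mu r * routed r y * m)"
    using nn mg m x mu_pos[of r] gam_nonneg[of r None] by (simp flip: ennreal_plus)
  finally have l: "?l = ennreal ((\<Sum>k. lam r (Suc k) * x ^ Suc k) * (x * m) + mu r * gam r None * m
    + mu r * routed r y * m)" (is "_ = ennreal ?X") .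
  have X: "?X = \<beta> r y * monomial y (i - axis r 1) + speed r * monomial y i"
    unfolding B_def x_def[symmetric] m_def[symmetric] mi by (simp add: algebra_simps)
  show "?l = ennreal (\<beta> r y * monomial y (i - axis r 1) + speed r * monomial y i)"
    unfolding l X ..
  have "?X \<ge> 0" using nn mg m x mu_pos[of r] gam_nonneg[of r None] by (intro add_nonneg_nonneg mult_nonneg_nonneg) auto
  then show "0 \<le> \<beta> r y * monomial y (i - axis r 1) + speed r * monomial y i"
    unfolding X .
qed

text \<open>\<open>drift y\<close> is the generator applied to the monomial, so
  \<open>B(y) \<ge> 0\<close> makes \<open>y^i\<close> a submartingale. The second claim again
  excludes truncation, for arguments at which some \<open>B_r\<close> is negative.\<close>

lemma kop_K_monomial:
  assumes y: "\<And>s. 0 \<le> y $ s" "\<And>s. y $ s \<le> 1"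
  shows "kop K (\<lambda>j. ennreal (monomial y j)) i = ennreal (monomial y i + drift y i / rate)"
    and "0 \<le> monomial y i + drift y i / rate"
proof -
  let ?c = "(\<Sum>r | i $ r > 0. speed r) / rate"
  let ?J = "\<lambda>r. \<beta> r y * monomial y (i - axis r 1) + speed r * monomial y i"
  have J: "?J r \<ge> 0" if "i $ r > 0" for r by (rule nn_integral_jump_monomial(2)[OF y that])
  have S: "(\<Sum>r | i $ r > 0. ?J r) \<ge> 0" using J by (intro sum_nonneg) auto
  have m: "monomial y i \<ge> 0" by (rule monomial_nonneg[OF y(1)])
  have c: "1 - ?c \<ge> 0" using total_rate_split[of i] by simp
  have e: "(1 - ?c) * monomial y i + 1 / rate * (\<Sum>r | i $ r > 0. ?J r)
    = monomial y i + drift y i / rate"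
  proof -
    have "(\<Sum>r | i $ r > 0. ?J r) = drift y i + (\<Sum>r | i $ r > 0. speed r) * monomial y i"
      by (subst sum.distrib) (simp only: sum_distrib_right)
    then show ?thesis using rate_pos by (simp only:) (simp add: field_simps)
  qed
  have "kop K (\<lambda>j. ennreal (monomial y j)) i
    = ennreal (1 - ?c) * ennreal (monomial y i) + ennreal (1 / rate) * (\<Sum>r | i $ r > 0. ennreal (?J r))"
    unfolding kop_K by (intro arg_cong2[where f = "(+)"] arg_cong2[where f = "(*)"] sum.cong refl)
      (auto simp: nn_integral_jump_monomial(1)[OF y])
  also have "\<dots> = ennreal ((1 - ?c) * monomial y i + 1 / rate * (\<Sum>r | i $ r > 0. ?J r))"
  proof -
    have "(\<Sum>r | i $ r > 0. ennreal (?J r)) = ennreal (\<Sum>r | i $ r > 0. ?J r)"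
      using J by (intro sum_ennreal) auto
    then show ?thesis
      using c m S rate_pos by (simp only: ennreal_mult ennreal_plus mult_nonneg_nonneg zero_le_divide_1_iff less_imp_le)
  qed
  finally show "kop K (\<lambda>j. ennreal (monomial y j)) i = ennreal (monomial y i + drift y i / rate)"
    unfolding e .
  have "0 \<le> (1 - ?c) * monomial y i + 1 / rate * (\<Sum>r | i $ r > 0. ?J r)"
    using c m S rate_pos by (intro add_nonneg_nonneg mult_nonneg_nonneg) auto
  then show "0 \<le> monomial y i + drift y i / rate"
    unfolding e .
qed

lemma B_1: "\<beta> r 1 = 0"
  using gam_split[of r] by (simp add: B_def lam_total_def)

text \<open>Conservativity is the monomial identity at \<open>y = 1\<close>, where \<open>B\<close>
  vanishes.\<close>

lemma K_row_sum: "(\<Sum>\<^sup>+ j. K i j) = 1"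
  using kop_K_monomial(1)[of 1 i] by (simp add: kop_def B_1 monomial_def)

end

section \<open>Irreducibility off the empty state, and finite columns\<close>

context network
begin

definition reach :: "nat ^ 'd \<Rightarrow> nat ^ 'd \<Rightarrow> bool" where
  "reach i j \<longleftrightarrow> (\<exists>n. kpow K n i j > 0)"

lemma reach_refl: "reach i i"
  unfolding reach_def by (intro exI[of _ 0]) (simp add: kpow_0)

lemma reach_trans: "reach i j \<Longrightarrow> reach j k \<Longrightarrow> reach i k"
  unfolding reach_def using kpow_mult_le[of K _ i j _ k]
  by (metis ennreal_zero_less_mult_iff order_less_le_trans)

lemma reach_jump: "i $ r > 0 \<Longrightarrow> jump r i j > 0 \<Longrightarrow> reach i j"
  unfolding reach_def using Kr_ge_jump[of i r j] rate_pos by (intro exI[of _ "Suc 0"])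
     (auto simp: kpow_1 K_def zero_less_divide_iff intro: less_le_trans[of 0 "jump r i j / rate"])

lemma jump_parts_nonneg:
  "0 \<le> (if j $ r > i $ r \<and> j = i + axis r (j $ r - i $ r) then lam r (j $ r - i $ r) else 0)"
  "0 \<le> (if j = i - axis r 1 then mu r * gam r None else 0)"
  "0 \<le> (if j = i - axis r 1 + axis s 1 then mu r * gam r (Some s) else 0)"
  using lam_nonneg mu_pos[of r] gam_nonneg by auto

lemma jump_up:
  assumes "lam r (Suc k) > 0"
  shows "jump r i (i + axis r (Suc k)) > 0"
  unfolding jump_def
proof (intro add_pos_nonneg[OF add_pos_nonneg] sum_nonneg jump_parts_nonneg)
  show "0 < (if i $ r < (i + axis r (Suc k)) $ r
      \<and> i + axis r (Suc k) = i + axis r ((i + axis r (Suc k)) $ r - i $ r)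
    then lam r ((i + axis r (Suc k)) $ r - i $ r) else 0)" using assms by (simp add: axis_component)
qed

lemma jump_leave:
  assumes "gam r None > 0"
  shows "jump r i (i - axis r 1) > 0"
  unfolding jump_def
proof (intro add_pos_nonneg[OF add_nonneg_pos] sum_nonneg jump_parts_nonneg)
  show "0 < (if i - axis r 1 = i - axis r 1 then mu r * gam r None else 0)"
    using assms mu_pos[of r] by simp
qed

lemma jump_move:
  assumes "s \<noteq> r" "gam r (Some s) > 0"
  shows "jump r i (i - axis r 1 + axis s 1) > 0"
  unfolding jump_def
proof (intro add_nonneg_pos add_nonneg_nonneg jump_parts_nonneg)
  let ?f = "\<lambda>t. if i - axis r 1 + axis s 1 = i - axis r 1 + axis t 1 then mu r * gam r (Some t) else 0"
  have "0 < ?f s" using assms mu_pos[of r] by simp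
  also have "?f s \<le> (\<Sum>t | t \<noteq> r. ?f t)"
    using assms jump_parts_nonneg(3)[of "i - axis r 1 + axis s 1" i r] by (intro member_le_sum) auto
  finally show "0 < (\<Sum>t | t \<noteq> r. ?f t)" .
qed

text \<open>A single individual follows a path of the routing graph from \<open>r\<close> to
  \<open>s\<close>, while all others stay where they are.\<close>

lemma reach_move:
  assumes "i $ r > 0"
  shows "reach i (i - axis r 1 + axis s 1)"
proof -
  have "(r, s) \<in> {(r, s). gam r (Some s) > 0}\<^sup>+"
    using gam_irreducible by (simp add: irreducible_nonneg_matrix_def)
  then have "\<forall>i. i $ r > 0 \<longrightarrow> reach i (i - axis r 1 + axis s 1)"
  proof (induction rule: converse_trancl_induct)
    case (base r)
    then have "gam r (Some s) > 0" "s \<noteq> r" using gam_diag[of r] by auto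
    then show ?case using reach_jump jump_move by blast
  next
    case (step r t)
    then have "gam r (Some t) > 0" "t \<noteq> r" using gam_diag[of r] by auto
    show ?case
    proof (intro allI impI)
      fix i :: "nat ^ 'd" assume i: "i $ r > 0"
      let ?i = "i - axis r 1 + axis t 1"
      have "reach i ?i" using reach_jump[OF i jump_move] \<open>t \<noteq> r\<close> \<open>gam r (Some t) > 0\<close> by blast
      moreover have "?i $ t > 0" by (simp add: axis_component)
      then have "reach ?i (?i - axis t 1 + axis s 1)" using step.IH by blast
      moreover have "?i - axis t 1 = i - axis r 1" by (simp add: vec_eq_iff axis_component)
      ultimately show "reach i (i - axis r 1 + axis s 1)" using reach_trans by metis
    qed
  qed
  with assms show ?thesis by blast
qed

text \<open>Departure may be impossible from \<open>r\<close> itself; the individual is first routed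
  to a coordinate with a positive exit probability.\<close>

lemma reach_leave:
  assumes "i $ r > 0"
  shows "reach i (i - axis r 1)"
proof -
  obtain s where s: "gam s None > 0" using gam_exit by blast
  let ?i = "i - axis r 1 + axis s 1"
  have "?i $ s > 0" by (simp add: axis_component)
  then have "reach ?i (?i - axis s 1)" using reach_jump jump_leave s by blast
  moreover have "?i - axis s 1 = i - axis r 1" by (simp add: vec_eq_iff axis_component)
  ultimately show ?thesis using reach_trans[OF reach_move[OF assms, of s]] by metis
qed

definition total :: "nat ^ 'd \<Rightarrow> nat" where "total i = (\<Sum>r\<in>UNIV. i $ r)"

lemma total_add: "total (i + j) = total i + total j"
  by (simp add: total_def sum.distrib)

lemma total_axis: "total (axis r n) = n"
  by (simp add: total_def axis_component)

lemma total_eq_0: "total i = 0 \<longleftrightarrow> i = 0"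
  by (auto simp: total_def vec_eq_iff)

lemma ex_pos_component: "(i :: nat ^ 'd) \<noteq> 0 \<Longrightarrow> \<exists>r. i $ r > 0"
  by (auto simp: vec_eq_iff)

lemma reach_large:
  assumes "i \<noteq> 0"
  shows "\<exists>i'. reach i i' \<and> i' \<noteq> 0 \<and> total i' \<ge> N"
proof (induction N)
  case 0
  show ?case using reach_refl assms by blast
next
  case (Suc N)
  then obtain i' where i': "reach i i'" "i' \<noteq> 0" "total i' \<ge> N" by blast
  obtain r where r: "i' $ r > 0" using ex_pos_component i'(2) by blast
  obtain k where k: "lam r (Suc k) > 0"
  proof -
    have "\<exists>k. lam r (Suc k) \<noteq> 0"
    proof (rule ccontr)
      assume "\<not> ?thesis"
      then have "lam_total lam r = 0" by (simp add: lam_total_def)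
      with lam_total_pos[of r] show False by simp
    qed
    then show thesis using that lam_nonneg[of "Suc _" r] by (metis le_add1 less_eq_real_def plus_1_eq_Suc)
  qed
  have "reach i (i' + axis r (Suc k))" using reach_trans[OF i'(1) reach_jump[OF r jump_up[OF k]]] .
  moreover have "total (i' + axis r (Suc k)) \<ge> Suc N"
    using i'(3) by (simp add: total_add total_axis)
  moreover from this have "i' + axis r (Suc k) \<noteq> 0" using total_eq_0 by force
  ultimately show ?case by blast
qed

text \<open>Truncated subtraction makes the induction measure the total surplus of \<open>i\<close>
  over \<open>j\<close>. An individual from a surplus coordinate is moved to a deficient one if
  there is any, and removed from the system otherwise.\<close>

lemma reach_smaller:
  assumes "total i \<ge> total j"
  shows "reach i j"
  using assms
proof (induction "\<Sum>r\<in>UNIV. i $ r - j $ r" arbitrary: i rule: less_induct)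
  case less
  show ?case
  proof (cases "\<forall>r. i $ r \<le> j $ r")
    case True
    then have "i $ r = j $ r" for r
    proof (rule_tac ccontr)
      assume "i $ r \<noteq> j $ r"
      then have "(\<Sum>r\<in>UNIV. i $ r) < (\<Sum>r\<in>UNIV. j $ r)"
        using True by (intro sum_strict_mono_ex1) (auto intro!: exI[of _ r] simp: le_neq_implies_less)
      with less.prems show False by (simp add: total_def)
    qed
    then have "i = j" by (simp add: vec_eq_iff)
    then show ?thesis using reach_refl by simp
  next
    case False
    then obtain r where r: "i $ r > j $ r" by (auto simp: not_le)
    have decrease: "(\<Sum>t\<in>UNIV. i' $ t - j $ t) < (\<Sum>t\<in>UNIV. i $ t - j $ t)"
      if "\<And>t. i' $ t - j $ t \<le> i $ t - j $ t" "i' $ r - j $ r < i $ r - j $ r" for i'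
      using that by (intro sum_strict_mono_ex1) auto
    have split: "total (i - axis r 1) + 1 = total i"
      using r total_add[of "i - axis r 1" "axis r 1"] minus_axis_add[of i r] total_axis[of r 1]
      by simp
    show ?thesis
    proof (cases "\<exists>s. i $ s < j $ s")
      case True
      then obtain s where s: "i $ s < j $ s" by blast
      have ne: "s \<noteq> r" using r s by auto
      let ?i = "i - axis r 1 + axis s 1"
      have "total ?i = total i" using split by (simp add: total_add total_axis)
      moreover have "(\<Sum>t\<in>UNIV. ?i $ t - j $ t) < (\<Sum>t\<in>UNIV. i $ t - j $ t)"
        using r s ne by (intro decrease) (auto simp: axis_component)
      ultimately have "reach ?i j" using less.hyps[of ?i] less.prems by simp
      then show ?thesis using reach_trans[OF reach_move[of i r s]] r by simp
    next
      case False
      then have ge: "j $ t \<le> i $ t" for t by (simp add: not_less)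
      let ?i = "i - axis r 1"
      have "total j \<le> total ?i"
        unfolding total_def using r ge by (intro sum_mono) (auto simp: axis_component)
      moreover have "(\<Sum>t\<in>UNIV. ?i $ t - j $ t) < (\<Sum>t\<in>UNIV. i $ t - j $ t)"
        using r by (intro decrease) (auto simp: axis_component)
      ultimately have "reach ?i j" using less.hyps[of ?i] by simp
      then show ?thesis using reach_trans[OF reach_leave[of i r]] r by simp
    qed
  qed
qed

text \<open>Upward jumps first make the population at least as large as that of \<open>j\<close>;
  surplus is then moved or removed.\<close>

lemma reach_all: "i \<noteq> 0 \<Longrightarrow> reach i j"
  using reach_large[of i "total j"] reach_smaller reach_trans by blast

text \<open>One jump lowers a coordinate by at most 1, so all predecessors of \<open>j\<close> lie
  in a finite box. This is the source of the finite columns.\<close>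

lemma K_support: "K i j \<noteq> 0 \<Longrightarrow> i $ t \<le> j $ t + 1"
proof (cases "i = j")
  case False
  assume "K i j \<noteq> 0"
  then have "Kr i j \<noteq> 0" by (auto simp: K_def)
  obtain r where "jump r i j \<noteq> 0"
  proof (rule ccontr)
    assume "\<not> thesis"
    then have "jump r i j = 0" for r using that by blast
    with \<open>Kr i j \<noteq> 0\<close> False show False by (simp add: Kr_eq)
  qed
  then have "j = i + axis r (j $ r - i $ r) \<or> j = i - axis r 1 \<or> (\<exists>s. j = i - axis r 1 + axis s 1)"
    unfolding jump_def by (auto split: if_splits elim!: sum.not_neutral_contains_not_neutral)
  then consider "j = i + axis r (j $ r - i $ r)" | "j = i - axis r 1" | s where "j = i - axis r 1 + axis s 1"
    by blast
  then show ?thesis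
  proof cases
    case 1
    have "j $ t = i $ t + axis r (j $ r - i $ r) $ t"
      using arg_cong[OF 1, of "\<lambda>v. v $ t"] by (simp only: vector_add_component)
    then show ?thesis by linarith
  qed (auto simp: axis_component)
qed simp

lemma K_0: "j \<noteq> 0 \<Longrightarrow> K 0 j = 0"
  by (auto simp: K_def Kr_eq)

sublocale absorbing_chain K 0
proof
  show "(\<Sum>\<^sup>+ j. K i j) = 1" for i by (rule K_row_sum)
  show "K 0 j = 0" if "j \<noteq> 0" for j by (rule K_0[OF that])
  show "\<exists>n. kpow K n i j > 0" if "i \<noteq> 0" for i j using reach_all[OF that] by (simp add: reach_def)
  show "finite {i. i \<noteq> 0 \<and> K i j \<noteq> 0}" for j
    by (rule finite_subset[OF _ finite_vec_le[of "\<lambda>t. j $ t + 1"]]) (use K_support in auto)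
  show "infinite (UNIV :: (nat ^ 'd) set)"
  proof (rule notI)
    assume fin: "finite (UNIV :: (nat ^ 'd) set)"
    have inj: "inj (\<lambda>n. axis undefined n :: nat ^ 'd)" by (auto intro!: injI simp: axis_eq_axis)
    have "finite (range (\<lambda>n. axis undefined n :: nat ^ 'd))"
      by (rule finite_subset[OF subset_UNIV fin])
    then have "finite (UNIV :: nat set)" using inj by (rule finite_imageD)
    then show False by simp
  qed
qed

lemma Kr_has_sum: "(Kr i has_sum 1) UNIV"
  using K_row_sum[of i] Kr_nonneg by (subst has_sum_iff_nn_integral) (auto simp: K_def)

lemma enn2real_K: "enn2real (K i j) = Kr i j"
  by (simp add: K_def Kr_nonneg)

end

section \<open>The decay parameter through Green functions\<close>

locale network_process = network lam mu gam
  for lam :: "'d::finite \<Rightarrow> nat \<Rightarrow> real" and mu :: "'d \<Rightarrow> real" and gam :: "'d \<Rightarrow> 'd option \<Rightarrow> real" +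
  fixes P :: "real \<Rightarrow> nat ^ 'd \<Rightarrow> nat ^ 'd \<Rightarrow> real"
  assumes QP: "Q_function (gen lam mu gam) P"
begin

lemma P_uniformization:
  assumes "t \<ge> 0"
  shows "ennreal (P t i j) = (\<Sum>n. ennreal (poisson_weight (rate * t) n) * kpow K n i j)"
proof -
  have "K = (\<lambda>i j. ennreal (Kr i j))" by (simp add: K_def fun_eq_iff)
  moreover have "gen lam mu gam i j = rate * (Kr i j - (if i = j then 1 else 0))" for i j
    using rate_pos by (simp add: Kr_def)
  ultimately show ?thesis
    using uniformization[where K = Kr and i = i and j = j, OF QP rate_pos _ Kr_nonneg Kr_has_sum assms]
    by simp
qed

lemma P_nonneg: "t \<ge> 0 \<Longrightarrow> P t i j \<ge> 0"
  using QP transition_function_bounds(1) by (auto simp: Q_function_def)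

abbreviation laplace :: "nat ^ 'd \<Rightarrow> nat ^ 'd \<Rightarrow> real \<Rightarrow> ennreal" where
  "laplace i j l \<equiv> (\<integral>\<^sup>+t\<in>{0..}. ennreal (exp (l * t) * P t i j) \<partial>lborel)"

text \<open>The restriction to \<open>l < rate\<close> keeps the radius
  \<open>rate / (rate - l)\<close> positive. No rate with a finite Laplace transform is lost by it,
  as \<open>laplace_finite_iff\<close> shows.\<close>

definition green_rates :: "real set" where
  "green_rates = {l. 0 \<le> l \<and> l < rate \<and> (\<forall>i j. i \<noteq> 0 \<longrightarrow> j \<noteq> 0 \<longrightarrow> green K (rate / (rate - l)) i j < \<infinity>)}"

lemma radius_ge_1: "0 \<le> l \<Longrightarrow> l < rate \<Longrightarrow> 1 \<le> rate / (rate - l)"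
  by simp

lemma green_rates_down: "l \<in> green_rates \<Longrightarrow> 0 \<le> k \<Longrightarrow> k \<le> l \<Longrightarrow> k \<in> green_rates"
proof -
  assume l: "l \<in> green_rates" and k: "0 \<le> k" "k \<le> l"
  then have "rate / (rate - k) \<le> rate / (rate - l)"
    by (intro divide_left_mono) (auto simp: green_rates_def)
  then have "green K (rate / (rate - k)) i j \<le> green K (rate / (rate - l)) i j" for i j
    using l k by (intro green_mono) (auto simp: green_rates_def)
  moreover have "green K (rate / (rate - l)) i j < \<infinity>" if "i \<noteq> 0" "j \<noteq> 0" for i j
    using l that by (simp add: green_rates_def)
  ultimately have "green K (rate / (rate - k)) i j < \<infinity>" if "i \<noteq> 0" "j \<noteq> 0" for i j
    using that le_less_trans by blast
  with l k show ?thesis by (simp add: green_rates_def)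
qed

text \<open>Staying at \<open>i\<close> for \<open>n\<close> steps is one of the ways to return, so
  the Green function dominates the geometric series with ratio \<open>R * Kr i i\<close>. Its
  convergence forces this ratio below 1.\<close>

lemma green_rates_bound:
  assumes "l \<in> green_rates" "i \<noteq> 0"
  shows "l \<le> rate * (1 - Kr i i)"
proof -
  have l: "0 \<le> l" "l < rate" using assms by (auto simp: green_rates_def)
  define R where "R = rate / (rate - l)"
  have R: "R \<ge> 1" using radius_ge_1[OF l] by (simp add: R_def)
  have kp: "ennreal (Kr i i ^ n) \<le> kpow K n i i" for n
  proof (induction n)
    case (Suc n)
    have "ennreal (Kr i i ^ Suc n) = K i i * ennreal (Kr i i ^ n)"
      using Kr_nonneg by (simp add: K_def ennreal_mult)
    also have "\<dots> \<le> kpow K (Suc 0) i i * kpow K n i i"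
      unfolding kpow_1 by (intro mult_left_mono Suc) auto
    also have "\<dots> \<le> kpow K (Suc n) i i" using kpow_mult_le[of K "Suc 0" i i n i] by simp
    finally show ?case .
  qed (simp add: kpow_0)
  have fin: "green K R i i < \<infinity>" using assms by (auto simp: green_rates_def R_def)
  have "(\<Sum>n. ennreal ((R * Kr i i) ^ n)) \<le> green K R i i"
    unfolding green_def power_mult_distrib using R Kr_nonneg kp
    by (intro suminf_le) (auto simp: ennreal_mult intro!: mult_left_mono)
  then have "(\<Sum>n. ennreal ((R * Kr i i) ^ n)) \<noteq> top" using fin by (auto simp: top_unique)
  then have "summable (\<lambda>n. (R * Kr i i) ^ n)"
    using R Kr_nonneg by (intro summable_suminf_not_top) auto
  then have "R * Kr i i < 1" using R Kr_nonneg[of i i] by (simp add: summable_geometric_iff)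
  then show ?thesis using l by (simp add: R_def field_simps)
qed

text \<open>For \<open>l \<ge> rate\<close>, finiteness would by monotonicity contradict \<open>green_rates_bound\<close>.\<close>

lemma laplace_finite_iff:
  assumes "i \<noteq> 0" "j \<noteq> 0" "l \<ge> 0"
  shows "laplace i j l < \<infinity> \<longleftrightarrow> l \<in> green_rates"
proof -
  have below: "laplace i j k < \<infinity> \<longleftrightarrow> k \<in> green_rates" if k: "0 \<le> k" "k < rate" for k
  proof -
    have "laplace i j k < \<infinity> \<longleftrightarrow> green K (rate / (rate - k)) i j < \<infinity>"
      using k laplace_eq_green[where P = P and K = K and i = i and j = j and l = k,
          OF P_uniformization P_nonneg rate_pos]
      by (auto simp: ennreal_mult_less_top)
    also have "\<dots> \<longleftrightarrow> k \<in> green_rates"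
      using green_finite_transfer[OF radius_ge_1[OF k] assms(1,2)] k assms by (auto simp: green_rates_def)
    finally show ?thesis .
  qed
  show ?thesis
  proof (cases "l < rate")
    case True
    then show ?thesis using below assms by blast
  next
    case False
    \<comment> \<open>Halving the holding probability places \<open>k\<close> strictly between the
      bound \<open>rate * (1 - Kr i i)\<close> and \<open>rate\<close>.\<close>
    define k where "k = rate * (1 - Kr i i / 2)"
    have "Kr i i \<le> 1" using K_le_1[of i i] by (simp add: K_def ennreal_le_1)
    then have k: "0 \<le> k" "k < rate" "rate * (1 - Kr i i) < k"
      using rate_pos Kr_self_pos[of i] by (simp_all add: k_def right_diff_distrib)
    have "laplace i j k \<le> laplace i j l" using k False P_nonneg
      by (intro nn_integral_mono) (auto simp: indicator_def intro!: ennreal_leI mult_right_mono)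
    moreover have "\<not> laplace i j k < \<infinity>"
      using below[OF k(1,2)] green_rates_bound[OF _ assms(1), of k] k(3) by auto
    ultimately have "\<not> laplace i j l < \<infinity>" by (meson le_less_trans)
    then show ?thesis using False by (simp add: green_rates_def)
  qed
qed

text \<open>The set of rates is the same for all pairs of states, so the common value in the
  definition exists; a concrete nonzero state makes it unique.\<close>

lemma decay_parameter_eq: "decay_parameter (UNIV - {0}) P = Sup (ereal ` green_rates)"
proof -
  have *: "{l. l \<ge> 0 \<and> laplace i j l < \<infinity>} = green_rates"
    if "i \<in> UNIV - {0}" "j \<in> UNIV - {0}" for i j
    using laplace_finite_iff[of i j] that by (auto simp: green_rates_def)
  have o: "axis undefined 1 \<in> (UNIV - {0} :: (nat ^ 'd) set)" by (simp add: axis_eq_0_iff)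
  show ?thesis
    unfolding decay_parameter_def
  proof (rule the_equality)
    fix L
    assume "\<forall>i\<in>UNIV - {0}. \<forall>j\<in>UNIV - {0}. L = Sup (ereal ` {l. l \<ge> 0 \<and> laplace i j l < \<infinity>})"
    from bspec[OF bspec[OF this o] o] show "L = Sup (ereal ` green_rates)" by (simp only: *[OF o o])
  next
    show "\<forall>i\<in>UNIV - {0}. \<forall>j\<in>UNIV - {0}. Sup (ereal ` green_rates) = Sup (ereal ` {l. l \<ge> 0 \<and>
      laplace i j l < \<infinity>})"
    proof (intro ballI)
      fix i j :: "nat ^ 'd" assume "i \<in> UNIV - {0}" "j \<in> UNIV - {0}"
      from *[OF this] show "Sup (ereal ` green_rates) = Sup (ereal ` {l. l \<ge> 0 \<and>
        laplace i j l < \<infinity>})"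
        by (rule arg_cong[where f = "\<lambda>A. Sup (ereal ` A)", OF sym])
    qed
  qed
qed

lemma approximating_rates:
  assumes "0 \<le> l" "ereal l \<le> decay_parameter (UNIV - {0}) P"
  obtains ls where "\<And>n. ls n \<in> green_rates" "ls \<longlonglongrightarrow> l" "l < rate"
proof -
  have le: "ereal l \<le> Sup (ereal ` green_rates)" using assms by (simp add: decay_parameter_eq)
  have "\<exists>k\<in>green_rates. ereal (l - 1 / real (Suc n)) < ereal k" for n
  proof -
    have "ereal (l - 1 / real (Suc n)) < ereal l" by simp
    also note le
    finally show ?thesis unfolding less_Sup_iff by auto
  qed
  then obtain k where k: "\<And>n. k n \<in> green_rates" "\<And>n. l - 1 / real (Suc n) < k n"
    by (metis less_ereal.simps(1))
  define ls where "ls n = min (k n) l" for n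
  have "ls n \<in> green_rates" for n
    using green_rates_down[OF k(1)[of n]] k(1)[of n] assms(1) by (auto simp: ls_def green_rates_def min_def)
  moreover have "ls \<longlonglongrightarrow> l"
  proof (rule tendsto_sandwich[OF always_eventually always_eventually])
    show "\<forall>n. l - 1 / real (Suc n) \<le> ls n" using k(2) by (auto simp: ls_def intro: less_imp_le)
    show "\<forall>n. ls n \<le> l" by (auto simp: ls_def)
    have "(\<lambda>n. l - 1 / real (Suc n)) \<longlonglongrightarrow> l - 0" by (intro tendsto_intros LIMSEQ_Suc[OF lim_1_over_n])
    then show "(\<lambda>n. l - 1 / real (Suc n)) \<longlonglongrightarrow> l" by simp
  qed simp
  moreover have "l < rate"
  proof -
    let ?o = "axis undefined 1 :: nat ^ 'd"
    have "ls n \<le> rate * (1 - Kr ?o ?o)" for n by (rule green_rates_bound) (use calculation in auto)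
    then have "l \<le> rate * (1 - Kr ?o ?o)" using calculation(2) by (intro LIMSEQ_le_const2) auto
    also have "\<dots> < rate" using rate_pos Kr_self_pos[of ?o] by (simp add: right_diff_distrib)
    finally show ?thesis .
  qed
  ultimately show thesis using that by blast
qed

end

section \<open>The minimal root and the derivative at 1\<close>

context network
begin

abbreviation qmin :: "real ^ 'd" where
  "qmin \<equiv> min_root lam mu gam"

definition S :: "'d \<Rightarrow> real \<Rightarrow> real" where
  "S r x = (\<Sum>k. lam r (Suc k) * x ^ Suc k)"

lemma B_eq_S: "\<beta> r x = x $ r * (S r (x $ r) - lam_total lam r)
    + mu r * (gam r None + routed r x) - mu r * x $ r" by (simp add: B_def S_def)

lemma S_mono: "0 \<le> x \<Longrightarrow> x \<le> y \<Longrightarrow> y \<le> 1 \<Longrightarrow> S r x \<le> S r y"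
  unfolding S_def using lam_nonneg[of "Suc _" r]
  by (intro suminf_le lam_power_summable mult_left_mono power_mono) auto

lemma S_nonneg: "0 \<le> x \<Longrightarrow> x \<le> 1 \<Longrightarrow> 0 \<le> S r x"
  unfolding S_def using lam_nonneg[of "Suc _" r] by (intro suminf_nonneg lam_power_summable) auto

text \<open>Convergence is needed up to the boundary point 1, where the radius of convergence is of
  no help; the summable coefficients dominate the terms.\<close>

lemma tendsto_S:
  assumes "\<And>n. 0 \<le> x n" "\<And>n. x n \<le> 1" "x \<longlonglongrightarrow> p"
  shows "(\<lambda>n. S r (x n)) \<longlonglongrightarrow> S r p"
proof -
  have "((\<lambda>n. \<Sum>k. lam r (Suc k) * x n ^ Suc k) \<longlongrightarrow> (\<Sum>k. lam r (Suc k) * p ^ Suc k)) sequentially"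
  proof (rule tannerys_theorem[where M = "\<lambda>k. lam r (Suc k)", THEN conjunct2, THEN conjunct2])
    show "(\<lambda>n. lam r (Suc k) * x n ^ Suc k) \<longlonglongrightarrow> lam r (Suc k) * p ^ Suc k" for k
      by (intro tendsto_intros assms)
    have "norm (lam r (Suc k) * x n ^ Suc k) \<le> lam r (Suc k)" for k n
      using assms lam_nonneg[of "Suc k" r]
      by (auto simp: abs_mult simp del: power_Suc intro!: mult_left_le power_le_one)
    then show "\<forall>\<^sub>F (k, n) in at_top \<times>\<^sub>F sequentially. norm (lam r (Suc k) * x n ^ Suc k) \<le> lam r (Suc k)"
      by (intro always_eventually) auto
  qed (auto intro: lam_summable)
  then show ?thesis by (simp add: S_def)
qed

text \<open>The fixed points are the roots of \<open>B\<close>. The step size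
  \<open>1 / rate\<close> gives \<open>x_r\<close> the positive coefficient
  \<open>rate - speed r\<close> in \<open>F_eq\<close>, which makes \<open>F\<close>
  monotone.\<close>

definition F :: "real ^ 'd \<Rightarrow> real ^ 'd" where
  "F x = (\<chi> r. x $ r + \<beta> r x / rate)"

lemma F_component: "F x $ r = x $ r + \<beta> r x / rate"
  by (simp add: F_def)

lemma F_eq: "F x $ r = (x $ r * (rate - speed r) + x $ r * S r (x $ r)
    + mu r * (gam r None + routed r x)) / rate"
  using rate_pos by (simp add: F_component B_eq_S field_simps)

text \<open>Two quantitative forms of monotonicity: a strict increase in coordinate \<open>r\<close>
  persists under \<open>F\<close>, and one in coordinate \<open>s\<close> is passed on to every
  \<open>r\<close> that routes to \<open>s\<close>.\<close>

lemma F_mono_gap: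
  assumes "\<And>s. 0 \<le> x $ s" "\<And>s. x $ s \<le> y $ s" "\<And>s. y $ s \<le> 1"
  shows "F y $ r - F x $ r \<ge> (y $ r - x $ r) * (rate - speed r) / rate"
    and "F y $ r - F x $ r \<ge> mu r * gam r (Some s) * (y $ s - x $ s) / rate"
proof -
  have xy: "x $ r * S r (x $ r) \<le> y $ r * S r (y $ r)"
    using assms order_trans[OF assms(2,3)] order_trans[OF assms(1,2)] by (intro mult_mono S_mono S_nonneg) auto
  have sum: "gam r (Some s) * (y $ s - x $ s) \<le> routed r y - routed r x" for s
    unfolding sum_subtractf[symmetric] right_diff_distrib[symmetric]
    using gam_nonneg assms(2) by (intro member_le_sum[of s]) auto
  then have sum': "mu r * gam r (Some s) * (y $ s - x $ s) \<le> mu r * (routed r y - routed r x)" for s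
    using mu_pos[of r] by (simp only: mult.assoc) (intro mult_left_mono, auto)
  have s0: "0 \<le> mu r * (routed r y - routed r x)"
    using order_trans[OF _ sum'[of r]] by (simp add: gam_diag)
  have eq: "F y $ r - F x $ r = ((y $ r - x $ r) * (rate - speed r)
    + (y $ r * S r (y $ r) - x $ r * S r (x $ r)) + mu r * (routed r y - routed r x)) / rate"
    unfolding F_eq diff_divide_distrib[symmetric] by (simp add: algebra_simps)
  have d: "0 \<le> (y $ r - x $ r) * (rate - speed r)"
    using assms(2)[of r] rate_gt_single[of r] by (intro mult_nonneg_nonneg) auto
  show "F y $ r - F x $ r \<ge> (y $ r - x $ r) * (rate - speed r) / rate"
    unfolding eq using xy s0 rate_pos by (intro divide_right_mono) auto
  show "F y $ r - F x $ r \<ge> mu r * gam r (Some s) * (y $ s - x $ s) / rate"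
    unfolding eq using xy sum'[of s] d rate_pos by (intro divide_right_mono) linarith+
qed

lemma F_mono:
  assumes "\<And>s. 0 \<le> x $ s" "\<And>s. x $ s \<le> y $ s" "\<And>s. y $ s \<le> 1"
  shows "F x $ r \<le> F y $ r"
proof -
  have "0 \<le> (y $ r - x $ r) * (rate - speed r) / rate"
    using assms(2)[of r] rate_gt_single[of r] rate_pos by (intro divide_nonneg_pos mult_nonneg_nonneg) auto
  then show ?thesis using F_mono_gap(1)[OF assms, of r] by linarith
qed

lemma F_fixed_iff: "(\<forall>r. \<beta> r x = 0) \<longleftrightarrow> F x = x"
  using rate_pos by (simp add: vec_eq_iff F_component)

definition approx :: "nat \<Rightarrow> real ^ 'd" where "approx n = (F ^^ n) 0"

lemma approx_Suc: "approx (Suc n) = F (approx n)"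
  by (simp add: approx_def)

lemma approx_below_fixed:
  assumes "\<And>s. 0 \<le> y $ s" "\<And>s. y $ s \<le> 1" "F y = y"
  shows "0 \<le> approx n $ r \<and> approx n $ r \<le> y $ r"
proof (induction n arbitrary: r)
  case (Suc n)
  have "F 0 $ r \<ge> 0"
    using rate_pos mu_pos[of r] gam_nonneg[of r None] by (simp add: F_component B_def)
  moreover have "F 0 $ r \<le> F (approx n) $ r"
    using Suc assms(2) by (intro F_mono) (auto intro: order_trans)
  moreover have "F (approx n) $ r \<le> F y $ r" using Suc assms by (intro F_mono) auto
  ultimately show ?case using assms(3) by (simp add: approx_Suc)
qed (use assms in \<open>simp add: approx_def\<close>)

lemma F_1: "F 1 = 1"
  using F_fixed_iff[of 1] B_1 by blast

lemma approx_bounds: "0 \<le> approx n $ r" "approx n $ r \<le> 1"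
  using approx_below_fixed[of 1 n r] F_1 by auto

lemma approx_mono: "approx n $ r \<le> approx (Suc n) $ r"
proof (induction n arbitrary: r)
  case 0
  then show ?case using approx_bounds[of "Suc 0"] by (simp add: approx_def)
next
  case (Suc n)
  have "F (approx n) $ r \<le> F (approx (Suc n)) $ r" by (rule F_mono) (rule approx_bounds Suc)+
  then show ?case by (simp flip: approx_Suc)
qed

text \<open>The value of \<open>B\<close> at an iterate is a multiple of the next increment, so
  monotone iteration means \<open>B \<ge> 0\<close> and strict growth means
  \<open>B > 0\<close>.\<close>

lemma B_approx: "\<beta> r (approx n) = rate * (approx (Suc n) $ r - approx n $ r)"
  using rate_pos by (simp add: approx_Suc F_component)

lemma B_approx_nonneg: "\<beta> r (approx n) \<ge> 0"
  unfolding B_approx using rate_pos approx_mono[of n r] by simp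

text \<open>The monotone limit of the iterates is a root by continuity and lies below every other
  root in the cube, so the \<open>LEAST\<close> in \<open>min_root\<close> is attained.\<close>

lemma min_root_props:
  shows "\<And>r. (\<lambda>n. approx n $ r) \<longlonglongrightarrow> qmin $ r"
    and "\<And>r. \<beta> r (qmin) = 0"
proof -
  have conv: "convergent (\<lambda>n. approx n $ r)" for r
  proof -
    have "incseq (\<lambda>n. approx n $ r)" by (rule incseq_SucI) (rule approx_mono)
    moreover have "\<forall>n. approx n $ r \<le> 1" using approx_bounds by blast
    ultimately obtain L where "(\<lambda>n. approx n $ r) \<longlonglongrightarrow> L" by (rule incseq_convergent)
    then show ?thesis by (rule convergentI)
  qed
  define p where "p = (\<chi> r. lim (\<lambda>n. approx n $ r))"
  have p: "(\<lambda>n. approx n $ r) \<longlonglongrightarrow> p $ r" for r using conv by (simp add: p_def convergent_LIMSEQ_iff)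
  have p01: "0 \<le> p $ r" "p $ r \<le> 1" for r
    using LIMSEQ_le_const[OF p[of r]] LIMSEQ_le_const2[OF p[of r]] approx_bounds by blast+
  have Bp: "\<beta> r p = 0" for r
  proof -
    have "(\<lambda>n. \<beta> r (approx n)) \<longlonglongrightarrow> \<beta> r p"
      unfolding B_eq_S by (intro tendsto_intros tendsto_S p approx_bounds)
    moreover have "(\<lambda>n. \<beta> r (approx n)) \<longlonglongrightarrow> rate * (p $ r - p $ r)"
      unfolding B_approx by (intro tendsto_intros p LIMSEQ_Suc[OF p])
    ultimately show ?thesis using LIMSEQ_unique by fastforce
  qed
  have "qmin = p"
    unfolding min_root_def
  proof (rule Least_equality)
    show "0 \<le> p \<and> p \<le> 1 \<and> (\<forall>r. \<beta> r p = 0)" using p01 Bp by (simp add: less_eq_vec_def)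
    fix y assume y: "0 \<le> y \<and> y \<le> 1 \<and> (\<forall>r. \<beta> r y = 0)"
    have "approx n $ r \<le> y $ r" for n r
      using approx_below_fixed[of y n r] y F_fixed_iff[of y] by (simp add: less_eq_vec_def)
    then show "p \<le> y" using LIMSEQ_le_const2[OF p] by (auto simp: less_eq_vec_def)
  qed
  then show "(\<lambda>n. approx n $ r) \<longlonglongrightarrow> qmin $ r" "\<beta> r (qmin) = 0" for r using p Bp by auto
qed

lemma min_root_bounds: "0 \<le> qmin $ r" "qmin $ r \<le> 1"
  using LIMSEQ_le_const[OF min_root_props(1)[of r]] LIMSEQ_le_const2[OF min_root_props(1)[of r]] approx_bounds
  by blast+

text \<open>Growth starts at a coordinate with a positive exit probability, spreads backwards along
  the routing graph and never stops. Hence late iterates have all \<open>B_r\<close> positive, and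
  every iterate lies strictly below 1.\<close>

lemma approx_strict:
  obtains N where "\<And>n r. n \<ge> N \<Longrightarrow> approx n $ r < approx (Suc n) $ r"
proof -
  have step1: "approx (Suc n) $ r < approx (Suc (Suc n)) $ r" if "approx n $ r < approx (Suc n) $ r" for n r
  proof -
    have "0 < (approx (Suc n) $ r - approx n $ r) * (rate - speed r) / rate"
      using that rate_gt_single[of r] rate_pos by simp
    also have "\<dots> \<le> F (approx (Suc n)) $ r - F (approx n) $ r"
      by (rule F_mono_gap(1)) (rule approx_bounds approx_mono)+
    finally show ?thesis by (simp flip: approx_Suc)
  qed
  have step2: "approx (Suc n) $ r < approx (Suc (Suc n)) $ r"
    if "approx n $ s < approx (Suc n) $ s" "gam r (Some s) > 0" for n r s
  proof -
    have "0 < mu r * gam r (Some s) * (approx (Suc n) $ s - approx n $ s) / rate"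
      using that mu_pos[of r] rate_pos by simp
    also have "\<dots> \<le> F (approx (Suc n)) $ r - F (approx n) $ r"
      by (rule F_mono_gap(2)) (rule approx_bounds approx_mono)+
    finally show ?thesis by (simp flip: approx_Suc)
  qed
  obtain s where s: "gam s None > 0" using gam_exit by blast
  have s0: "approx 0 $ s < approx (Suc 0) $ s"
    using s mu_pos[of s] rate_pos by (simp add: approx_def F_component B_def)
  have "\<exists>n. approx n $ r < approx (Suc n) $ r" for r
  proof -
    have "(r, s) \<in> {(r, s). gam r (Some s) > 0}\<^sup>+"
      using gam_irreducible by (simp add: irreducible_nonneg_matrix_def)
    then show ?thesis by (induction rule: converse_trancl_induct) (use s0 step2 in blast)+
  qed
  then obtain n0 where n0: "\<And>r. approx (n0 r) $ r < approx (Suc (n0 r)) $ r" by metis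
  define N where "N = Max (range n0)"
  have "approx n $ r < approx (Suc n) $ r" if "n \<ge> N" for n r
  proof -
    have "n0 r \<le> N" unfolding N_def by (rule Max_ge) auto
    with that have "n0 r \<le> n" by simp
    then show ?thesis by (induction n rule: dec_induct) (use n0 step1 in auto)
  qed
  then show thesis by (rule that)
qed

text \<open>The monomial has value 1 at the empty state. Splitting this value off as
  \<open>K i 0\<close> brings the identity into the form that \<open>test_pair\<close>
  requires.\<close>

lemma kop_off_zero:
  assumes y: "\<And>s. 0 \<le> y $ s" "\<And>s. y $ s \<le> 1"
  shows "kop K (\<lambda>j. ennreal (if j = 0 then 0 else monomial y j)) i + K i 0
    = ennreal (monomial y i + drift y i / rate)"
proof -
  have "ennreal (monomial y j) = ennreal (if j = 0 then 0 else monomial y j) + indicator {0} j" for j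
    by (auto simp: monomial_zero indicator_def)
  then have "kop K (\<lambda>j. ennreal (monomial y j)) i
    = kop K (\<lambda>j. ennreal (if j = 0 then 0 else monomial y j) + indicator {0} j) i" by simp
  also have "\<dots> = kop K (\<lambda>j. ennreal (if j = 0 then 0 else monomial y j)) i + K i 0"
    using kpow_1[of K i 0] by (simp add: kop_add kpow_def)
  finally show ?thesis using kop_K_monomial(1)[OF y, of i] by simp
qed

text \<open>If one coordinate of \<open>i\<close> is large, its power alone is below
  \<open>e\<close> and the remaining factors are at most 1; so exceptional \<open>i\<close> lie in a
  finite box.\<close>

lemma monomial_vanishing:
  fixes y :: "real ^ 'd"
  assumes y: "\<And>s. 0 \<le> y $ s" "\<And>s. y $ s < 1" and e: "e > 0"
  shows "finite {i. monomial y i > e}"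
proof -
  have "\<exists>N. \<forall>n\<ge>N. y $ t ^ n < e" for t
  proof -
    have "(\<lambda>n. y $ t ^ n) \<longlonglongrightarrow> 0" using y by (intro LIMSEQ_power_zero) auto
    from order_tendstoD(2)[OF this e] show ?thesis by (simp add: eventually_sequentially)
  qed
  then obtain N where N: "\<And>t n. n \<ge> N t \<Longrightarrow> y $ t ^ n < e" by metis
  show ?thesis
  proof (rule finite_subset[OF _ finite_vec_le[of N]])
    show "{i. monomial y i > e} \<subseteq> {i. \<forall>t. i $ t \<le> N t}"
    proof (safe, rule ccontr)
      fix i :: "nat ^ 'd" and t assume i: "e < monomial y i" "\<not> i $ t \<le> N t"
      have "monomial y i = y $ t ^ (i $ t) * (\<Prod>s\<in>UNIV - {t}. y $ s ^ (i $ s))"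
        unfolding monomial_def by (subst prod.remove[of _ t]) auto
      also have "\<dots> \<le> y $ t ^ (i $ t) * 1"
        using y by (intro mult_left_mono prod_le_1) (auto intro: power_le_one less_imp_le)
      also have "\<dots> < e" using N[of t "i $ t"] i by simp
      finally show False using i by simp
    qed
  qed
qed

text \<open>\<open>jacobian_1 a\<close> is \<open>B'(1)\<close> when \<open>a r = \<Sum>\<^sub>k k \<lambda>\<^sub>r\<^sub>k\<close>; partial sums for \<open>a\<close> bound it from below.\<close>

definition jacobian_1 :: "('d \<Rightarrow> real) \<Rightarrow> real ^ 'd ^ 'd" where
  "jacobian_1 a = (\<chi> r s. (if s = r then a r - mu r else 0) + mu r * gam r (Some s))"

abbreviation mean_jump :: "'d \<Rightarrow> real" where
  "mean_jump r \<equiv> (\<Sum>k. real (Suc k) * lam r (Suc k))"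

abbreviation finite_mean :: "'d \<Rightarrow> bool" where
  "finite_mean r \<equiv> summable (\<lambda>k. real (Suc k) * lam r (Suc k))"

definition tangent :: "nat \<Rightarrow> real ^ 'd ^ 'd" where
  "tangent N = jacobian_1 (\<lambda>r. \<Sum>k<N. real (Suc k) * lam r (Suc k))"

lemma jacobian_1_mult: "(jacobian_1 a *v v) $ r = (a r - mu r) * v $ r + mu r * routed r v"
proof -
  have "(jacobian_1 a *v v) $ r = (\<Sum>s\<in>UNIV. (if s = r then (a r - mu r) * v $ s else 0)
    + mu r * (gam r (Some s) * v $ s))"
    unfolding matrix_vector_mult_def jacobian_1_def by (auto intro!: sum.cong simp: algebra_simps)
  then show ?thesis by (simp add: sum.distrib sum_distrib_left)
qed

lemma tangent_mult: "(tangent N *v v) $ r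
    = ((\<Sum>k<N. real (Suc k) * lam r (Suc k)) - mu r) * v $ r + mu r * routed r v"
  unfolding tangent_def jacobian_1_mult ..

lemma perron_jacobian_1:
  obtains v where "\<And>r. v $ r > 0" "jacobian_1 a *v v = max_real_eigenvalue (jacobian_1 a) *\<^sub>R v"
proof (rule perron_frobenius[of "jacobian_1 a"])
  have off: "jacobian_1 a $ r $ s = mu r * gam r (Some s)" if "r \<noteq> s" for r s
    using that by (simp add: jacobian_1_def)
  then show "jacobian_1 a $ r $ s \<ge> 0" if "r \<noteq> s" for r s
    using that mu_pos[of r] gam_nonneg[of r "Some s"] by simp
  have "r \<noteq> s \<and> jacobian_1 a $ r $ s > 0 \<longleftrightarrow> gam r (Some s) > 0" for r s
    using off[of r s] mu_pos[of r] gam_diag[of r] by (cases "r = s") (auto simp: zero_less_mult_iff)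
  then show "(r, s) \<in> {(r, s). r \<noteq> s \<and> jacobian_1 a $ r $ s > 0}\<^sup>+" for r s
    using gam_irreducible by (simp add: irreducible_nonneg_matrix_def)
qed blast

section \<open>First-order behaviour of B at 1\<close>

lemma B_decrement:
  assumes x: "\<And>s. x $ s = 1 - e * v $ s"
  shows "\<beta> r x = x $ r * (S r (x $ r) - lam_total lam r) + e * mu r * v $ r - e * mu r * routed r v"
proof -
  have "gam r None = 1 - (\<Sum>s\<in>UNIV. gam r (Some s))" using gam_split[of r] by simp
  then show ?thesis
    unfolding B_eq_S x by (simp add: sum_subtractf right_diff_distrib sum_distrib_left algebra_simps)
qed

abbreviation secant :: "nat \<Rightarrow> real ^ 'd \<Rightarrow> 'd \<Rightarrow> real \<Rightarrow> real" where
  "secant N v r e \<equiv> (1 - e * v $ r) * (\<Sum>k<N. lam r (Suc k) * ((1 - e * v $ r) ^ Suc k - 1))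
    + e * mu r * v $ r - e * mu r * routed r v"

text \<open>For \<open>x \<le> 1\<close> each term of the difference series is nonpositive, so
  cutting it off at \<open>N\<close> can only increase it. The bound is a polynomial in
  \<open>e\<close> and therefore differentiable at 0 even if the mean jump size is infinite.\<close>

lemma B_tangent_upper:
  assumes x: "\<And>s. x $ s = 1 - e * v $ s" and x0: "0 \<le> x $ r" "x $ r \<le> 1"
  shows "\<beta> r x \<le> secant N v r e"
proof -
  have "S r (x $ r) - lam_total lam r = (\<Sum>k. lam r (Suc k) * (x $ r ^ Suc k - 1))"
    unfolding S_def lam_total_def using suminf_diff[OF lam_power_summable[OF x0] lam_summable]
    by (simp add: algebra_simps)
  also have "\<dots> \<le> (\<Sum>k<N. lam r (Suc k) * (x $ r ^ Suc k - 1))"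
  proof -
    have s: "summable (\<lambda>k. lam r (Suc k) * (x $ r ^ Suc k - 1))"
      using summable_diff[OF lam_power_summable[OF x0] lam_summable, of r] by (simp add: algebra_simps)
    have "lam r (Suc k) * (x $ r ^ Suc k - 1) \<le> 0" for k
      using lam_nonneg[of "Suc k" r] power_le_one[OF x0, of "Suc k"] by (intro mult_nonneg_nonpos) auto
    then have "(\<Sum>k<N. - (lam r (Suc k) * (x $ r ^ Suc k - 1))) \<le> (\<Sum>k. - (lam r (Suc k) * (x $ r ^ Suc k - 1)))"
      by (intro sum_le_suminf summable_minus s) auto
    then show ?thesis using suminf_minus[OF s] by (simp add: sum_negf)
  qed
  finally have "x $ r * (S r (x $ r) - lam_total lam r) \<le> x $ r * (\<Sum>k<N. lam r (Suc k) * (x $ r ^ Suc k - 1))"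
    using x0 by (intro mult_left_mono)
  then show ?thesis unfolding B_decrement[of x e v, OF x] x[of r] by linarith
qed

text \<open>\<open>secant\<close> vanishes at \<open>e = 0\<close>, so the quotient tends to its
  derivative there.\<close>

lemma tangent_limit:
  "((\<lambda>e. secant N v r e / e) \<longlongrightarrow> - (tangent N *v v) $ r) (at_right 0)"
proof -
  let ?g = "secant N v r"
  have d0: "((\<lambda>e. \<Sum>k<N. lam r (Suc k) * ((1 - e * v $ r) ^ Suc k - 1)) has_real_derivative
      (\<Sum>k<N. lam r (Suc k) * (real (Suc k) * (1 - 0 * v $ r) ^ k * (- v $ r)))) (at 0)"
    by (intro DERIV_sum) (auto intro!: derivative_eq_intros simp del: power_Suc)
  have d: "((\<lambda>e. \<Sum>k<N. lam r (Suc k) * ((1 - e * v $ r) ^ Suc k - 1)) has_real_derivative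
      (- (\<Sum>k<N. real (Suc k) * lam r (Suc k)) * v $ r)) (at 0)"
  proof -
    have "(\<Sum>k<N. lam r (Suc k) * (real (Suc k) * (1 - 0 * v $ r) ^ k * (- v $ r)))
      = (\<Sum>k<N. - (real (Suc k) * lam r (Suc k) * v $ r))" by (intro sum.cong) auto
    also have "\<dots> = - (\<Sum>k<N. real (Suc k) * lam r (Suc k)) * v $ r"
      unfolding sum_negf sum_distrib_right[symmetric] by simp
    finally show "?thesis" using d0 by (simp only:)
  qed
  have "(?g has_real_derivative - (tangent N *v v) $ r) (at 0)"
    by (rule derivative_eq_intros d refl)+ (simp add: tangent_mult algebra_simps)
  then have "((\<lambda>e. (?g e - ?g 0) / (e - 0)) \<longlongrightarrow> - (tangent N *v v) $ r) (at 0)"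
    by (simp only: has_field_derivative_iff)
  then have "((\<lambda>e. ?g e / e) \<longlongrightarrow> - (tangent N *v v) $ r) (at 0)" by simp
  then show ?thesis by (rule tendsto_within_subset) simp
qed

text \<open>Writing the factor \<open>real (Suc k + 1)\<close> as \<open>real (Suc k) + 1\<close>
  splits off one copy of \<open>lam_total\<close>, which cancels in \<open>dB\<close>. What remains
  on the diagonal is the mean jump size minus \<open>mu r\<close>.\<close>

lemma dB_1_series:
  "(\<Sum>k. ereal (real (Suc k + 1) * lam r (Suc k) * (1 $ r) ^ Suc k)) = (if finite_mean r
       then ereal (mean_jump r + lam_total lam r) else \<infinity>)"
proof -
  let ?a = "\<lambda>k. real (Suc k) * lam r (Suc k) + lam r (Suc k)"
  have nn: "0 \<le> ?a k" for k
    using lam_nonneg[of "Suc k" r] by (intro add_nonneg_nonneg mult_nonneg_nonneg) auto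
  have e: "ereal (real (Suc k + 1) * lam r (Suc k) * (1 $ r) ^ Suc k)
    = ereal (?a k)" for k by (simp add: algebra_simps)
  show ?thesis
  proof (cases "finite_mean r")
    case True
    have "(\<Sum>k. ereal (?a k))
      = ereal (\<Sum>k. ?a k)"
      using nn True lam_summable[of r] by (intro suminf_ereal' summable_add) auto
    also have "(\<Sum>k. ?a k) = mean_jump r + lam_total lam r"
      unfolding lam_total_def using True lam_summable[of r] by (intro suminf_add[symmetric])
    finally show ?thesis unfolding e using True by simp
  next
    case False
    have "(\<Sum>k. ereal (?a k)) = \<infinity>"
    proof (rule ccontr)
      assume "(\<Sum>k. ereal (?a k)) \<noteq> \<infinity>"
      then have "summable (\<lambda>k. ?a k)"
        using nn by (intro summable_ereal) auto
      from summable_diff[OF this lam_summable[of r]] False show False by simp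
    qed
    then show ?thesis unfolding e using False by simp
  qed
qed

lemma dB_1:
  "dB lam mu gam r s 1 = (if s = r \<and> \<not> finite_mean r then \<infinity>
     else ereal ((if s = r then mean_jump r - mu r else 0) + mu r * gam r (Some s)))"
  unfolding dB_def dB_1_series by (auto simp: gam_diag)

lemma rho_1_cases:
  obtains (infinite) r where "\<not> finite_mean r" "rho lam mu gam 1 = \<infinity>"
  | (finite) v \<rho> where "\<And>r. finite_mean r" "rho lam mu gam 1 = ereal \<rho>"
      "\<And>r. v $ r > 0" "jacobian_1 mean_jump *v v = \<rho> *\<^sub>R v"
proof (cases "\<exists>r. \<not> finite_mean r")
  case True
  then obtain r where r: "\<not> finite_mean r" by blast
  then have "dB lam mu gam r r 1 = \<infinity>" by (simp add: dB_1)
  then have "rho lam mu gam 1 = \<infinity>" unfolding rho_def by auto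
  with r infinite show thesis by blast
next
  case False
  then have fin: "finite_mean r" for r by blast
  have "rho lam mu gam 1 = ereal (max_real_eigenvalue (jacobian_1 mean_jump))"
    unfolding rho_def jacobian_1_def using fin by (simp add: dB_1)
  moreover obtain v where "\<And>r. v $ r > 0"
    "jacobian_1 mean_jump *v v = max_real_eigenvalue (jacobian_1 mean_jump) *\<^sub>R v"
    using perron_jacobian_1 by blast
  ultimately show thesis using finite fin by blast
qed

text \<open>By Bernoulli's inequality a root \<open>p\<close> makes \<open>w = 1 - p\<close> satisfy
  \<open>B'(1) w \<ge> 0\<close>. If \<open>w\<close> had a positive component, the row where
  \<open>w / v\<close> is maximal would be negative, because the Perron eigenvalue is.\<close>

lemma min_root_eq_1:
  assumes "rho lam mu gam 1 < 0"
  shows "qmin = 1"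
proof -
  obtain v \<rho> where fin: "\<And>r. finite_mean r"
    and \<rho>: "\<rho> < 0" and v: "\<And>r. v $ r > 0"
    and ev: "jacobian_1 mean_jump *v v = \<rho> *\<^sub>R v"
    using assms by (cases rule: rho_1_cases) auto
  define p where "p = qmin"
  define w where "w = 1 - p"
  have p01: "0 \<le> p $ r" "p $ r \<le> 1" for r using min_root_bounds by (auto simp: p_def)
  have w0: "w $ r \<ge> 0" for r using p01 by (simp add: w_def)
  let ?A = "jacobian_1 mean_jump"
  have Aw: "(?A *v w) $ r \<ge> 0" for r
  proof -
    have x: "p $ s = 1 - 1 * w $ s" for s by (simp add: w_def)
    have "p $ r * (S r (p $ r) - lam_total lam r) \<ge> - mean_jump r * w $ r"
    proof -
      have bern: "1 - p $ r ^ Suc k \<le> real (Suc k) * w $ r" for k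
        using Bernoulli_inequality[of "- w $ r" "Suc k"] p01[of r] by (simp add: w_def algebra_simps)
      have "lam_total lam r - S r (p $ r) = (\<Sum>k. lam r (Suc k) * (1 - p $ r ^ Suc k))"
        unfolding S_def lam_total_def using suminf_diff[OF lam_summable lam_power_summable[OF p01]]
        by (simp add: algebra_simps)
      also have "\<dots> \<le> (\<Sum>k. real (Suc k) * lam r (Suc k) * w $ r)"
      proof (rule suminf_le)
        show "lam r (Suc k) * (1 - p $ r ^ Suc k) \<le> real (Suc k) * lam r (Suc k) * w $ r" for k
          using mult_left_mono[OF bern[of k] lam_nonneg[of "Suc k" r]] by (simp add: mult_ac del: of_nat_Suc)
        show "summable (\<lambda>k. lam r (Suc k) * (1 - p $ r ^ Suc k))"
          using summable_diff[OF lam_summable lam_power_summable[OF p01], of r] by (simp add: algebra_simps)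
        show "summable (\<lambda>k. real (Suc k) * lam r (Suc k) * w $ r)"
          using fin by (rule summable_mult2)
      qed
      also have "\<dots> = mean_jump r * w $ r" using fin by (rule suminf_mult2[symmetric])
      finally have 1: "lam_total lam r - S r (p $ r) \<le> mean_jump r * w $ r" .
      have "0 \<le> lam_total lam r - S r (p $ r)"
        using S_mono[of "p $ r" 1 r] p01 by (simp add: S_def lam_total_def)
      then have "p $ r * (lam_total lam r - S r (p $ r)) \<le> lam_total lam r - S r (p $ r)"
        using p01[of r] by (simp add: mult_left_le_one_le)
      with 1 show ?thesis by (simp add: algebra_simps)
    qed
    moreover have "\<beta> r p = 0" using min_root_props(2) by (simp add: p_def)
    ultimately show ?thesis unfolding jacobian_1_mult B_decrement[of p 1 w, OF x] by (simp add: algebra_simps)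
  qed
  have "w $ r = 0" for r
  proof (rule ccontr)
    assume "w $ r \<noteq> 0"
    then have wr: "w $ r > 0" using w0[of r] by simp
    have off: "?A $ r $ s \<ge> 0" if "r \<noteq> s" for r s
      using that mu_pos[of r] gam_nonneg[of r "Some s"] by (simp add: jacobian_1_def)
    obtain t where t: "w $ t > 0" and le: "(?A *v w) $ t \<le> w $ t / v $ t * (?A *v v) $ t"
      by (rule max_ratio_row[OF off v wr])
    note le
    also have "w $ t / v $ t * (?A *v v) $ t = w $ t * \<rho>"
      unfolding ev using v[of t] by simp
    also have "\<dots> < 0" using t \<rho> by (simp add: mult_pos_neg)
    finally show False using Aw[of t] by simp
  qed
  then show ?thesis by (simp add: w_def p_def vec_eq_iff)
qed

text \<open>If some mean is infinite, a large \<open>N\<close> makes one diagonal entry nonnegative,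
  which forces the Perron eigenvalue of \<open>tangent N\<close> to be nonnegative. If all means are
  finite, the Perron vector of \<open>B'(1)\<close> works up to \<open>e\<close> for large
  \<open>N\<close>.\<close>

lemma rho_nonneg_direction:
  assumes "\<not> rho lam mu gam 1 < 0"
  obtains v where "\<And>r. v $ r > 0" "\<And>e. e > 0 \<Longrightarrow> \<exists>N. \<forall>r. - (tangent N *v v) $ r \<le> e"
proof (cases rule: rho_1_cases)
  case (infinite r)
  have nn: "0 \<le> real (Suc k) * lam r (Suc k)" for k using lam_nonneg[of "Suc k" r] by simp
  obtain N where N: "(\<Sum>k<N. real (Suc k) * lam r (Suc k)) \<ge> mu r"
  proof (rule ccontr)
    assume "\<not> thesis"
    then have "(\<Sum>k<N. real (Suc k) * lam r (Suc k)) \<le> mu r" for N using that by (meson linear)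
    then have "finite_mean r" using nn by (intro summableI_nonneg_bounded[where x = "mu r"]) auto
    with infinite show False by blast
  qed
  obtain v where v: "\<And>r. v $ r > 0" and ev: "tangent N *v v = max_real_eigenvalue (tangent N) *\<^sub>R v"
    unfolding tangent_def by (rule perron_jacobian_1) blast
  have "0 \<le> (tangent N *v v) $ r"
    unfolding tangent_mult using N v mu_pos[of r] gam_nonneg
    by (intro add_nonneg_nonneg mult_nonneg_nonneg sum_nonneg) (auto intro: less_imp_le)
  then have "0 \<le> max_real_eigenvalue (tangent N)" using v[of r] by (simp add: ev zero_le_mult_iff not_le)
  then have "- (tangent N *v v) $ r \<le> 0" for r using v[of r] by (simp add: ev)
  then show thesis using that[of v] v by (meson less_imp_le order_trans)
next
  case (finite v \<rho>)
  have \<rho>: "\<rho> \<ge> 0" using assms finite by simp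
  have "\<exists>N. \<forall>r. - (tangent N *v v) $ r \<le> e" if "e > 0" for e
  proof -
    have "\<forall>\<^sub>F N in sequentially. - (tangent N *v v) $ r < e" for r
    proof -
      have "(\<lambda>N. (\<Sum>k<N. real (Suc k) * lam r (Suc k))) \<longlonglongrightarrow> mean_jump r"
        using finite(1) by (rule summable_LIMSEQ)
      then have "(\<lambda>N. - (tangent N *v v) $ r) \<longlonglongrightarrow> - (jacobian_1 mean_jump *v v) $ r"
        unfolding tangent_mult jacobian_1_mult by (intro tendsto_intros)
      then have "(\<lambda>N. - (tangent N *v v) $ r) \<longlonglongrightarrow> - (\<rho> * v $ r)" by (simp only: finite(4) vector_scaleR_component real_scaleR_def)
      moreover have "- (\<rho> * v $ r) < e" using that \<rho> finite(3)[of r] by (smt (verit) mult_nonneg_nonneg)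
      ultimately show ?thesis by (rule order_tendstoD(2))
    qed
    then have "\<forall>\<^sub>F N in sequentially. \<forall>r. - (tangent N *v v) $ r < e"
      by (simp add: eventually_all_finite)
    then obtain N where "\<forall>n\<ge>N. \<forall>r. - (tangent n *v v) $ r < e"
      unfolding eventually_sequentially by blast
    then show ?thesis by (intro exI[of _ N]) (auto intro: less_imp_le)
  qed
  with finite(3) that show thesis by blast
qed

end

section \<open>Eigenmeasures\<close>

lemma has_sum_sum_family:
  fixes f :: "'b \<Rightarrow> 'a \<Rightarrow> real"
  assumes "finite I" "\<And>r. r \<in> I \<Longrightarrow> (f r has_sum s r) A"
  shows "((\<lambda>x. \<Sum>r\<in>I. f r x) has_sum (\<Sum>r\<in>I. s r)) A"
  using assms by (induction I rule: finite_induct) (auto intro!: has_sum_add)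

text \<open>\<open>mass_bound\<close> is the potential bound for the test functions \<open>y\<^sup>j\<close> at \<open>y = approx n\<close>.\<close>

locale eigenmeasure = network lam mu gam
  for lam :: "'d::finite \<Rightarrow> nat \<Rightarrow> real" and mu :: "'d \<Rightarrow> real" and gam :: "'d \<Rightarrow> 'd option \<Rightarrow> real" +
  fixes m :: "nat ^ 'd \<Rightarrow> real" and l :: real
  assumes l: "0 \<le> l" "l < rate"
    and m_pos: "\<And>i. i \<noteq> 0 \<Longrightarrow> m i > 0"
    and eigen: "\<And>j. j \<noteq> 0 \<Longrightarrow> m j = rate / (rate - l) * column_sum m j"
    and mass_bound: "\<And>n A. finite A \<Longrightarrow> 0 \<notin> A \<Longrightarrow> (\<Sum>j\<in>A. m j * (l * monomial (approx n) j
          + drift (approx n) j)) \<le> rate * column_sum m 0"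
begin

abbreviation nonzero :: "(nat ^ 'd) set" where "nonzero \<equiv> UNIV - {0}"

abbreviation part_summable :: "'d \<Rightarrow> real ^ 'd \<Rightarrow> bool" where
  "part_summable r x \<equiv> (\<lambda>i. m i * monomial x (i - axis r 1)) summable_on {i \<in> nonzero. i $ r > 0}"

lemma kernel_eigen:
  assumes j: "j \<noteq> 0"
  shows "(\<Sum>\<^sup>+ i. (if i = 0 then 0 else ennreal (m i)) * K i j)
    = ennreal ((rate - l) / rate) * (if j = 0 then 0 else ennreal (m j))"
proof -
  have "(\<Sum>\<^sup>+ i. (if i = 0 then 0 else ennreal (m i)) * K i j) = ennreal (column_sum m j)"
  proof -
    have "(\<lambda>i. (if i = 0 then 0 else ennreal (m i)) * K i j)
        = (\<lambda>i. ennreal (m i) * (if i = 0 then 0 else K i j))" by auto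
    then show ?thesis by (simp only:) (rule nn_sum_column[OF refl less_imp_le[OF m_pos]])
  qed
  also have "column_sum m j = (rate - l) / rate * m j" using eigen[OF j] l by simp
  also have "ennreal ((rate - l) / rate * m j) = ennreal ((rate - l) / rate) * ennreal (m j)"
    using m_pos[OF j] l by (intro ennreal_mult) auto
  finally show ?thesis by (simp only: if_not_P[OF j])
qed

lemma invariant_measure_Q_eigen: "invariant_measure_Q nonzero (gen lam mu gam) l m"
proof -
  have "((\<lambda>i. m i * gen lam mu gam i j) has_sum (- l * m j)) nonzero" if j: "j \<noteq> 0" for j
  proof -
    let ?I = "{i. i \<noteq> 0 \<and> K i j \<noteq> 0}"
    \<comment> \<open>The diagonal term of \<open>gen\<close> contributes at \<open>i = j\<close>;
      positivity of the holding probability guarantees that \<open>j\<close> belongs to the finite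
      index set \<open>?I\<close>.\<close>
    have Kjj: "K j j \<noteq> 0" using Kr_self_pos[of j] by (simp add: K_def not_le)
    have g: "gen lam mu gam i j = rate * (Kr i j - (if i = j then 1 else 0))" for i
      using rate_pos by (simp add: Kr_def)
    have zero: "m i * gen lam mu gam i j = 0" if "i \<in> nonzero - ?I" for i
    proof -
      have "Kr i j = 0" using that Kr_nonneg[of i j] by (auto simp: K_def)
      moreover have "i \<noteq> j" using that Kjj by auto
      ultimately show ?thesis by (simp add: g)
    qed
    have "((\<lambda>i. m i * gen lam mu gam i j) has_sum (\<Sum>i\<in>?I. m i * gen lam mu gam i j)) ?I"
      using finite_column[of j] by (intro has_sum_finite) auto
    also have "?this \<longleftrightarrow> ((\<lambda>i. m i * gen lam mu gam i j) has_sum (\<Sum>i\<in>?I. m i * gen lam mu gam i j)) nonzero"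
      by (rule has_sum_cong_neutral) (use zero in auto)
    finally have "((\<lambda>i. m i * gen lam mu gam i j) has_sum (\<Sum>i\<in>?I. m i * gen lam mu gam i j)) nonzero" .
    moreover have "(\<Sum>i\<in>?I. m i * gen lam mu gam i j) = - l * m j"
    proof -
      have "(\<Sum>i\<in>?I. m i * gen lam mu gam i j)
        = rate * ((\<Sum>i\<in>?I. m i * Kr i j) - (\<Sum>i\<in>?I. m i * (if i = j then 1 else 0)))"
        unfolding g sum_subtractf[symmetric] sum_distrib_left by (intro sum.cong) (auto simp: algebra_simps)
      also have "(\<Sum>i\<in>?I. m i * (if i = j then 1 else 0)) = m j"
        using finite_column[of j] j Kjj by (simp add: if_distrib[of "(*) _"] cong: if_cong)
      also have "(\<Sum>i\<in>?I. m i * Kr i j) = (rate - l) / rate * m j"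
        using eigen[OF j] l by (simp add: enn2real_K)
      also have "rate * ((rate - l) / rate * m j - m j) = - l * m j"
        using rate_pos by (simp add: field_simps)
      finally show ?thesis .
    qed
    ultimately show ?thesis by simp
  qed
  then show ?thesis using m_pos by (auto simp: invariant_measure_Q_def)
qed

definition flux :: real where "flux = (\<Sum>r\<in>UNIV. m (axis r 1) * mu r * gam r None)"

lemma Kr_axis_0: "Kr (axis r 1) 0 = mu r * gam r None / rate"
proof -
  have 1: "{t. (axis r 1 :: nat ^ 'd) $ t > 0} = {r}" by (auto simp: axis_component)
  have 2: "axis r (1::nat) \<noteq> (0 :: nat ^ 'd)" by (simp add: axis_eq_0_iff)
  have 3: "(0 :: nat ^ 'd) \<noteq> axis r 1 - axis r 1 + axis s 1" for s
    by (auto simp: vec_eq_iff axis_component)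
  have 4: "(0 :: nat ^ 'd) = axis r 1 - axis r 1" by (simp add: vec_eq_iff)
  have "jump r (axis r 1) 0 = mu r * gam r None"
    unfolding jump_def using 3 4 by simp
  then show ?thesis using 2 by (simp only: Kr_eq 1) simp
qed

lemma Kr_0_support:
  assumes "i \<noteq> 0" "i \<notin> range (\<lambda>r. axis r 1)"
  shows "Kr i 0 = 0"
proof -
  have "jump t i 0 = 0" if t: "i $ t > 0" for t
  proof -
    have "0 \<noteq> i - axis t 1"
    proof
      assume "0 = i - axis t 1"
      then have "i = axis t 1" using minus_axis_add[OF t] by simp
      with assms show False by blast
    qed
    moreover have "0 \<noteq> i - axis t 1 + axis s 1" for s
    proof
      assume "0 = i - axis t 1 + axis s 1"
      from arg_cong[OF this, of "\<lambda>v. v $ s"] show False by (simp add: axis_component)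
    qed
    ultimately show ?thesis by (simp add: jump_def)
  qed
  then show ?thesis using assms by (simp add: Kr_eq)
qed

text \<open>The empty state is entered only from unit vectors, by the departure of the last
  individual. This produces the right side of the functional equation.\<close>

lemma exit_flux: "column_sum m 0 = flux / rate"
proof -
  let ?E = "range (\<lambda>r. axis r 1 :: nat ^ 'd)"
  have inj: "inj (\<lambda>r. axis r 1 :: nat ^ 'd)" by (auto intro!: injI simp: axis_eq_axis)
  have "column_sum m 0 = (\<Sum>i\<in>?E. m i * Kr i 0)"
    unfolding enn2real_K
  proof (rule sum.mono_neutral_left)
    show "{i. i \<noteq> 0 \<and> K i 0 \<noteq> 0} \<subseteq> ?E" using Kr_0_support by (force simp: K_def)
    show "\<forall>i\<in>?E - {i. i \<noteq> 0 \<and> K i 0 \<noteq> 0}. m i * Kr i 0 = 0"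
    proof
      fix i assume i: "i \<in> ?E - {i. i \<noteq> 0 \<and> K i 0 \<noteq> 0}"
      then have "i \<noteq> 0" by (auto simp: axis_eq_0_iff)
      with i have "K i 0 = 0" by blast
      then have "Kr i 0 = 0" using Kr_nonneg[of i 0] by (simp add: K_def)
      then show "m i * Kr i 0 = 0" by simp
    qed
  qed auto
  also have "\<dots> = (\<Sum>r\<in>UNIV. m (axis r 1) * Kr (axis r 1) 0)" by (subst sum.reindex[OF inj]) simp
  also have "\<dots> = flux / rate"
    unfolding Kr_axis_0 flux_def sum_divide_distrib by (intro sum.cong) auto
  finally show ?thesis .
qed

lemma axis_ne_0: "axis r (1::nat) \<noteq> (0 :: nat ^ 'd)"
  by (simp add: axis_eq_0_iff)

lemma flux_pos: "flux > 0"
proof -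
  have nn: "0 \<le> m (axis r 1) * mu r * gam r None" for r
    using m_pos[OF axis_ne_0[of r]] mu_pos[of r] gam_nonneg[of r None] by simp
  obtain r where r: "gam r None > 0" using gam_exit by blast
  have "0 < m (axis r 1) * mu r * gam r None" using m_pos[OF axis_ne_0[of r]] mu_pos[of r] r by simp
  also have "\<dots> \<le> flux" unfolding flux_def by (intro member_le_sum nn) auto
  finally show ?thesis .
qed

section \<open>Generating functions of the measure\<close>

lemma gf_part_has_sum:
  assumes "part_summable r x"
  shows "((\<lambda>i. if i $ r > 0 then m i * monomial x (i - axis r 1) else 0) has_sum gf_part nonzero m r x)
    nonzero"
proof -
  have "((\<lambda>i. m i * monomial x (i - axis r 1)) has_sum gf_part nonzero m r x) {i \<in> nonzero. i $ r > 0}"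
    unfolding gf_part_def using assms by (rule has_sum_infsum)
  also have "?this \<longleftrightarrow> ?thesis" by (rule has_sum_cong_neutral) auto
  finally show ?thesis .
qed

text \<open>The one-step identity for the monomial is summed against \<open>m\<close>. On one side
  this gives the generating functions; on the other, exchanging sums uses that \<open>m\<close> is
  an eigenmeasure of the kernel, and the column of 0 gives the flux. \<open>h\<close> is kept in one
  piece: it is nonnegative although single \<open>B_r\<close> may be negative, so the exchange can
  take place in \<open>ennreal\<close>.\<close>

lemma gf_equation:
  assumes x: "\<And>s. 0 \<le> x $ s" "\<And>s. x $ s \<le> 1"
    and s0: "(\<lambda>i. m i * monomial x i) summable_on nonzero"
    and s1: "\<And>r. part_summable r x"
  shows "l * gf nonzero m x + (\<Sum>r\<in>UNIV. \<beta> r x * gf_part nonzero m r x) = flux"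
proof -
  let ?g = "gf nonzero m x" and ?p = "\<lambda>r. gf_part nonzero m r x"
  define M where "M i = (if i = 0 then 0 else ennreal (m i))" for i :: "nat ^ 'd"
  define f where "f j = ennreal (if j = 0 then 0 else monomial x j)" for j :: "nat ^ 'd"
  define h where "h i = monomial x i + drift x i / rate"
    for i
  have h_nn: "h i \<ge> 0" for i unfolding h_def by (rule kop_K_monomial(2)[OF x])
  have mon: "monomial x i \<ge> 0" for i by (rule monomial_nonneg[OF x(1)])
  have g0: "((\<lambda>i. m i * monomial x i) has_sum ?g) nonzero"
    unfolding gf_def using s0 by (rule has_sum_infsum)
  have g_nn: "?g \<ge> 0" using g0 by (rule has_sum_nonneg) (use m_pos mon in \<open>auto simp: less_imp_le\<close>)
  have "((\<lambda>i. \<Sum>r\<in>UNIV. \<beta> r x * (if i $ r > 0 then m i * monomial x (i - axis r 1) else 0))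
      has_sum (\<Sum>r\<in>UNIV. \<beta> r x * ?p r)) nonzero"
    by (intro has_sum_sum_family has_sum_cmult_right gf_part_has_sum s1) auto
  from has_sum_add[OF g0 has_sum_cmult_right[OF this, of "1 / rate"]]
  have "((\<lambda>i. m i * monomial x i + 1 / rate * (\<Sum>r\<in>UNIV. \<beta> r x *
        (if i $ r > 0 then m i * monomial x (i - axis r 1) else 0)))
      has_sum (?g + 1 / rate * (\<Sum>r\<in>UNIV. \<beta> r x * ?p r))) nonzero" .
  moreover have "m i * monomial x i + 1 / rate * (\<Sum>r\<in>UNIV. \<beta> r x *
        (if i $ r > 0 then m i * monomial x (i - axis r 1) else 0)) = m i * h i" for i
  proof -
    have "(\<Sum>r\<in>UNIV. \<beta> r x * (if i $ r > 0 then m i * monomial x (i - axis r 1) else 0))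
      = (\<Sum>r | i $ r > 0. \<beta> r x * (m i * monomial x (i - axis r 1)))"
      by (rule sum.mono_neutral_cong_right) auto
    also have "\<dots> = m i * drift x i" by (simp add: sum_distrib_left mult_ac)
    finally show ?thesis by (simp add: h_def algebra_simps)
  qed
  ultimately have hs: "((\<lambda>i. m i * h i) has_sum (?g + 1 / rate * (\<Sum>r\<in>UNIV. \<beta> r x * ?p r))) nonzero"
    by simp
  let ?V = "?g + 1 / rate * (\<Sum>r\<in>UNIV. \<beta> r x * ?p r)"
  have V: "?V \<ge> 0" using hs by (rule has_sum_nonneg) (use m_pos h_nn in \<open>auto simp: less_imp_le\<close>)
  have MC: "(\<integral>\<^sup>+ i. ennreal (m i * w i) \<partial>count_space nonzero) = (\<Sum>\<^sup>+ i. M i * ennreal (w i))"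
    if "\<And>i. w i \<ge> 0" for w
    using m_pos that by (subst nn_integral_count_space_indicator)
       (auto intro!: nn_integral_cong simp: M_def indicator_def ennreal_mult less_imp_le)
  have "ennreal ?V = (\<integral>\<^sup>+ i. ennreal (m i * h i) \<partial>count_space nonzero)"
    using hs V m_pos h_nn by (subst (asm) has_sum_iff_nn_integral) (auto simp: less_imp_le)
  also have "\<dots> = (\<Sum>\<^sup>+ i. M i * ennreal (h i))" by (rule MC[OF h_nn])
  also have "\<dots> = (\<Sum>\<^sup>+ i. M i * kop K f i + M i * K i 0)"
  proof (intro nn_integral_cong)
    fix i
    have "ennreal (h i) = kop K f i + K i 0"
      unfolding h_def f_def using kop_off_zero[OF x, of i] by simp
    then show "M i * ennreal (h i) = M i * kop K f i + M i * K i 0" by (simp add: distrib_left)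
  qed
  also have "\<dots> = (\<Sum>\<^sup>+ i. M i * kop K f i) + (\<Sum>\<^sup>+ i. M i * K i 0)" by (intro nn_integral_add) auto
  also have "(\<Sum>\<^sup>+ i. M i * kop K f i) = ennreal ((rate - l) / rate * ?g)"
  proof -
    have "(\<Sum>\<^sup>+ i. M i * kop K f i) = (\<Sum>\<^sup>+ i. \<Sum>\<^sup>+ j. M i * K i j * f j)"
      unfolding kop_def by (simp add: nn_integral_cmult mult.assoc)
    also have "\<dots> = (\<Sum>\<^sup>+ j. (\<Sum>\<^sup>+ i. M i * K i j) * f j)"
      by (subst nn_integral_count_space_swap) (simp add: nn_integral_multc)
    also have "\<dots> = (\<Sum>\<^sup>+ j. ennreal ((rate - l) / rate) * (M j * ennreal (monomial x j)))"
    proof (intro nn_integral_cong)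
      fix j
      show "(\<Sum>\<^sup>+ i. M i * K i j) * f j
        = ennreal ((rate - l) / rate) * (M j * ennreal (monomial x j))"
      proof (cases "j = 0")
        case True
        then show ?thesis by (simp add: f_def M_def)
      next
        case False
        have "(\<Sum>\<^sup>+ i. M i * K i j) = ennreal ((rate - l) / rate) * M j"
          unfolding M_def by (rule kernel_eigen[OF False])
        then show ?thesis using False by (simp add: f_def mult.assoc)
      qed
    qed
    also have "\<dots> = ennreal ((rate - l) / rate) * (\<integral>\<^sup>+ i. ennreal (m i * monomial x i) \<partial>count_space nonzero)"
      by (simp add: nn_integral_cmult MC[OF mon])
    also have "(\<integral>\<^sup>+ i. ennreal (m i * monomial x i) \<partial>count_space nonzero) = ennreal ?g"
      using g0 g_nn m_pos mon by (subst (asm) has_sum_iff_nn_integral) (auto simp: less_imp_le)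
    also have "ennreal ((rate - l) / rate) * ennreal ?g = ennreal ((rate - l) / rate * ?g)"
      using l g_nn by (intro ennreal_mult[symmetric]) auto
    finally show ?thesis .
  qed
  also have "(\<Sum>\<^sup>+ i. M i * K i 0) = ennreal (flux / rate)"
  proof -
    have "M i * K i 0 = ennreal (m i) * (if i = 0 then 0 else K i 0)" for i by (simp add: M_def)
    then show ?thesis using nn_sum_column[of "\<lambda>i. ennreal (m i)" m 0] m_pos exit_flux by (simp add: less_imp_le)
  qed
  also have "ennreal ((rate - l) / rate * ?g) + ennreal (flux / rate) = ennreal ((rate - l) / rate * ?g + flux / rate)"
    using l g_nn flux_pos rate_pos by (intro ennreal_plus[symmetric]) auto
  finally have "?V = (rate - l) / rate * ?g + flux / rate"
    using V l g_nn flux_pos rate_pos by (subst (asm) ennreal_inj) (auto intro!: add_nonneg_nonneg)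
  then have "rate * ?V = rate * ((rate - l) / rate * ?g + flux / rate)" by simp
  then have "rate * (l * ?g + (\<Sum>r\<in>UNIV. \<beta> r x * ?p r)) = rate * flux"
    using rate_pos by (simp add: field_simps)
  then show ?thesis using rate_pos by simp
qed

lemma monomial_mono: "(\<And>s. 0 \<le> x $ s) \<Longrightarrow> (\<And>s. x $ s \<le> y $ s) \<Longrightarrow> monomial x i \<le> monomial y i"
  unfolding monomial_def by (intro prod_mono) (auto intro: power_mono)

lemma mass_bound':
  assumes "finite A" "0 \<notin> A"
  shows "(\<Sum>j\<in>A. m j * (l * monomial (approx n) j + drift (approx n) j)) \<le> flux"
  using mass_bound[OF assms, of n] exit_flux rate_pos by simp

lemma approx_monomial_nonneg: "monomial (approx n) i \<ge> 0"
  by (rule monomial_nonneg) (rule approx_bounds)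

text \<open>Take an iterate \<open>y\<close> above \<open>x\<close> with all \<open>B_r(y)\<close>
  positive. The drift part of \<open>mass_bound\<close> then bounds the \<open>r\<close>th part by
  \<open>flux / B_r(y)\<close>; the part with factor \<open>l\<close> could not be used, as
  \<open>l\<close> may be 0.\<close>

lemma summable_below_min_root:
  assumes x: "\<And>s. 0 \<le> x $ s" "\<And>s. x $ s < qmin $ s"
  shows "(\<lambda>i. m i * monomial x i) summable_on nonzero"
    and "part_summable r x"
proof -
  obtain N where N: "\<And>n r. n \<ge> N \<Longrightarrow> approx n $ r < approx (Suc n) $ r" by (rule approx_strict) blast
  have "\<forall>\<^sub>F n in sequentially. x $ s < approx n $ s" for s
    using order_tendstoD(1)[OF min_root_props(1) x(2)] .
  then have "\<forall>\<^sub>F n in sequentially. (\<forall>s. x $ s < approx n $ s) \<and> n \<ge> N"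
    by (intro eventually_conj eventually_ge_at_top) (simp add: eventually_all_finite)
  then obtain n where n: "\<And>s. x $ s < approx n $ s" "n \<ge> N"
    by (metis (mono_tags, lifting) eventually_happens sequentially_bot)
  define y where "y = approx n"
  have By: "\<beta> r y > 0" for r
    unfolding y_def B_approx using N[OF n(2), of r] rate_pos by simp
  have mon: "monomial y i \<ge> 0" for i unfolding y_def by (rule approx_monomial_nonneg)
  have monx: "monomial x i \<ge> 0" for i by (rule monomial_nonneg[OF x(1)])
  have xy: "monomial x i \<le> monomial y i" for i
    by (rule monomial_mono) (use x n in \<open>auto simp: y_def less_imp_le\<close>)
  have m_nn: "i \<noteq> 0 \<Longrightarrow> m i \<ge> 0" for i using m_pos[of i] by simp
  have part: "part_summable r x" for r
  proof (rule nonneg_bdd_above_summable_on)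
    show "0 \<le> m i * monomial x (i - axis r 1)" if "i \<in> {i \<in> nonzero. i $ r > 0}" for i
      using that m_nn monx by auto
    show "bdd_above (sum (\<lambda>i. m i * monomial x (i - axis r 1)) ` {A. A \<subseteq> {i \<in> nonzero. i $ r > 0} \<and> finite A})"
    proof (rule bdd_aboveI2)
      fix A :: "(nat ^ 'd) set" assume A: "A \<in> {A. A \<subseteq> {i \<in> nonzero. i $ r > 0} \<and> finite A}"
      have "\<beta> r y * (\<Sum>i\<in>A. m i * monomial x (i - axis r 1))
        = (\<Sum>i\<in>A. m i * (\<beta> r y * monomial x (i - axis r 1)))"
        by (simp add: sum_distrib_left mult_ac)
      also have "\<dots> \<le> (\<Sum>i\<in>A. m i * (l * monomial y i + drift y i))"
      proof (intro sum_mono mult_left_mono)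
        fix i assume i: "i \<in> A"
        have "\<beta> r y * monomial x (i - axis r 1) \<le> \<beta> r y * monomial y (i - axis r 1)"
          using By[of r] xy by (intro mult_left_mono) auto
        also have "\<dots> \<le> drift y i" using i A By mon by (intro member_le_sum) (auto simp: less_imp_le)
        also have "\<dots> \<le> l * monomial y i + drift y i" using l mon[of i] by simp
        finally show "\<beta> r y * monomial x (i - axis r 1) \<le> l * monomial y i + drift y i" .
        show "0 \<le> m i" using i A m_nn by auto
      qed
      also have "\<dots> \<le> flux" unfolding y_def by (rule mass_bound') (use A in auto)
      finally show "(\<Sum>i\<in>A. m i * monomial x (i - axis r 1)) \<le> flux / \<beta> r y"
        using By[of r] by (simp add: field_simps)
    qed
  qed
  then show "part_summable r x" .
  \<comment> \<open>Every nonzero \<open>i\<close> has a positive coordinate \<open>r\<close>, and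
    then \<open>x^i\<close> equals \<open>x_r x^(i - e_r)\<close>; so the full series is dominated
    by a combination of the parts.\<close>
  have "((\<lambda>i. \<Sum>r\<in>UNIV. x $ r * (if i $ r > 0 then m i * monomial x (i - axis r 1) else 0))
      has_sum (\<Sum>r\<in>UNIV. x $ r * gf_part nonzero m r x)) nonzero"
    by (intro has_sum_sum_family has_sum_cmult_right gf_part_has_sum part) auto
  then have "(\<lambda>i. \<Sum>r\<in>UNIV. x $ r * (if i $ r > 0 then m i * monomial x (i - axis r 1) else 0)) summable_on nonzero"
    by (rule has_sum_imp_summable)
  then show "(\<lambda>i. m i * monomial x i) summable_on nonzero"
  proof (rule summable_on_comparison_test)
    fix i :: "nat ^ 'd" assume i: "i \<in> nonzero"
    then show "0 \<le> m i * monomial x i" using m_nn monx by auto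
    obtain r where r: "i $ r > 0" using ex_pos_component[of i] i by auto
    have "m i * monomial x i = x $ r * (if i $ r > 0 then m i * monomial x (i - axis r 1) else 0)"
      using r monomial_split[OF r, of x] by simp
    also have "\<dots> \<le> (\<Sum>r\<in>UNIV. x $ r * (if i $ r > 0 then m i * monomial x (i - axis r 1) else 0))"
      using i m_nn monx x(1) by (intro member_le_sum) auto
    finally show "m i * monomial x i \<le> \<dots>" .
  qed
qed

text \<open>Here the term with factor \<open>l\<close> is kept and the nonnegative drift dropped.
  The iterates tend to 1, so on each finite set \<open>mass_bound\<close> becomes
  \<open>l * sum m A \<le> flux\<close> in the limit.\<close>

lemma convergent_if:
  assumes "rho lam mu gam 1 < 0" "0 < l"
  shows "m summable_on nonzero"
proof (rule nonneg_bdd_above_summable_on)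
  show "0 \<le> m i" if "i \<in> nonzero" for i using m_pos[of i] that by simp
  show "bdd_above (sum m ` {A. A \<subseteq> nonzero \<and> finite A})"
  proof (rule bdd_aboveI2)
    fix A :: "(nat ^ 'd) set" assume A: "A \<in> {A. A \<subseteq> nonzero \<and> finite A}"
    have "(\<Sum>j\<in>A. m j * (l * monomial (approx n) j)) \<le> flux" for n
    proof -
      have "(\<Sum>j\<in>A. m j * (l * monomial (approx n) j)) \<le> (\<Sum>j\<in>A. m j * (l * monomial (approx n) j
          + drift (approx n) j))"
      proof (intro sum_mono mult_left_mono)
        fix j assume "j \<in> A"
        then have "j \<noteq> 0" using A by auto
        then show "0 \<le> m j" using m_pos[of j] by simp
        show "l * monomial (approx n) j \<le> l * monomial (approx n) j + drift (approx n) j"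
          using B_approx_nonneg approx_monomial_nonneg by (simp add: sum_nonneg)
      qed
      also have "\<dots> \<le> flux" by (rule mass_bound') (use A in auto)
      finally show ?thesis .
    qed
    moreover have "(\<lambda>n. \<Sum>j\<in>A. m j * (l * monomial (approx n) j)) \<longlonglongrightarrow> (\<Sum>j\<in>A. m j * (l * 1))"
    proof -
      have "(\<lambda>n. approx n $ r) \<longlonglongrightarrow> 1" for r
        using min_root_props(1)[of r] min_root_eq_1[OF assms(1)] by simp
      then have "(\<lambda>n. monomial (approx n) j) \<longlonglongrightarrow> (\<Prod>r\<in>UNIV. 1 ^ (j $ r))" for j :: "nat ^ 'd"
        unfolding monomial_def by (intro tendsto_intros)
      then have "(\<lambda>n. monomial (approx n) j) \<longlonglongrightarrow> 1" for j :: "nat ^ 'd" by simp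
      then show ?thesis by (intro tendsto_intros)
    qed
    ultimately have "(\<Sum>j\<in>A. m j * (l * 1)) \<le> flux" by (intro LIMSEQ_le_const2) auto
    then show "sum m A \<le> flux / l"
      using assms(2) by (simp add: field_simps flip: sum_distrib_left sum_distrib_right)
  qed
qed

text \<open>With finite mass the equation is available on the whole closed cube. At
  \<open>x = 1\<close> it says that \<open>l\<close> times the mass is the positive flux, hence
  \<open>l > 0\<close>; subtracting the equation at points near 1 leads to the condition on
  \<open>rho\<close>.\<close>

lemma convergent_only_if:
  assumes sm: "m summable_on nonzero"
  shows "0 < l" "rho lam mu gam 1 < 0"
proof -
  define T where "T = infsum m nonzero"
  have m_nn: "i \<noteq> 0 \<Longrightarrow> m i \<ge> 0" for i using m_pos[of i] by simp
  have mT: "(m has_sum T) nonzero" unfolding T_def using sm by (rule has_sum_infsum)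
  have T: "T \<ge> 0" using mT by (rule has_sum_nonneg) (use m_nn in auto)
  have s0: "(\<lambda>i. m i * monomial x i) summable_on nonzero"
    and s1: "part_summable r x"
    and p1: "0 \<le> gf_part nonzero m r x" "gf_part nonzero m r x \<le> T"
    if x: "\<And>s. 0 \<le> x $ s" "\<And>s. x $ s \<le> 1" for x r
  proof -
    have le: "m i * monomial x j \<le> m i" "0 \<le> m i * monomial x j" if "i \<noteq> 0" for i j
      using m_nn[OF that] monomial_le_1[OF x, of j] monomial_nonneg[OF x(1), of j]
      by (auto intro: mult_left_le)
    show "(\<lambda>i. m i * monomial x i) summable_on nonzero"
      by (rule summable_on_comparison_test[OF sm]) (use le in auto)
    have "m summable_on {i \<in> nonzero. i $ r > 0}" by (rule summable_on_subset_banach[OF sm]) auto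
    then show s1: "part_summable r x"
      by (rule summable_on_comparison_test) (use le in auto)
    show "0 \<le> gf_part nonzero m r x" unfolding gf_part_def by (rule infsum_nonneg) (use le in auto)
    show "gf_part nonzero m r x \<le> T"
      unfolding gf_part_def T_def by (rule infsum_mono_neutral[OF s1 sm]) (use le m_nn in auto)
  qed
  have eq: "l * gf nonzero m x + (\<Sum>r\<in>UNIV. \<beta> r x * gf_part nonzero m r x) = flux"
    if x: "\<And>s. 0 \<le> x $ s" "\<And>s. x $ s \<le> 1" for x
    by (rule gf_equation[OF x s0[OF x] s1[OF x]])
  have "gf nonzero m 1 = T" unfolding gf_def T_def by (intro infsum_cong) (simp add: monomial_def)
  then have eq1: "l * T = flux" using eq[of 1] by (simp add: B_1)
  then show "0 < l" using flux_pos T l(1) by (metis less_eq_real_def mult_zero_left)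
  show "rho lam mu gam 1 < 0"
  proof (rule ccontr)
    assume "\<not> rho lam mu gam 1 < 0"
    then obtain v where v: "\<And>r. v $ r > 0" and vN: "\<And>e. e > 0 \<Longrightarrow> \<exists>N. \<forall>r. - (tangent N *v v) $ r \<le> e"
      by (rule rho_nonneg_direction) blast
    define r1 where "r1 = (undefined :: 'd)"
    \<comment> \<open>The unit vector \<open>e_r1\<close> alone contributes \<open>c * e\<close> to
      \<open>l (M(1) - M(1 - e v))\<close>, a linear lower bound.\<close>
    define c where "c = l * m (axis r1 1) * v $ r1"
    have c: "c > 0" using \<open>0 < l\<close> m_pos[OF axis_ne_0] v by (simp add: c_def)
    define vm where "vm = Max (range (($) v))"
    have vm: "v $ s \<le> vm" for s unfolding vm_def by (intro Max_ge) auto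
    have vm_pos: "vm > 0" using v[of r1] vm[of r1] by linarith
    have step: "c \<le> (\<Sum>r\<in>UNIV. max 0 (secant N v r e / e) * T)" if e: "0 < e" "e < 1 / vm" for N e
    proof -
      define x where "x = (\<chi> s. 1 - e * v $ s)"
      have xs: "x $ s = 1 - e * v $ s" for s by (simp add: x_def)
      have x: "0 \<le> x $ s" "x $ s \<le> 1" for s
      proof -
        have "e * v $ s \<le> e * vm" using vm e by (intro mult_left_mono) auto
        also have "\<dots> < 1" using e vm_pos by (simp add: field_simps)
        finally show "0 \<le> x $ s" by (simp add: xs)
        show "x $ s \<le> 1" using v[of s] e by (simp add: xs)
      qed
      have "m (axis r1 1) * (e * v $ r1) \<le> T - gf nonzero m x"
      proof -
        have "((\<lambda>i. m i - m i * monomial x i) has_sum (T - gf nonzero m x)) nonzero"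
          using has_sum_add[OF mT has_sum_cmult_right[OF has_sum_infsum[OF s0[OF x]], of "-1"]]
          by (simp add: gf_def)
        from finite_sum_le_has_sum[OF this, of "{axis r1 1}"]
        show ?thesis using m_nn monomial_le_1[OF x] axis_ne_0[of r1]
          by (auto simp: monomial_axis xs algebra_simps intro!: mult_left_le)
      qed
      then have "l * (m (axis r1 1) * (e * v $ r1)) \<le> l * (T - gf nonzero m x)"
        using l by (intro mult_left_mono)
      also have "\<dots> = (\<Sum>r\<in>UNIV. \<beta> r x * gf_part nonzero m r x)"
        using eq[OF x] eq1 by (simp add: algebra_simps)
      \<comment> \<open>Of the parts of \<open>M\<close> only bounds between 0 and \<open>T\<close>
        are known, so negative values of \<open>secant\<close> have to be replaced by 0.\<close>
      also have "\<dots> \<le> (\<Sum>r\<in>UNIV. max 0 (secant N v r e) * T)"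
      proof (intro sum_mono)
        fix r
        have "\<beta> r x \<le> secant N v r e"
          by (rule B_tangent_upper[OF xs x])
        then have "\<beta> r x * gf_part nonzero m r x \<le> max 0 (secant N v r e) * gf_part nonzero m r x"
          using p1(1)[OF x] by (intro mult_right_mono) auto
        also have "\<dots> \<le> max 0 (secant N v r e) * T" using p1(2)[OF x] by (intro mult_left_mono) auto
        finally show "\<beta> r x * gf_part nonzero m r x \<le> max 0 (secant N v r e) * T" .
      qed
      also have "\<dots> = e * (\<Sum>r\<in>UNIV. max 0 (secant N v r e / e) * T)"
        unfolding sum_distrib_left using e by (intro sum.cong) (auto simp: max_def field_simps)
      finally show ?thesis using e by (simp add: c_def mult_ac)
    qed
    have lim: "c \<le> (\<Sum>r\<in>UNIV. max 0 (- (tangent N *v v) $ r) * T)" for N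
    proof (rule tendsto_lowerbound)
      show "((\<lambda>e. \<Sum>r\<in>UNIV. max 0 (secant N v r e / e) * T) \<longlongrightarrow>
          (\<Sum>r\<in>UNIV. max 0 (- (tangent N *v v) $ r) * T)) (at_right 0)"
        by (intro tendsto_intros tangent_limit)
      show "\<forall>\<^sub>F e in at_right 0. c \<le> (\<Sum>r\<in>UNIV. max 0 (secant N v r e / e) * T)"
        using step vm_pos by (intro eventually_at_rightI[of 0 "1 / vm"]) auto
    qed simp
    \<comment> \<open>The summand 1 keeps the divisor positive. With tolerance
      \<open>c / (2 d)\<close>, the sum over all coordinates stays below \<open>c / 2\<close>,
      contradicting \<open>lim\<close>.\<close>
    define d where "d = real (CARD('d)) * T + 1"
    have d: "d > 0" using T by (simp add: d_def add_nonneg_pos)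
    obtain N where N: "\<And>r. - (tangent N *v v) $ r \<le> c / (2 * d)"
      using vN[of "c / (2 * d)"] c d by auto
    have "c \<le> (\<Sum>r\<in>(UNIV :: 'd set). c / (2 * d) * T)"
      using N c d T by (intro order_trans[OF lim[of N]] sum_mono mult_right_mono) auto
    also have "\<dots> = c * (real (CARD('d)) * T) / (2 * d)" by simp
    also have "\<dots> \<le> c * d / (2 * d)"
      using c d by (intro divide_right_mono mult_left_mono) (auto simp: d_def)
    also have "\<dots> = c / 2" using d by simp
    finally show False using c by simp
  qed
qed

end

section \<open>Invariance for the transition function\<close>

locale process_eigenmeasure = network_process lam mu gam P + eigenmeasure lam mu gam m l
  for lam :: "'d::finite \<Rightarrow> nat \<Rightarrow> real" and mu :: "'d \<Rightarrow> real" and gam :: "'d \<Rightarrow> 'd option \<Rightarrow> real"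
    and P :: "real \<Rightarrow> nat ^ 'd \<Rightarrow> nat ^ 'd \<Rightarrow> real" and m :: "nat ^ 'd \<Rightarrow> real" and l :: real
begin

text \<open>Each kernel step multiplies the measure by \<open>q\<close>, so averaging over the
  Poisson clock gives \<open>exp (- rate t (1 - q))\<close>, which is \<open>exp (- l t)\<close>.
  The mass that has reached 0 does not disturb this, since no path returns from there.\<close>

lemma invariant_measure_P_eigen: "invariant_measure_P nonzero P l m"
proof -
  define q where "q = (rate - l) / rate"
  have q: "0 < q" using l by (simp add: q_def)
  define M where "M i = (if i = 0 then 0 else ennreal (m i))" for i :: "nat ^ 'd"
  have MK: "(\<Sum>\<^sup>+ i. M i * K i j) = ennreal q * M j" if "j \<noteq> 0" for j
    unfolding M_def q_def by (rule kernel_eigen[OF that])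
  have Mk: "(\<Sum>\<^sup>+ i. M i * kpow K n i j) = ennreal (q ^ n) * M j" if "j \<noteq> 0" for n j
  proof (induction n)
    case 0
    have "(\<Sum>\<^sup>+ i. M i * kpow K 0 i j) = (\<Sum>\<^sup>+ i. M i * indicator {j} i)" by (simp add: kpow_0)
    then show ?case by simp
  next
    case (Suc n)
    have "(\<Sum>\<^sup>+ i. M i * kpow K (Suc n) i j) = (\<Sum>\<^sup>+ i. \<Sum>\<^sup>+ k. M i * K i k * kpow K n k j)"
      unfolding kpow_Suc by (simp add: nn_integral_cmult mult.assoc)
    also have "\<dots> = (\<Sum>\<^sup>+ k. (\<Sum>\<^sup>+ i. M i * K i k) * kpow K n k j)"
      by (subst nn_integral_count_space_swap) (simp add: nn_integral_multc)
    also have "\<dots> = (\<Sum>\<^sup>+ k. ennreal q * (M k * kpow K n k j))"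
    proof (intro nn_integral_cong)
      fix k
      show "(\<Sum>\<^sup>+ i. M i * K i k) * kpow K n k j = ennreal q * (M k * kpow K n k j)"
        using MK[of k] kpow_absorbing[OF that, of n] by (cases "k = 0") (auto simp: mult.assoc)
    qed
    also have "\<dots> = ennreal (q ^ Suc n) * M j"
      using q by (simp add: nn_integral_cmult Suc ennreal_mult mult.assoc)
    finally show ?case .
  qed
  have "((\<lambda>i. m i * P t i j) has_sum (exp (- l * t) * m j)) nonzero"
    if j: "j \<noteq> 0" and t: "t \<ge> 0" for j t
  proof -
    define w where "w n = poisson_weight (rate * t) n" for n
    have w: "w n \<ge> 0" for n using rate_pos t by (simp add: w_def)
    have "(\<integral>\<^sup>+ i. ennreal (m i * P t i j) \<partial>count_space nonzero)
      = (\<Sum>\<^sup>+ i. M i * ennreal (P t i j))"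
      using m_pos P_nonneg[OF t] by (subst nn_integral_count_space_indicator)
         (auto intro!: nn_integral_cong simp: M_def indicator_def ennreal_mult less_imp_le)
    also have "\<dots> = (\<Sum>\<^sup>+ i. (\<Sum>n. ennreal (w n) * (M i * kpow K n i j)))" by (intro nn_integral_cong)
         (simp add: P_uniformization[OF t] w_def mult.left_commute flip: ennreal_suminf_cmult)
    also have "\<dots> = (\<Sum>n. ennreal (w n) * (ennreal (q ^ n) * M j))"
      by (subst nn_integral_suminf) (simp_all add: nn_integral_cmult Mk[OF j])
    also have "\<dots> = (\<Sum>n. ennreal (exp (- (rate * t)) * m j * ((rate * t * q) ^ n / fact n)))"
      using w q m_pos[OF j] j by (intro suminf_cong)
        (simp add: M_def w_def power_mult_distrib mult_ac flip: ennreal_mult)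
    also have "\<dots> = ennreal (exp (- (rate * t)) * m j * exp (rate * t * q))"
    proof (rule suminf_ennreal_eq)
      show "0 \<le> exp (- (rate * t)) * m j * ((rate * t * q) ^ n / fact n)" for n
        using rate_pos t q m_pos[OF j] by auto
      have "(\<lambda>n. (rate * t * q) ^ n / fact n) sums exp (rate * t * q)"
        using exp_converges[of "rate * t * q"] by (simp add: field_simps)
      then show "(\<lambda>n. exp (- (rate * t)) * m j * ((rate * t * q) ^ n / fact n)) sums
          (exp (- (rate * t)) * m j * exp (rate * t * q))" by (rule sums_mult)
    qed
    also have "exp (- (rate * t)) * m j * exp (rate * t * q) = exp (- l * t) * m j"
    proof -
      have "rate * t * q = rate * t - l * t" using rate_pos by (simp add: q_def field_simps)
      then have "exp (- (rate * t)) * exp (rate * t * q) = exp (- l * t)" by (simp flip: exp_add)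
      then show ?thesis by (simp only: mult.commute mult.left_commute)
    qed
    finally show ?thesis
      using m_pos P_nonneg[OF t] j by (subst has_sum_iff_nn_integral) (auto simp: less_imp_le)
  qed
  then show ?thesis using m_pos by (auto simp: invariant_measure_P_def)
qed

end

section \<open>Existence of the eigenmeasure\<close>

context network_process
begin

lemma ex_eigenmeasure:
  assumes l: "0 \<le> l" "ereal l \<le> decay_parameter (UNIV - {0}) P"
  obtains m where "eigenmeasure lam mu gam m l"
proof -
  obtain ls where ls: "\<And>n. ls n \<in> green_rates" "ls \<longlonglongrightarrow> l" and lr: "l < rate"
    using approximating_rates[OF l] by blast
  define R where "R = rate / (rate - l)"
  have lim: "(\<lambda>n. rate / (rate - ls n)) \<longlonglongrightarrow> R"
    unfolding R_def using ls(2) lr by (intro tendsto_intros) auto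
  have ge: "1 \<le> rate / (rate - ls n)" for n using ls(1)[of n] by (auto simp: green_rates_def)
  have fin: "green K (rate / (rate - ls n)) i j < \<infinity>" if "i \<noteq> 0" "j \<noteq> 0" for n i j
    using ls(1)[of n] that by (auto simp: green_rates_def)
  obtain m where m_pos: "\<And>i. i \<noteq> 0 \<Longrightarrow> m i > 0"
    and eig: "\<And>j. j \<noteq> 0 \<Longrightarrow> m j = R * column_sum m j"
    and bd: "\<And>f D A. test_pair f D \<Longrightarrow> finite A \<Longrightarrow> 0 \<notin> A \<Longrightarrow>
      (\<Sum>j\<in>A. m j * ((R - 1) * f j + R * D j)) \<le> R * column_sum m 0"
  proof (rule exists_invariant_measure[of "\<lambda>n. rate / (rate - ls n)" R], goal_cases)
    case (4 m)
    show ?case by (rule that) (fact 4)+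
  qed (use ge lim fin in auto)
  obtain N where N: "\<And>n r. n \<ge> N \<Longrightarrow> approx n $ r < approx (Suc n) $ r" by (rule approx_strict) blast
  have "eigenmeasure lam mu gam m l"
  proof
    show "0 \<le> l" "l < rate" by (fact l lr)+
    show "m i > 0" if "i \<noteq> 0" for i by (rule m_pos[OF that])
    show "m j = rate / (rate - l) * column_sum m j" if "j \<noteq> 0" for j
      using eig[OF that] by (simp add: R_def)
    fix n and A :: "(nat ^ 'd) set" assume A: "finite A" "0 \<notin> A"
    define y where "y = approx n"
    have y: "0 \<le> y $ s" "y $ s \<le> 1" for s by (auto simp: y_def approx_bounds)
    \<comment> \<open>Strict growth is known only from \<open>N\<close> on, so the iterate is first
      compared with a later one, which lies strictly below its successor.\<close>
    have y1: "y $ s < 1" for s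
    proof -
      have "approx n $ s \<le> approx (max n N) $ s"
        by (rule lift_Suc_mono_le[of "\<lambda>n. approx n $ s"]) (auto intro: approx_mono)
      also have "\<dots> < approx (Suc (max n N)) $ s" by (rule N) simp
      also have "\<dots> \<le> 1" by (rule approx_bounds)
      finally show ?thesis by (simp add: y_def)
    qed
    define f where "f j = (if j = 0 then 0 else monomial y j)" for j :: "nat ^ 'd"
    define D where "D j = (if j = 0 then 0 else (drift y j) / rate)" for j :: "nat ^ 'd"
    have bound: "(\<Sum>j\<in>A. m j * ((R - 1) * f j + R * D j)) \<le> R * column_sum m 0"
    proof (rule bd[OF _ A], unfold test_pair_def, intro conjI allI impI)
      show "0 \<le> f i" "f i \<le> 1" for i
        using monomial_nonneg[OF y(1), of i] monomial_le_1[OF y, of i] by (auto simp: f_def)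
      show "f 0 = 0" "D 0 = 0" by (simp_all add: f_def D_def)
      show "finite {i. f i > e}" if "e > 0" for e
        by (rule finite_subset[OF _ monomial_vanishing[OF y(1) y1 that]]) (use that in \<open>auto simp: f_def\<close>)
      show "0 \<le> D i" for i using B_approx_nonneg rate_pos monomial_nonneg[OF y(1)]
        by (auto simp: D_def y_def intro!: divide_nonneg_pos sum_nonneg mult_nonneg_nonneg)
      show "ennreal (f i + D i) = kop K (\<lambda>j. ennreal (f j)) i + K i 0" if "i \<noteq> 0" for i
        unfolding f_def using that kop_off_zero[OF y, of i] by (simp add: D_def)
    qed
    \<comment> \<open>Multiplication by \<open>rate - l\<close> translates the discrete weights back
      to continuous time: \<open>R - 1\<close> becomes \<open>l\<close> and \<open>R\<close> becomes
      \<open>rate\<close>.\<close>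
    have "(\<Sum>j\<in>A. m j * (l * monomial y j + drift y j))
      = (rate - l) * (\<Sum>j\<in>A. m j * ((R - 1) * f j + R * D j))"
      unfolding sum_distrib_left
    proof (intro sum.cong refl)
      fix j assume "j \<in> A"
      then have j: "j \<noteq> 0" using A by auto
      define X where "X = drift y j"
      have "(rate - l) * (R - 1) = l" "(rate - l) * R = rate" using lr by (simp_all add: R_def field_simps)
      moreover have "f j = monomial y j" "rate * D j = X"
        using j rate_pos by (simp_all add: f_def D_def X_def)
      ultimately have "(rate - l) * ((R - 1) * f j + R * D j) = l * monomial y j + X"
        by (simp only: distrib_left mult.assoc[symmetric])
      then show "m j * (l * monomial y j + X) = (rate - l) * (m j * ((R - 1) * f j + R * D j))"
        by (metis mult.left_commute)
    qed
    also have "\<dots> \<le> (rate - l) * (R * column_sum m 0)" using bound lr by (intro mult_left_mono) auto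
    also have "\<dots> = rate * column_sum m 0" using lr by (simp add: R_def)
    finally show "(\<Sum>j\<in>A. m j * (l * monomial (approx n) j + drift (approx n) j))
        \<le> rate * column_sum m 0"
      unfolding y_def .
  qed
  then show thesis by (rule that)
qed

end

theorem theorem4p2:
  fixes lam :: "'d::finite \<Rightarrow> nat \<Rightarrow> real"
    and mu :: "'d \<Rightarrow> real"
    and gam :: "'d \<Rightarrow> 'd option \<Rightarrow> real"
    and P :: "real \<Rightarrow> nat ^ 'd \<Rightarrow> nat ^ 'd \<Rightarrow> real"
    and C :: "(nat ^ 'd) set"
    and l :: real
  assumes "CARD('d) \<ge> 2"
    and "\<And>r k. k \<ge> 1 \<Longrightarrow> lam r k \<ge> 0"
    and "\<And>r. summable (\<lambda>k. lam r (Suc k))"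
    and "\<And>r. lam_total lam r > 0"
    and "\<And>r. mu r > 0"
    and "\<And>r a. gam r a \<ge> 0"
    and "\<And>r. (\<Sum>a\<in>UNIV. gam r a) = 1"
    and "\<And>r. gam r (Some r) = 0"
    and "\<exists>r. gam r None > 0"
    and "irreducible_nonneg_matrix (\<lambda>r s. gam r (Some s))"
    and "Q_function (gen lam mu gam) P"
    and "C = UNIV - {0}"
    and "0 \<le> l" and "ereal l \<le> decay_parameter C P"
  shows "\<exists>m. invariant_measure_Q C (gen lam mu gam) l m
    \<and> (\<forall>x. (\<forall>s. 0 \<le> x $ s \<and> x $ s < min_root lam mu gam $ s) \<longrightarrow>
          (\<lambda>i. m i * monomial x i) summable_on C
        \<and> (\<forall>r. (\<lambda>i. m i * monomial x (i - axis r 1)) summable_on {i\<in>C. i $ r > 0})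
        \<and> l * gf C m x + (\<Sum>r\<in>UNIV. B lam mu gam r x * gf_part C m r x)
            = (\<Sum>r\<in>UNIV. m (axis r 1) * mu r * gam r None)) \<and> invariant_measure_P C P l m
    \<and> (m summable_on C \<longleftrightarrow> rho lam mu gam 1 < 0 \<and> decay_parameter C P > 0
         \<and> 0 < l \<and> ereal l \<le> decay_parameter C P)"
proof -
  interpret network_process lam mu gam P
    by unfold_locales (use assms in auto)
  obtain m where "eigenmeasure lam mu gam m l"
    using ex_eigenmeasure[of l] assms(12-14) by blast
  then interpret eigenmeasure lam mu gam m l .
  interpret process_eigenmeasure lam mu gam P m l ..
  have C: "C = UNIV - {0}" by (fact assms(12))
  have decay: "decay_parameter C P > 0" if "0 < l"
  proof -
    have "(0::ereal) < ereal l" using that by simp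
    also note assms(14)
    finally show ?thesis .
  qed
  show ?thesis
  proof (intro exI[of _ m] conjI allI impI)
    show "invariant_measure_Q C (gen lam mu gam) l m"
      unfolding C by (rule invariant_measure_Q_eigen)
    show "invariant_measure_P C P l m"
      unfolding C by (rule invariant_measure_P_eigen)
    show "m summable_on C \<longleftrightarrow> rho lam mu gam 1 < 0 \<and> decay_parameter C P > 0
         \<and> 0 < l \<and> ereal l \<le> decay_parameter C P"
      using convergent_if convergent_only_if decay assms(14) unfolding C by blast
    fix x :: "real ^ 'd" assume x: "\<forall>s. 0 \<le> x $ s \<and> x $ s < min_root lam mu gam $ s"
    show s0: "(\<lambda>i. m i * monomial x i) summable_on C"
      unfolding C by (rule summable_below_min_root(1)) (use x in auto)
    show s1: "(\<lambda>i. m i * monomial x (i - axis r 1)) summable_on {i\<in>C. i $ r > 0}" for r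
      unfolding C by (rule summable_below_min_root(2)) (use x in auto)
    have "x $ s \<le> 1" for s using x min_root_bounds(2)[of s] by (meson less_imp_le order_trans)
    then show "l * gf C m x + (\<Sum>r\<in>UNIV. B lam mu gam r x * gf_part C m r x)
            = (\<Sum>r\<in>UNIV. m (axis r 1) * mu r * gam r None)"
      using gf_equation[of x] s0 s1 x unfolding C flux_def by blast
  qed
qed

end
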